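(* Let $f\in L^2(0,T;V^\star)$ and $y_0\in H$. For each mesh parameter $d>0$ let $(y_d,p_d)\in W_d\times Q_d$ denote the solution of the discrete saddle point problem $$\hat a(y_d,w_d)+\hat b(w_d,p_d)=\hat l_1(w_d)\quad\forall w_d\in W_d,\qquad \hat b(y_d,q_d)-\hat c(p_d,q_d)=\hat l_2(q_d)\quad\forall q_d\in Q_d.$$ Then, as $d\to0$, the sequences $(y_d)_d$ and $(p_d)_d$ converge weakly in $W(0,T)\times L^2(0,T;V)$ to the solution $(y,p)\in W(0,T)\times L^2(0,T;V)$ of $$\hat a(y,w)+\hat b(w,p)=\hat l_1(w)\quad\forall w\in W(0,T),\qquad \hat b(y,q)-\hat c(p,q)=\hat l_2(q)\quad\forall q\in L^2(0,T;V).$$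
   Context: $T>0$, $\Omega\subset\mathbb{R}^n$ is a bounded open domain, $n\in\{1,2,3\}$, $V:=H^1_0(\Omega)$, $H:=L^2(\Omega)$, $V^\star=H^{-1}(\Omega)$, with Gelfand triple $V\hookrightarrow H\equiv H^\star\hookrightarrow V^\star$. $a:V\times V\to\mathbb{R}$ is a symmetric, continuous, coercive bilinear form and $V$ carries the inner product $(u,v)_V:=a(u,v)$; $R:V^\star\to V$ is the Riesz lift $(R\phi,v)_V=\langle\phi,v\rangle_{V^\star,V}$ for all $v\in V$, and $V^\star$ carries the inner product $(\phi,\psi)_{V^\star}:=(R\phi,R\psi)_V$. $W(0,T):=\{v\in L^2(0,T;V)\mid v_t\in L^2(0,T;V^\star)\}$ with inner product $(u,v)_{W(0,T)}=\int_0^T(u_t,v_t)_{V^\star}+\int_0^T(u,v)_V$; point values $v(0),v(T)\in H$ are understood via the continuous embedding $W(0,T)\hookrightarrow C([0,T],H)$. $W_d\subset W(0,T)$ and $Q_d\subset L^2(0,T;V)$ are finite-dimensional (finite element) spaces indexed by a mesh size parameter $d>0$ (a sequence of values tending to $0$). Standing assumptions: (0) approximation property: for every $(w,q)\in W(0,T)\times L^2(0,T;V)$ there exist $(w_d,q_d)\in W_d\times Q_d$ with $w_d\to w$ strongly in $W(0,T)$ and $q_d\to q$ strongly in $L^2(0,T;V)$ as $d\to0$; (1) $(w_d)_t\in Q_d$ for all $w_d\in W_d$; (2) the $L^2$-projection $\Pi_d:L^2(0,T;L^2(\Omega))\to Q_d$, defined by $\int_0^T(\Pi_dv,q_d)_H=\int_0^T(v,q_d)_H$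 for all $q_d\in Q_d$, satisfies $\|\Pi_dv\|_{L^2(0,T;V)}\le C_\Pi\|v\|_{L^2(0,T;V)}$ for all $v\in L^2(0,T;V)$ with $C_\Pi>0$ independent of $d$. The forms are: $\hat a(y,w)=(y(T),w(T))_H+\int_0^T(y,w)_V$, $\hat b(w,q)=\int_0^T\langle w_t,q\rangle_{V^\star,V}$, $\hat c(p,q)=\int_0^T(p,q)_V$, $\hat l_1(w)=(y_0,w(0))_H+\int_0^T\langle f,w\rangle_{V^\star,V}$, $\hat l_2(q)=\int_0^T\langle f,q\rangle_{V^\star,V}$. Both the continuous problem and, for each fixed $d>0$, the discrete problem have a unique solution. *)

theory Defs
  imports "HOL-Analysis.Analysis" "HOL-Library.Function_Algebras"
begin

text \<open>
  Elements of Lebesgue, Sobolev and Bochner spaces are represented by functions, not by classes of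
  functions modulo null sets. The spaces are sets of functions, their norms are seminorms
  on representatives, and identity of elements means seminorm distance 0.
\<close>

instantiation "fun" :: (type, scaleR) scaleR
begin
definition scaleR_fun_def: "c *\<^sub>R f = (\<lambda>x. c *\<^sub>R f x)"
instance ..
end

lemma scaleR_fun_apply [simp]: "(c *\<^sub>R f) x = c *\<^sub>R f x"
  by (simp add: scaleR_fun_def)

instance "fun" :: (type, real_vector) real_vector
  by standard (auto simp: fun_eq_iff scaleR_add_right scaleR_add_left)


section \<open>Duals and weak convergence\<close>

definition linear_functional_on :: "'x::real_vector set \<Rightarrow> ('x \<Rightarrow> real) \<Rightarrow> bool" where
  "linear_functional_on X F \<longleftrightarrow>
     (\<forall>x\<in>X. \<forall>y\<in>X. F (x + y) = F x + F y) \<and> (\<forall>c. \<forall>x\<in>X. F (c *\<^sub>R x) = c * F x)"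

definition dual_space :: "'x::real_vector set \<Rightarrow> ('x \<Rightarrow> real) \<Rightarrow> ('x \<Rightarrow> real) set" where
  "dual_space X N = {F. linear_functional_on X F \<and> (\<exists>C. \<forall>x\<in>X. \<bar>F x\<bar> \<le> C * N x)}"

definition weakly_converges ::
  "'x::real_vector set \<Rightarrow> ('x \<Rightarrow> real) \<Rightarrow> (nat \<Rightarrow> 'x) \<Rightarrow> 'x \<Rightarrow> bool" where
  "weakly_converges X N x l \<longleftrightarrow>
     (\<forall>k. x k \<in> X) \<and> l \<in> X \<and> (\<forall>F\<in>dual_space X N. (\<lambda>k. F (x k)) \<longlonglongrightarrow> F l)"


section \<open>Lebesgue and Sobolev spaces on a domain\<close>

primrec C_k :: "nat \<Rightarrow> ('a::euclidean_space \<Rightarrow> real) \<Rightarrow> bool" where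
  "C_k 0 f \<longleftrightarrow> continuous_on UNIV f"
| "C_k (Suc k) f \<longleftrightarrow> (\<forall>x. f differentiable at x) \<and>
     (\<forall>i\<in>Basis. C_k k (\<lambda>x. frechet_derivative f (at x) i))"

definition test_functions :: "'a::euclidean_space set \<Rightarrow> ('a \<Rightarrow> real) set" where
  "test_functions \<Omega> = {\<phi>. (\<forall>k. C_k k \<phi>) \<and> (\<exists>K. compact K \<and> K \<subseteq> \<Omega> \<and> (\<forall>x. x \<notin> K \<longrightarrow> \<phi> x = 0))}"

definition L2 :: "'a::euclidean_space set \<Rightarrow> ('a \<Rightarrow> real) set" where
  "L2 \<Omega> = {u \<in> borel_measurable (lebesgue_on \<Omega>). integrable (lebesgue_on \<Omega>) (\<lambda>x. (u x)\<^sup>2)}"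

definition L2_inner :: "'a::euclidean_space set \<Rightarrow> ('a \<Rightarrow> real) \<Rightarrow> ('a \<Rightarrow> real) \<Rightarrow> real" where
  "L2_inner \<Omega> u v = (LINT x|lebesgue_on \<Omega>. u x * v x)"

definition L2_norm :: "'a::euclidean_space set \<Rightarrow> ('a \<Rightarrow> real) \<Rightarrow> real" where
  "L2_norm \<Omega> u = sqrt (L2_inner \<Omega> u u)"

definition has_weak_pderiv ::
  "'a::euclidean_space set \<Rightarrow> 'a \<Rightarrow> ('a \<Rightarrow> real) \<Rightarrow> ('a \<Rightarrow> real) \<Rightarrow> bool" where
  "has_weak_pderiv \<Omega> i u g \<longleftrightarrow>
     (\<forall>\<phi>\<in>test_functions \<Omega>.
        L2_inner \<Omega> u (\<lambda>x. frechet_derivative \<phi> (at x) i) = - L2_inner \<Omega> g \<phi>)"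

definition weak_pderiv :: "'a::euclidean_space set \<Rightarrow> 'a \<Rightarrow> ('a \<Rightarrow> real) \<Rightarrow> 'a \<Rightarrow> real" where
  "weak_pderiv \<Omega> i u = (SOME g. g \<in> L2 \<Omega> \<and> has_weak_pderiv \<Omega> i u g)"

definition H1 :: "'a::euclidean_space set \<Rightarrow> ('a \<Rightarrow> real) set" where
  "H1 \<Omega> = {u \<in> L2 \<Omega>. \<forall>i\<in>Basis. \<exists>g\<in>L2 \<Omega>. has_weak_pderiv \<Omega> i u g}"

definition H1_norm :: "'a::euclidean_space set \<Rightarrow> ('a \<Rightarrow> real) \<Rightarrow> real" where
  "H1_norm \<Omega> u = sqrt ((L2_norm \<Omega> u)\<^sup>2 + (\<Sum>i\<in>Basis. (L2_norm \<Omega> (weak_pderiv \<Omega> i u))\<^sup>2))"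

definition H10 :: "'a::euclidean_space set \<Rightarrow> ('a \<Rightarrow> real) set" where
  "H10 \<Omega> = {u \<in> H1 \<Omega>. \<exists>\<phi>. (\<forall>k. \<phi> k \<in> test_functions \<Omega>) \<and> (\<lambda>k. H1_norm \<Omega> (u - \<phi> k)) \<longlonglongrightarrow> 0}"


section \<open>The energy inner product on \<open>V\<close> and the Riesz inner product on its dual\<close>

type_synonym 'a form = "('a \<Rightarrow> real) \<Rightarrow> ('a \<Rightarrow> real) \<Rightarrow> real"

definition admissible_form :: "'a::euclidean_space set \<Rightarrow> 'a form \<Rightarrow> bool" where
  "admissible_form \<Omega> a \<longleftrightarrow>
     (\<forall>u\<in>H10 \<Omega>. \<forall>v\<in>H10 \<Omega>. a u v = a v u) \<and>
     (\<forall>u\<in>H10 \<Omega>. linear_functional_on (H10 \<Omega>) (a u)) \<and>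
     (\<forall>v\<in>H10 \<Omega>. linear_functional_on (H10 \<Omega>) (\<lambda>u. a u v)) \<and>
     (\<exists>M. \<forall>u\<in>H10 \<Omega>. \<forall>v\<in>H10 \<Omega>. \<bar>a u v\<bar> \<le> M * H1_norm \<Omega> u * H1_norm \<Omega> v) \<and>
     (\<exists>\<alpha>>0. \<forall>u\<in>H10 \<Omega>. a u u \<ge> \<alpha> * (H1_norm \<Omega> u)\<^sup>2)"

definition V_norm :: "'a form \<Rightarrow> ('a \<Rightarrow> real) \<Rightarrow> real" where
  "V_norm a u = sqrt (a u u)"

definition V_dual :: "'a::euclidean_space set \<Rightarrow> 'a form \<Rightarrow> (('a \<Rightarrow> real) \<Rightarrow> real) set" where
  "V_dual \<Omega> a = dual_space (H10 \<Omega>) (V_norm a)"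

definition riesz_lift :: "'a::euclidean_space set \<Rightarrow> 'a form \<Rightarrow> (('a \<Rightarrow> real) \<Rightarrow> real) \<Rightarrow> 'a \<Rightarrow> real"
where
  "riesz_lift \<Omega> a F = (SOME r. r \<in> H10 \<Omega> \<and> (\<forall>v\<in>H10 \<Omega>. a r v = F v))"

definition V_dual_inner ::
  "'a::euclidean_space set \<Rightarrow> 'a form \<Rightarrow> (('a \<Rightarrow> real) \<Rightarrow> real) \<Rightarrow> (('a \<Rightarrow> real) \<Rightarrow> real) \<Rightarrow> real" where
  "V_dual_inner \<Omega> a F G = a (riesz_lift \<Omega> a F) (riesz_lift \<Omega> a G)"

definition V_dual_norm ::
  "'a::euclidean_space set \<Rightarrow> 'a form \<Rightarrow> (('a \<Rightarrow> real) \<Rightarrow> real) \<Rightarrow> real" where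
  "V_dual_norm \<Omega> a F = sqrt (V_dual_inner \<Omega> a F F)"


section \<open>Bochner spaces on \<open>(0,T)\<close>\<close>

text \<open>
  The library notion of Bochner measurability needs a normed type as codomain; here the codomain
  \<open>X\<close> is a set of functions with a seminorm \<open>N\<close>, so strong measurability (almost
  everywhere limit of simple functions) is spelled out.
\<close>

definition strongly_measurable ::
  "real \<Rightarrow> 'x::real_vector set \<Rightarrow> ('x \<Rightarrow> real) \<Rightarrow> (real \<Rightarrow> 'x) \<Rightarrow> bool" where
  "strongly_measurable T X N v \<longleftrightarrow>
     (\<exists>s. (\<forall>k. simple_function (lebesgue_on {0<..<T}) (s k) \<and> (\<forall>t\<in>{0<..<T}. s k t \<in> X)) \<and>
          (AE t in lebesgue_on {0<..<T}. (\<lambda>k::nat. N (s k t - v t)) \<longlonglongrightarrow> 0))"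

definition Bochner_L2 ::
  "real \<Rightarrow> 'x::real_vector set \<Rightarrow> ('x \<Rightarrow> real) \<Rightarrow> (real \<Rightarrow> 'x) set" where
  "Bochner_L2 T X N = {v. strongly_measurable T X N v \<and>
     (AE t in lebesgue_on {0<..<T}. v t \<in> X) \<and>
     integrable (lebesgue_on {0<..<T}) (\<lambda>t. (N (v t))\<^sup>2)}"

abbreviation L2V :: "'a::euclidean_space set \<Rightarrow> 'a form \<Rightarrow> real \<Rightarrow> (real \<Rightarrow> 'a \<Rightarrow> real) set" where
  "L2V \<Omega> a T \<equiv> Bochner_L2 T (H10 \<Omega>) (V_norm a)"

abbreviation L2V_dual ::
  "'a::euclidean_space set \<Rightarrow> 'a form \<Rightarrow> real \<Rightarrow> (real \<Rightarrow> ('a \<Rightarrow> real) \<Rightarrow> real) set" where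
  "L2V_dual \<Omega> a T \<equiv> Bochner_L2 T (V_dual \<Omega> a) (V_dual_norm \<Omega> a)"

definition L2V_inner ::
  "'a form \<Rightarrow> real \<Rightarrow> (real \<Rightarrow> 'a \<Rightarrow> real) \<Rightarrow> (real \<Rightarrow> 'a \<Rightarrow> real) \<Rightarrow> real" where
  "L2V_inner a T u v = (LINT t|lebesgue_on {0<..<T}. a (u t) (v t))"

definition L2V_norm :: "'a form \<Rightarrow> real \<Rightarrow> (real \<Rightarrow> 'a \<Rightarrow> real) \<Rightarrow> real" where
  "L2V_norm a T v = sqrt (L2V_inner a T v v)"

definition L2H_inner ::
  "'a::euclidean_space set \<Rightarrow> real \<Rightarrow> (real \<Rightarrow> 'a \<Rightarrow> real) \<Rightarrow> (real \<Rightarrow> 'a \<Rightarrow> real) \<Rightarrow> real" where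
  "L2H_inner \<Omega> T u v = (LINT t|lebesgue_on {0<..<T}. L2_inner \<Omega> (u t) (v t))"

definition dual_pairing ::
  "real \<Rightarrow> (real \<Rightarrow> ('a \<Rightarrow> real) \<Rightarrow> real) \<Rightarrow> (real \<Rightarrow> 'a \<Rightarrow> real) \<Rightarrow> real" where
  "dual_pairing T g v = (LINT t|lebesgue_on {0<..<T}. g t (v t))"


section \<open>The space \<open>W(0,T)\<close>\<close>

text \<open>
  The \<open>V\<^sup>*\<close>-valued identity \<open>\<integral> v \<phi>' = - \<integral> g \<phi>\<close>, tested with the elements of \<open>V\<close>; the function
  \<open>v\<close> enters as a \<open>V\<^sup>*\<close>-valued one through the embedding of \<open>H\<close> into \<open>V\<^sup>*\<close>.
\<close>

definition has_weak_time_deriv ::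
  "'a::euclidean_space set \<Rightarrow> real \<Rightarrow> (real \<Rightarrow> 'a \<Rightarrow> real) \<Rightarrow> (real \<Rightarrow> ('a \<Rightarrow> real) \<Rightarrow> real) \<Rightarrow> bool" where
  "has_weak_time_deriv \<Omega> T v g \<longleftrightarrow>
     (\<forall>\<eta>\<in>H10 \<Omega>. \<forall>\<phi>\<in>test_functions {0<..<T}.
        (LINT t|lebesgue_on {0<..<T}. L2_inner \<Omega> (v t) \<eta> * deriv \<phi> t) =
        - (LINT t|lebesgue_on {0<..<T}. g t \<eta> * \<phi> t))"

definition time_deriv ::
  "'a::euclidean_space set \<Rightarrow> 'a form \<Rightarrow> real \<Rightarrow> (real \<Rightarrow> 'a \<Rightarrow> real) \<Rightarrow> real \<Rightarrow> ('a \<Rightarrow> real) \<Rightarrow> real" where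
  "time_deriv \<Omega> a T v = (SOME g. g \<in> L2V_dual \<Omega> a T \<and> has_weak_time_deriv \<Omega> T v g)"

definition W_space :: "'a::euclidean_space set \<Rightarrow> 'a form \<Rightarrow> real \<Rightarrow> (real \<Rightarrow> 'a \<Rightarrow> real) set" where
  "W_space \<Omega> a T = {v \<in> L2V \<Omega> a T. \<exists>g\<in>L2V_dual \<Omega> a T. has_weak_time_deriv \<Omega> T v g}"

definition W_inner ::
  "'a::euclidean_space set \<Rightarrow> 'a form \<Rightarrow> real \<Rightarrow> (real \<Rightarrow> 'a \<Rightarrow> real) \<Rightarrow> (real \<Rightarrow> 'a \<Rightarrow> real) \<Rightarrow> real" where
  "W_inner \<Omega> a T u v =
     (LINT t|lebesgue_on {0<..<T}. V_dual_inner \<Omega> a (time_deriv \<Omega> a T u t) (time_deriv \<Omega> a T v t))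
     + L2V_inner a T u v"

definition W_norm :: "'a::euclidean_space set \<Rightarrow> 'a form \<Rightarrow> real \<Rightarrow> (real \<Rightarrow> 'a \<Rightarrow> real) \<Rightarrow> real" where
  "W_norm \<Omega> a T v = sqrt (W_inner \<Omega> a T v v)"

text \<open>The image of \<open>v\<close> under the embedding of \<open>W(0,T)\<close> into \<open>C([0,T],H)\<close>.\<close>

definition cont_rep ::
  "'a::euclidean_space set \<Rightarrow> real \<Rightarrow> (real \<Rightarrow> 'a \<Rightarrow> real) \<Rightarrow> real \<Rightarrow> 'a \<Rightarrow> real" where
  "cont_rep \<Omega> T v = (SOME u.
     (\<forall>s\<in>{0..T}. u s \<in> L2 \<Omega> \<and> ((\<lambda>t. L2_norm \<Omega> (u t - u s)) \<longlongrightarrow> 0) (at s within {0..T})) \<and>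
     (AE t in lebesgue_on {0<..<T}. L2_norm \<Omega> (v t - u t) = 0))"


section \<open>The saddle point problem\<close>

definition a_hat ::
  "'a::euclidean_space set \<Rightarrow> 'a form \<Rightarrow> real \<Rightarrow> (real \<Rightarrow> 'a \<Rightarrow> real) \<Rightarrow> (real \<Rightarrow> 'a \<Rightarrow> real) \<Rightarrow> real" where
  "a_hat \<Omega> a T y w = L2_inner \<Omega> (cont_rep \<Omega> T y T) (cont_rep \<Omega> T w T) + L2V_inner a T y w"

definition b_hat ::
  "'a::euclidean_space set \<Rightarrow> 'a form \<Rightarrow> real \<Rightarrow> (real \<Rightarrow> 'a \<Rightarrow> real) \<Rightarrow> (real \<Rightarrow> 'a \<Rightarrow> real) \<Rightarrow> real" where
  "b_hat \<Omega> a T w q = dual_pairing T (time_deriv \<Omega> a T w) q"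

definition c_hat :: "'a form \<Rightarrow> real \<Rightarrow> (real \<Rightarrow> 'a \<Rightarrow> real) \<Rightarrow> (real \<Rightarrow> 'a \<Rightarrow> real) \<Rightarrow> real" where
  "c_hat a T p q = L2V_inner a T p q"

definition l1_hat ::
  "'a::euclidean_space set \<Rightarrow> real \<Rightarrow> (real \<Rightarrow> ('a \<Rightarrow> real) \<Rightarrow> real) \<Rightarrow> ('a \<Rightarrow> real) \<Rightarrow>
   (real \<Rightarrow> 'a \<Rightarrow> real) \<Rightarrow> real" where
  "l1_hat \<Omega> T f y0 w = L2_inner \<Omega> y0 (cont_rep \<Omega> T w 0) + dual_pairing T f w"

definition l2_hat ::
  "real \<Rightarrow> (real \<Rightarrow> ('a \<Rightarrow> real) \<Rightarrow> real) \<Rightarrow> (real \<Rightarrow> 'a \<Rightarrow> real) \<Rightarrow> real" where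
  "l2_hat T f q = dual_pairing T f q"

definition saddle_solution ::
  "'a::euclidean_space set \<Rightarrow> 'a form \<Rightarrow> real \<Rightarrow> (real \<Rightarrow> ('a \<Rightarrow> real) \<Rightarrow> real) \<Rightarrow> ('a \<Rightarrow> real) \<Rightarrow>
   (real \<Rightarrow> 'a \<Rightarrow> real) set \<Rightarrow> (real \<Rightarrow> 'a \<Rightarrow> real) set \<Rightarrow>
   (real \<Rightarrow> 'a \<Rightarrow> real) \<Rightarrow> (real \<Rightarrow> 'a \<Rightarrow> real) \<Rightarrow> bool" where
  "saddle_solution \<Omega> a T f y0 X Y y p \<longleftrightarrow> y \<in> X \<and> p \<in> Y \<and>
     (\<forall>w\<in>X. a_hat \<Omega> a T y w + b_hat \<Omega> a T w p = l1_hat \<Omega> T f y0 w) \<and>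
     (\<forall>q\<in>Y. b_hat \<Omega> a T y q - c_hat a T p q = l2_hat T f q)"


section \<open>Discrete spaces\<close>

text \<open>A finite-dimensional space is spanned by representatives of a basis.\<close>

definition fin_dim_subspace :: "'x::real_vector set \<Rightarrow> 'x set \<Rightarrow> bool" where
  "fin_dim_subspace S X \<longleftrightarrow> S \<subseteq> X \<and> (\<exists>B. finite B \<and> S = span B)"

definition L2_projection ::
  "'a::euclidean_space set \<Rightarrow> real \<Rightarrow> (real \<Rightarrow> 'a \<Rightarrow> real) set \<Rightarrow> (real \<Rightarrow> 'a \<Rightarrow> real) \<Rightarrow> real \<Rightarrow> 'a \<Rightarrow> real"
where
  "L2_projection \<Omega> T Q v =
     (SOME r. r \<in> Q \<and> (\<forall>q\<in>Q. L2H_inner \<Omega> T r q = L2H_inner \<Omega> T v q))"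

text \<open>
  The derivative of \<open>w\<close>, a \<open>V\<^sup>*\<close>-valued function, belongs to the space \<open>Q\<close> of \<open>V\<close>-valued functions,
  \<open>V\<close> being identified with its image in \<open>V\<^sup>*\<close> under \<open>V \<rightarrow> H = H\<^sup>* \<rightarrow> V\<^sup>*\<close>.
\<close>

definition time_deriv_in ::
  "'a::euclidean_space set \<Rightarrow> 'a form \<Rightarrow> real \<Rightarrow> (real \<Rightarrow> 'a \<Rightarrow> real) \<Rightarrow> (real \<Rightarrow> 'a \<Rightarrow> real) set \<Rightarrow> bool" where
  "time_deriv_in \<Omega> a T w Q \<longleftrightarrow>
     (\<exists>q\<in>Q. AE t in lebesgue_on {0<..<T}.
        \<forall>\<eta>\<in>H10 \<Omega>. time_deriv \<Omega> a T w t \<eta> = L2_inner \<Omega> (q t) \<eta>)"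

end

theory Submission
  imports Defs
begin

text \<open>
  The discrete solutions even converge strongly, by a quasi-optimality estimate, so no weak
  compactness is needed. Let \<open>w\<^sub>d\<close>, \<open>q\<^sub>d\<close> approximate \<open>y\<close>, \<open>p\<close> and put \<open>e = y\<^sub>d - w\<^sub>d\<close>, \<open>\<eta> = p\<^sub>d - q\<^sub>d\<close>.
  Testing the discrete error equations with \<open>(e, \<eta>)\<close> controls \<open>e\<close> and \<open>\<eta>\<close> in
  \<open>L\<^sup>2(0,T;V)\<close>. Since \<open>e\<^sub>t \<in> Q\<^sub>d\<close>, the norm of \<open>e\<^sub>t\<close> is attained, up to the constant of the projection, on
  \<open>\<Pi>\<^sub>d R e\<^sub>t \<in> Q\<^sub>d\<close>, and the second error equation bounds it by \<open>\<eta>\<close> and the approximation errors.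
  Everything rests on the embedding of \<open>W(0,T)\<close> into \<open>C([0,T],H)\<close>. For \<open>v \<in> W(0,T)\<close>, du
  Bois-Reymond's lemma gives \<open>(v(t) - v(s), v(r))\<^sub>H = \<integral>\<^sub>s\<^sup>t \<langle>v\<^sub>t, v(r)\<rangle>\<close> for almost all
  \<open>s\<close>, \<open>t\<close>, \<open>r\<close>. Choosing in each dyadic interval next to \<open>t\<close> a point at which \<open>v\<close> has at
  most average energy, a telescoping sum yields
  \<open>\<parallel>v(t) - v(s)\<parallel>\<^sub>H\<^sup>2 \<le> 56 \<integral>\<^sub>s\<^sup>t (\<parallel>v\<^sub>t\<parallel>\<^sup>2 + \<parallel>v\<parallel>\<^sup>2)\<close>.
\<close>

section \<open>Semi-inner product spaces\<close>

text \<open>Functions are not identified modulo null sets, and derivatives, Riesz lifts and point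
  values are picked by \<open>SOME\<close>. Their linearity holds only up to seminorm zero. All
  Hilbert space arguments are therefore carried out once, for a semi-definite form on a carrier set,
  where \<open>ip_cong\<close> absorbs the ambiguity. Lifting v_t by Riesz turns
  \<open>b_hat\<close> into an inner product of \<open>L2V\<close>. The terminal term of
  \<open>a_hat\<close> shapes the proof. It has a good sign when the error is tested with itself,
  but its mixed form needs a trace bound in the full norm of W and so brings e_t into an energy
  estimate that does not control e_t. The loop closes because the norm of e_t enters linearly,
  multiplied by the approximation error, while the left side is quadratic. The trace bound is
  obtained without mollifying v: the curve is tested only with its own values, and a change of its
  H-norm is expressed by polarisation through such increments.\<close>

locale semi_inner_space =
  fixes X :: "'x::real_vector set" and ip :: "'x \<Rightarrow> 'x \<Rightarrow> real" and N :: "'x \<Rightarrow> real"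
  assumes subspace: "subspace X"
    and ip_sym: "\<And>x y. x \<in> X \<Longrightarrow> y \<in> X \<Longrightarrow> ip x y = ip y x"
    and ip_add_left: "\<And>x y z. x \<in> X \<Longrightarrow> y \<in> X \<Longrightarrow> z \<in> X \<Longrightarrow> ip (x + y) z = ip x z + ip y z"
    and ip_scale_left: "\<And>c x y. x \<in> X \<Longrightarrow> y \<in> X \<Longrightarrow> ip (c *\<^sub>R x) y = c * ip x y"
    and ip_nonneg: "\<And>x. x \<in> X \<Longrightarrow> 0 \<le> ip x x"
    and N_eq: "\<And>x. N x = sqrt (ip x x)"
begin

lemma mem_add: "x \<in> X \<Longrightarrow> y \<in> X \<Longrightarrow> x + y \<in> X"
  and mem_diff: "x \<in> X \<Longrightarrow> y \<in> X \<Longrightarrow> x - y \<in> X"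
  and mem_scale: "x \<in> X \<Longrightarrow> c *\<^sub>R x \<in> X"
  and mem_zero: "0 \<in> X"
  using subspace by (auto intro: subspace_add subspace_diff subspace_scale subspace_0)

lemmas mem = mem_add mem_diff mem_scale mem_zero

lemma ip_add_right: "x \<in> X \<Longrightarrow> y \<in> X \<Longrightarrow> z \<in> X \<Longrightarrow> ip z (x + y) = ip z x + ip z y"
  by (metis ip_add_left ip_sym mem_add)

lemma ip_scale_right: "x \<in> X \<Longrightarrow> y \<in> X \<Longrightarrow> ip y (c *\<^sub>R x) = c * ip y x"
  by (metis ip_scale_left ip_sym mem_scale)

lemma ip_diff_left: "x \<in> X \<Longrightarrow> y \<in> X \<Longrightarrow> z \<in> X \<Longrightarrow> ip (x - y) z = ip x z - ip y z"
  by (metis add_diff_cancel_right' diff_add_cancel ip_add_left mem_diff)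

lemma ip_diff_right: "x \<in> X \<Longrightarrow> y \<in> X \<Longrightarrow> z \<in> X \<Longrightarrow> ip z (x - y) = ip z x - ip z y"
  by (metis ip_diff_left ip_sym mem_diff)

lemmas ip_bilinear =
  ip_add_left ip_add_right ip_scale_left ip_scale_right ip_diff_left ip_diff_right

lemma ip_zero_left: "x \<in> X \<Longrightarrow> ip 0 x = 0"
  using ip_scale_left[of 0 x 0] mem_zero by auto

lemma ip_zero_right: "x \<in> X \<Longrightarrow> ip x 0 = 0"
  by (metis ip_sym ip_zero_left mem_zero)

lemma N_nonneg: "x \<in> X \<Longrightarrow> 0 \<le> N x"
  by (simp add: N_eq ip_nonneg)

lemma N_square: "x \<in> X \<Longrightarrow> (N x)\<^sup>2 = ip x x"
  by (simp add: N_eq ip_nonneg)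

lemma N_zero: "N 0 = 0"
  by (simp add: N_eq ip_zero_left mem_zero)

lemma Cauchy_Schwarz:
  assumes x: "x \<in> X" and y: "y \<in> X"
  shows "\<bar>ip x y\<bar> \<le> N x * N y"
proof -
  have q: "0 \<le> ip x x * s\<^sup>2 - 2 * s * ip x y + ip y y" for s
  proof -
    have "0 \<le> ip (s *\<^sub>R x - y) (s *\<^sub>R x - y)"
      using x y by (intro ip_nonneg mem)
    also have "\<dots> = ip x x * s\<^sup>2 - 2 * s * ip x y + ip y y"
      using x y ip_sym[OF x y] by (simp add: ip_bilinear mem algebra_simps power2_eq_square)
    finally show ?thesis .
  qed
  have "(ip x y)\<^sup>2 \<le> ip x x * ip y y"
  proof (cases "ip x x = 0")
    case True
    have "ip x y = 0"
    proof (rule ccontr)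
      assume "ip x y \<noteq> 0"
      then show False
        \<comment> \<open>This value of \<open>s\<close> turns the affine bound into 0 \<le>
          -1.\<close>
        using q[of "(ip y y + 1) / (2 * ip x y)"] True by simp
    qed
    then show ?thesis using True by simp
  next
    case False
    then have pos: "ip x x > 0" using ip_nonneg[OF x] by simp
    \<comment> \<open>The minimiser of the quadratic in \<open>s\<close>.\<close>
    have "0 \<le> ip x x * (ip x y / ip x x)\<^sup>2 - 2 * (ip x y / ip x x) * ip x y + ip y y"
      by (rule q)
    also have "\<dots> = ip y y - (ip x y)\<^sup>2 / ip x x"
      using pos by (simp add: field_simps power2_eq_square)
    finally show ?thesis using pos by (simp add: field_simps)
  qed
  then have "(ip x y)\<^sup>2 \<le> (N x * N y)\<^sup>2"
    using x y by (simp add: power_mult_distrib N_square)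
  then show ?thesis
    by (metis abs_le_square_iff abs_of_nonneg mult_nonneg_nonneg N_nonneg x y)
qed

lemma N_triangle:
  assumes "x \<in> X" "y \<in> X"
  shows "N (x + y) \<le> N x + N y"
proof -
  have "(N (x + y))\<^sup>2 = ip x x + 2 * ip x y + ip y y"
    using assms ip_sym[OF assms] by (simp add: N_square ip_bilinear mem)
  also have "\<dots> \<le> (N x)\<^sup>2 + 2 * (N x * N y) + (N y)\<^sup>2"
    using Cauchy_Schwarz[OF assms] assms by (simp add: N_square abs_le_iff)
  also have "\<dots> = (N x + N y)\<^sup>2" by (simp add: power2_eq_square algebra_simps)
  finally show ?thesis
    using assms N_nonneg by (meson add_nonneg_nonneg power2_le_imp_le)
qed

lemma N_scale: "x \<in> X \<Longrightarrow> N (c *\<^sub>R x) = \<bar>c\<bar> * N x"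
  by (simp add: N_eq ip_bilinear mem real_sqrt_mult mult.assoc[symmetric])

lemma N_minus_commute: "x \<in> X \<Longrightarrow> y \<in> X \<Longrightarrow> N (x - y) = N (y - x)"
  using N_scale[of "x - y" "-1"] mem_diff by simp

lemma N_triangle_diff:
  assumes "x \<in> X" "y \<in> X" "z \<in> X"
  shows "N (x - z) \<le> N (x - y) + N (y - z)"
  using N_triangle[of "x - y" "y - z"] assms by (simp add: mem)

lemma N_diff_le: "x \<in> X \<Longrightarrow> y \<in> X \<Longrightarrow> N (x - y) \<le> N x + N y"
  using N_triangle_diff[of x 0 y] N_minus_commute[of 0 y] mem_zero by simp

lemma N_abs_diff_le:
  assumes "x \<in> X" "y \<in> X"
  shows "\<bar>N x - N y\<bar> \<le> N (x - y)"
  using N_triangle[of "x - y" y] N_triangle[of "y - x" x] N_minus_commute[of x y] assms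
  by (simp add: mem)

text \<open>Stands in for equality of classes modulo null sets: representatives chosen by
  \<open>SOME\<close> may be exchanged inside an inner product.\<close>

lemma ip_cong:
  assumes "x \<in> X" "x' \<in> X" "y \<in> X" "y' \<in> X" "N (x - x') = 0" "N (y - y') = 0"
  shows "ip x y = ip x' y'"
proof -
  have "ip (x - x') y = 0" "ip x' (y - y') = 0"
    using Cauchy_Schwarz[of "x - x'" y] Cauchy_Schwarz[of x' "y - y'"] assms by (auto simp: mem)
  then show ?thesis using assms by (simp add: ip_bilinear)
qed

lemma tendsto_N:
  assumes "\<And>k. x k \<in> X" "l \<in> X" "(\<lambda>k. N (x k - l)) \<longlonglongrightarrow> 0"
  shows "(\<lambda>k. N (x k)) \<longlonglongrightarrow> N l"
proof -
  have "(\<lambda>k. N (x k) - N l) \<longlonglongrightarrow> 0"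
    by (rule Lim_null_comparison[OF _ assms(3)]) (use assms N_abs_diff_le in auto)
  then show ?thesis by (simp add: LIM_zero_iff)
qed

lemma tendsto_ip:
  assumes x: "\<And>k. x k \<in> X" "l \<in> X" "(\<lambda>k. N (x k - l)) \<longlonglongrightarrow> 0"
    and y: "\<And>k. y k \<in> X" "m \<in> X" "(\<lambda>k. N (y k - m)) \<longlonglongrightarrow> 0"
  shows "(\<lambda>k. ip (x k) (y k)) \<longlonglongrightarrow> ip l m"
proof -
  have b: "norm (ip (x k) (y k) - ip l m) \<le> N (x k - l) * N (y k) + N l * N (y k - m)" for k
  proof -
    have "ip (x k) (y k) - ip l m = ip (x k - l) (y k) + ip l (y k - m)"
      using x y by (simp add: ip_bilinear)
    then show ?thesis
      using Cauchy_Schwarz[of "x k - l" "y k"] Cauchy_Schwarz[of l "y k - m"] x y by (simp add: mem)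
  qed
  have "(\<lambda>k. N (x k - l) * N (y k) + N l * N (y k - m)) \<longlonglongrightarrow> 0 * N m + N l * 0"
    by (intro tendsto_intros x y tendsto_N)
  then have "(\<lambda>k. ip (x k) (y k) - ip l m) \<longlonglongrightarrow> 0"
    by (intro Lim_null_comparison[OF always_eventually[OF allI[OF b]]]) simp
  then show ?thesis by (simp add: LIM_zero_iff)
qed

lemma restrict:
  assumes "Real_Vector_Spaces.subspace Y" "Y \<subseteq> X"
  shows "semi_inner_space Y ip N"
proof (rule semi_inner_space.intro)
  have X: "x \<in> X" if "x \<in> Y" for x using assms(2) that by (rule subsetD)
  show "Real_Vector_Spaces.subspace Y" by (rule assms(1))
  show "\<And>x y. x \<in> Y \<Longrightarrow> y \<in> Y \<Longrightarrow> ip x y = ip y x"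
    by (rule ip_sym[OF X X])
  show "\<And>x y z. x \<in> Y \<Longrightarrow> y \<in> Y \<Longrightarrow> z \<in> Y \<Longrightarrow> ip (x + y) z = ip x z + ip y z"
    by (rule ip_add_left[OF X X X])
  show "\<And>c x y. x \<in> Y \<Longrightarrow> y \<in> Y \<Longrightarrow> ip (c *\<^sub>R x) y = c * ip x y"
    by (rule ip_scale_left[OF X X])
  show "\<And>x. x \<in> Y \<Longrightarrow> 0 \<le> ip x x"
    by (rule ip_nonneg[OF X])
  show "\<And>x. N x = sqrt (ip x x)" by (rule N_eq)
qed

section \<open>Riesz representation and orthogonal projection\<close>

definition complete_seminorm :: bool where
  "complete_seminorm \<longleftrightarrow> (\<forall>x. (\<forall>k. x k \<in> X) \<longrightarrow>
     (\<forall>\<epsilon>>0. \<exists>k0. \<forall>j\<ge>k0. \<forall>k\<ge>k0. N (x j - x k) < \<epsilon>) \<longrightarrow>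
     (\<exists>l\<in>X. (\<lambda>k::nat. N (x k - l)) \<longlonglongrightarrow> 0))"

text \<open>The representer minimises \<open>\<lambda>x. ip x x / 2 - F x\<close>; by the parallelogram law minimising
  sequences are Cauchy.\<close>

theorem Riesz_representation:
  assumes complete: complete_seminorm and F: "F \<in> dual_space X N"
  obtains r where "r \<in> X" "\<And>v. v \<in> X \<Longrightarrow> ip r v = F v"
proof -
  obtain C where C: "\<And>x. x \<in> X \<Longrightarrow> \<bar>F x\<bar> \<le> C * N x" and lin: "linear_functional_on X F"
    using F by (auto simp: dual_space_def)
  have F_add: "F (x + y) = F x + F y" if "x \<in> X" "y \<in> X" for x y
    using lin that by (auto simp: linear_functional_on_def)
  have F_scale: "F (c *\<^sub>R x) = c * F x" if "x \<in> X" for x c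
    using lin that by (auto simp: linear_functional_on_def)
  define J where "J x = ip x x / 2 - F x" for x
  \<comment> \<open>Completing the square in N x.\<close>
  have J_ge: "J x \<ge> - C\<^sup>2 / 2" if "x \<in> X" for x
  proof -
    have "F x \<le> C * N x" using C[OF that] by linarith
    moreover have "0 \<le> (N x - C)\<^sup>2" by simp
    ultimately show ?thesis
      using N_square[OF that] by (simp add: J_def power2_eq_square algebra_simps)
  qed
  define m where "m = Inf (J ` X)"
  have bdd: "bdd_below (J ` X)" using J_ge by (auto intro!: bdd_belowI2)
  have m_le: "m \<le> J x" if "x \<in> X" for x
    unfolding m_def using bdd that by (auto intro: cInf_lower)
  have "\<exists>x\<in>X. J x < m + 1 / Suc k" for k
  proof -
    have "\<exists>z\<in>J ` X. z < m + 1 / Suc k"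
      unfolding m_def using mem_zero bdd by (intro iffD1[OF cInf_less_iff]) auto
    then show ?thesis by auto
  qed
  then obtain x where x: "\<And>k. x k \<in> X" "\<And>k. J (x k) < m + 1 / Suc k" by metis
  \<comment> \<open>Parallelogram law: N (u - w)^2 equals 4 * (J u + J w - 2 * J mid) for the
    midpoint mid, and J mid is at least \<open>m\<close>.\<close>
  have par: "(N (u - w))\<^sup>2 \<le> 4 * (J u - m) + 4 * (J w - m)" if "u \<in> X" "w \<in> X" for u w
  proof -
    have mid: "(1/2) *\<^sub>R (u + w) \<in> X" using that by (intro mem)
    have "m \<le> J ((1/2) *\<^sub>R (u + w))" by (rule m_le[OF mid])
    also have "\<dots> = (ip u u + 2 * ip u w + ip w w) / 8 - (F u + F w) / 2"
      using that ip_sym[OF that]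
      by (simp add: J_def ip_bilinear mem F_add F_scale field_simps)
    finally have "m \<le> (ip u u + 2 * ip u w + ip w w) / 8 - (F u + F w) / 2" .
    moreover have "(N (u - w))\<^sup>2 = ip u u - 2 * ip u w + ip w w"
      using that ip_sym[OF that] by (simp add: N_square ip_bilinear mem)
    ultimately show ?thesis unfolding J_def by (simp add: field_simps)
  qed
  have "\<exists>l\<in>X. (\<lambda>k. N (x k - l)) \<longlonglongrightarrow> 0"
  proof (rule complete[unfolded complete_seminorm_def, rule_format])
    fix \<epsilon> :: real assume "\<epsilon> > 0"
    \<comment> \<open>Each of the two values of \<open>J\<close> exceeds \<open>m\<close> by less
      than 1 / (k0 + 1) and enters \<open>par\<close> with factor 4, whence the 8.\<close>
    then obtain k0 where k0: "1 / Suc k0 < \<epsilon>\<^sup>2 / 8"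
      using reals_Archimedean[of "\<epsilon>\<^sup>2 / 8"] by (auto simp: inverse_eq_divide)
    have "N (x j - x k) < \<epsilon>" if "j \<ge> k0" "k \<ge> k0" for j k
    proof -
      have small: "J (x i) - m < 1 / Suc k0" if "i \<ge> k0" for i
      proof -
        have "1 / real (Suc i) \<le> 1 / real (Suc k0)" using that by (simp add: field_simps)
        then show ?thesis using x(2)[of i] by linarith
      qed
      have "(N (x j - x k))\<^sup>2 < \<epsilon>\<^sup>2"
        using par[OF x(1)[of j] x(1)[of k]] small[OF \<open>j \<ge> k0\<close>] small[OF \<open>k \<ge> k0\<close>] k0 by argo
      then show ?thesis using \<open>\<epsilon> > 0\<close> by (meson less_imp_le power_less_imp_less_base)
    qed
    then show "\<exists>k0. \<forall>j\<ge>k0. \<forall>k\<ge>k0. N (x j - x k) < \<epsilon>" by blast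
  qed (use x in auto)
  then obtain r where r: "r \<in> X" "(\<lambda>k. N (x k - r)) \<longlonglongrightarrow> 0" by auto
  have F_lim: "(\<lambda>k. F (x k)) \<longlonglongrightarrow> F r"
  proof -
    have b: "norm (F (x k) - F r) \<le> C * N (x k - r)" for k
      using C[of "x k - r"] F_add[of "x k - r" r] x(1)[of k] r(1) by (simp add: mem)
    have "(\<lambda>k. C * N (x k - r)) \<longlonglongrightarrow> 0" using r(2) by (rule tendsto_mult_right_zero)
    then have "(\<lambda>k. F (x k) - F r) \<longlonglongrightarrow> 0"
      by (rule Lim_null_comparison[OF always_eventually[OF allI[OF b]]])
    then show ?thesis by (simp add: LIM_zero_iff)
  qed
  have "(\<lambda>k. J (x k)) \<longlonglongrightarrow> J r"
    unfolding J_def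
    using tendsto_diff[OF tendsto_divide[OF tendsto_ip[OF x(1) r x(1) r] tendsto_const[of 2]] F_lim]
    by simp
  moreover have "(\<lambda>k. m + 1 / Suc k) \<longlonglongrightarrow> m + 0"
    by (intro tendsto_add tendsto_const LIMSEQ_Suc[OF lim_1_over_n])
  ultimately have "J r \<le> m"
    using x(2) by (intro LIMSEQ_le[of _ "J r"]) (auto intro: less_imp_le)
  have "ip r v = F v" if v: "v \<in> X" for v
  proof -
    define D where "D = ip r v - F v"
    have q: "0 \<le> s * D + s\<^sup>2 * ip v v / 2" for s
    proof -
      have "J r \<le> J (r + s *\<^sub>R v)" using \<open>J r \<le> m\<close> m_le[of "r + s *\<^sub>R v"] r v by (auto simp: mem)
      then show ?thesis
        using r v ip_sym[OF r(1) v]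
        by (simp add: J_def D_def ip_bilinear mem F_add F_scale power2_eq_square algebra_simps)
    qed
    have "D = 0"
    proof (rule ccontr)
      assume "D \<noteq> 0"
      \<comment> \<open>\<open>K\<close> replaces \<open>ip v v\<close>, which may be zero. Along
        the step -D / K the first-order term -D^2 / K outweighs the quadratic term, which is at most
        D^2 / (2 K).\<close>
      define K where "K = ip v v + 1"
      have pos: "K > 0" and le: "ip v v \<le> K" using ip_nonneg[OF v] by (auto simp: K_def)
      have "0 \<le> (- D / K) * D + (- D / K)\<^sup>2 * ip v v / 2" by (rule q)
      also have "\<dots> \<le> (- D / K) * D + (- D / K)\<^sup>2 * K / 2"
        using le by (intro add_left_mono divide_right_mono mult_left_mono) auto
      also have "\<dots> = - (D\<^sup>2 / (2 * K))"
        using pos by (simp add: field_simps power2_eq_square)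
      finally show False using \<open>D \<noteq> 0\<close> pos by (simp add: divide_le_0_iff)
    qed
    then show ?thesis by (simp add: D_def)
  qed
  then show ?thesis using r(1) that by blast
qed

text \<open>Gram-Schmidt, one generator at a time: the new generator is made orthogonal to the
  previous span, and the projection gains one Fourier term. This supplies the witness behind the
  choice in \<open>L2_projection\<close>.\<close>

lemma projection_span_exists:
  assumes "finite B" "span B \<subseteq> X" "v \<in> X"
  shows "\<exists>r\<in>span B. \<forall>q\<in>span B. ip r q = ip v q"
  using assms
proof (induction B arbitrary: v rule: finite_induct)
  case empty
  then show ?case by (auto simp: ip_zero_right mem_zero)
next
  case (insert b B)
  have B: "span B \<subseteq> X" using insert.prems(1) span_mono[of B "insert b B"] by blast
  have b: "b \<in> X" using insert.prems(1) span_base[of b "insert b B"] by blast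
  obtain r where r: "r \<in> span B" "\<And>q. q \<in> span B \<Longrightarrow> ip r q = ip v q"
    using insert.IH[OF B insert.prems(2)] by auto
  obtain p where p: "p \<in> span B" "\<And>q. q \<in> span B \<Longrightarrow> ip p q = ip b q"
    using insert.IH[OF B b] by auto
  define b' where "b' = b - p"
  have b': "b' \<in> X" using b p B by (auto simp: b'_def mem)
  have orth: "ip b' q = 0" if "q \<in> span B" for q
  proof -
    have "p \<in> X" "q \<in> X" using that p(1) B by auto
    then show ?thesis using p(2)[OF that] b by (simp add: b'_def ip_bilinear)
  qed
  define c where "c = ip (v - r) b' / ip b' b'"
  \<comment> \<open>If \<open>b'\<close> has norm 0, then \<open>c\<close> is a division by zero and
    equals 0; Cauchy-Schwarz makes the right side vanish as well.\<close>
  have c: "c * ip b' b' = ip (v - r) b'"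
    using Cauchy_Schwarz[of "v - r" b'] b' insert.prems(2) r(1) B
    by (cases "ip b' b' = 0") (auto simp: c_def N_eq mem subset_iff)
  have b'_span: "b' \<in> span (insert b B)"
    unfolding b'_def using p(1) by (meson insertI1 span_base span_diff span_mono subsetD subset_insertI)
  have "r + c *\<^sub>R b' \<in> span (insert b B)"
    using r(1) b'_span by (meson span_add span_mono span_scale subsetD subset_insertI)
  moreover have "ip (r + c *\<^sub>R b') q = ip v q" if q: "q \<in> span (insert b B)" for q
  proof -
    obtain k where k: "q - k *\<^sub>R b \<in> span B" using q by (auto simp: span_insert)
    define s where "s = (q - k *\<^sub>R b) + k *\<^sub>R p"
    have s: "s \<in> span B" unfolding s_def using k p(1) by (intro span_add span_scale)
    have qs: "q = s + k *\<^sub>R b'" by (simp add: s_def b'_def algebra_simps)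
    have rX: "r \<in> X" and sX: "s \<in> X" using r s B by auto
    have 1: "ip r b' = 0" using orth[OF r(1)] ip_sym[OF rX b'] by simp
    have 2: "ip b' s = 0" by (rule orth[OF s])
    have 3: "c * ip b' b' = ip v b'" using c 1 rX b' insert.prems(2) by (simp add: ip_bilinear)
    show ?thesis
      unfolding qs using rX sX b' insert.prems(2) 1 2 3 r(2)[OF s]
      by (simp add: ip_bilinear mem algebra_simps)
  qed
  ultimately show ?case by blast
qed

end

section \<open>Bochner spaces\<close>

text \<open>Lebesgue measure is complete; extension by 0 reduces the restricted measure to the whole
  space.\<close>

lemma borel_measurable_lebesgue_on_AE:
  fixes f g :: "'a::euclidean_space \<Rightarrow> real"
  assumes S: "S \<in> sets lebesgue" and f: "f \<in> borel_measurable (lebesgue_on S)"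
    and ae: "AE x in lebesgue_on S. f x = g x"
  shows "g \<in> borel_measurable (lebesgue_on S)"
proof -
  have "AE x in lebesgue. (if x \<in> S then f x else 0) = (if x \<in> S then g x else 0)"
    using ae S by (simp add: AE_restrict_space_iff)
  then have "(\<lambda>x. if x \<in> S then g x else 0) \<in> borel_measurable lebesgue"
    by (rule borel_measurable_AE[OF borel_measurable_if_I[OF f S]])
  then show ?thesis by (rule borel_measurable_if_D)
qed

lemma borel_measurable_lebesgue_on_LIMSEQ_AE:
  fixes f :: "nat \<Rightarrow> 'a::euclidean_space \<Rightarrow> real"
  assumes S: "S \<in> sets lebesgue" and f: "\<And>k. f k \<in> borel_measurable (lebesgue_on S)"
    and ae: "AE x in lebesgue_on S. (\<lambda>k. f k x) \<longlonglongrightarrow> g x"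
  shows "g \<in> borel_measurable (lebesgue_on S)"
proof (rule borel_measurable_lebesgue_on_AE[OF S])
  show "(\<lambda>x. lim (\<lambda>k. f k x)) \<in> borel_measurable (lebesgue_on S)"
    using f by (rule borel_measurable_lim_metric)
  show "AE x in lebesgue_on S. lim (\<lambda>k. f k x) = g x"
    using ae by eventually_elim (rule limI)
qed

lemma sets_lebesgue_Ioo: "{a<..<b::real} \<in> sets lebesgue"
  by simp

lemma strongly_measurableE:
  assumes "strongly_measurable T X N v"
  obtains s where "\<And>k. simple_function (lebesgue_on {0<..<T}) (s k)"
    "\<And>k t. t \<in> {0<..<T} \<Longrightarrow> s k t \<in> X"
    "AE t in lebesgue_on {0<..<T}. (\<lambda>k::nat. N (s k t - v t)) \<longlonglongrightarrow> 0"
proof -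
  obtain s where "(\<forall>k. simple_function (lebesgue_on {0<..<T}) (s k) \<and> (\<forall>t\<in>{0<..<T}. s k t \<in> X)) \<and>
    (AE t in lebesgue_on {0<..<T}. (\<lambda>k::nat. N (s k t - v t)) \<longlonglongrightarrow> 0)"
    using assms unfolding strongly_measurable_def by (rule exE)
  then show ?thesis by (intro that[of s]) simp_all
qed

context semi_inner_space
begin

text \<open>The carrier bears no sigma-algebra, so measurability is drawn from simple functions: on
  these the inner product is simple, and it is continuous along the approximating sequences.\<close>

lemma strongly_measurable_ip:
  assumes u: "strongly_measurable T X N u" "AE t in lebesgue_on {0<..<T}. u t \<in> X"
    and v: "strongly_measurable T X N v" "AE t in lebesgue_on {0<..<T}. v t \<in> X"
  shows "(\<lambda>t. ip (u t) (v t)) \<in> borel_measurable (lebesgue_on {0<..<T})"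
proof -
  obtain s where s: "\<And>k. simple_function (lebesgue_on {0<..<T}) (s k)"
    "\<And>k t. t \<in> {0<..<T} \<Longrightarrow> s k t \<in> X"
    "AE t in lebesgue_on {0<..<T}. (\<lambda>k::nat. N (s k t - u t)) \<longlonglongrightarrow> 0"
    using strongly_measurableE[OF u(1)] by blast
  obtain r where r: "\<And>k. simple_function (lebesgue_on {0<..<T}) (r k)"
    "\<And>k t. t \<in> {0<..<T} \<Longrightarrow> r k t \<in> X"
    "AE t in lebesgue_on {0<..<T}. (\<lambda>k::nat. N (r k t - v t)) \<longlonglongrightarrow> 0"
    using strongly_measurableE[OF v(1)] by blast
  show ?thesis
  proof (rule borel_measurable_lebesgue_on_LIMSEQ_AE)
    show "(\<lambda>t. ip (s k t) (r k t)) \<in> borel_measurable (lebesgue_on {0<..<T})" for k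
      by (intro borel_measurable_simple_function simple_function_compose2[OF s(1) r(1)])
    have "AE t in lebesgue_on {0<..<T}. t \<in> {0<..<T}" by (rule AE_I2) simp
    then show "AE t in lebesgue_on {0<..<T}. (\<lambda>k. ip (s k t) (r k t)) \<longlonglongrightarrow> ip (u t) (v t)"
      using s(3) r(3) u(2) v(2)
    proof eventually_elim
      case (elim t)
      show ?case
        by (rule tendsto_ip[OF s(2)[OF elim(1)] elim(4) elim(2) r(2)[OF elim(1)] elim(5) elim(3)])
    qed
  qed simp
qed

lemma strongly_measurable_add:
  assumes u: "strongly_measurable T X N u" "AE t in lebesgue_on {0<..<T}. u t \<in> X"
    and v: "strongly_measurable T X N v" "AE t in lebesgue_on {0<..<T}. v t \<in> X"
  shows "strongly_measurable T X N (u + v)"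
proof -
  obtain s where s: "\<And>k. simple_function (lebesgue_on {0<..<T}) (s k)"
    "\<And>k t. t \<in> {0<..<T} \<Longrightarrow> s k t \<in> X"
    "AE t in lebesgue_on {0<..<T}. (\<lambda>k::nat. N (s k t - u t)) \<longlonglongrightarrow> 0"
    using strongly_measurableE[OF u(1)] by blast
  obtain r where r: "\<And>k. simple_function (lebesgue_on {0<..<T}) (r k)"
    "\<And>k t. t \<in> {0<..<T} \<Longrightarrow> r k t \<in> X"
    "AE t in lebesgue_on {0<..<T}. (\<lambda>k::nat. N (r k t - v t)) \<longlonglongrightarrow> 0"
    using strongly_measurableE[OF v(1)] by blast
  have "AE t in lebesgue_on {0<..<T}. t \<in> {0<..<T}" by (rule AE_I2) simp
  then have "AE t in lebesgue_on {0<..<T}. (\<lambda>k. N (s k t + r k t - (u + v) t)) \<longlonglongrightarrow> 0"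
    using s(3) r(3) u(2) v(2)
  proof eventually_elim
    case (elim t)
    have X: "s k t - u t \<in> X" "r k t - v t \<in> X" for k
      using s(2) r(2) elim by (auto intro: mem)
    have eq: "s k t + r k t - (u + v) t = (s k t - u t) + (r k t - v t)" for k
      by simp
    have b: "norm (N (s k t + r k t - (u + v) t)) \<le> N (s k t - u t) + N (r k t - v t)" for k
      unfolding eq using N_triangle[OF X] N_nonneg[OF mem_add[OF X]] by (simp del: add_diff_eq)
    have "(\<lambda>k. N (s k t - u t) + N (r k t - v t)) \<longlonglongrightarrow> 0"
      using tendsto_add[OF elim(2,3)] by simp
    then show ?case
      by (rule Lim_null_comparison[OF always_eventually[OF allI[OF b]]])
  qed
  moreover have "simple_function (lebesgue_on {0<..<T}) (\<lambda>t. s k t + r k t)" for k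
    by (rule simple_function_compose2[OF s(1) r(1)])
  ultimately show ?thesis
    unfolding strongly_measurable_def using s(2) r(2)
    by (intro exI[of _ "\<lambda>k t. s k t + r k t"]) (auto simp: mem)
qed

lemma strongly_measurable_scaleR:
  assumes u: "strongly_measurable T X N u" "AE t in lebesgue_on {0<..<T}. u t \<in> X"
  shows "strongly_measurable T X N (c *\<^sub>R u)"
proof -
  obtain s where s: "\<And>k. simple_function (lebesgue_on {0<..<T}) (s k)"
    "\<And>k t. t \<in> {0<..<T} \<Longrightarrow> s k t \<in> X"
    "AE t in lebesgue_on {0<..<T}. (\<lambda>k::nat. N (s k t - u t)) \<longlonglongrightarrow> 0"
    using strongly_measurableE[OF u(1)] by blast
  have "AE t in lebesgue_on {0<..<T}. t \<in> {0<..<T}" by (rule AE_I2) simp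
  then have "AE t in lebesgue_on {0<..<T}. (\<lambda>k. N (c *\<^sub>R s k t - (c *\<^sub>R u) t)) \<longlonglongrightarrow> 0"
    using s(3) u(2)
  proof eventually_elim
    case (elim t)
    have "N (c *\<^sub>R s k t - (c *\<^sub>R u) t) = \<bar>c\<bar> * N (s k t - u t)" for k
      using N_scale[of "s k t - u t" c] s(2) elim by (simp add: mem algebra_simps)
    then show ?case using elim(2) by (simp add: tendsto_mult_right_zero)
  qed
  moreover have "simple_function (lebesgue_on {0<..<T}) (\<lambda>t. c *\<^sub>R s k t)" for k
    using simple_function_compose[OF s(1)[of k], of "\<lambda>x. c *\<^sub>R x"] by (simp add: comp_def)
  ultimately show ?thesis
    unfolding strongly_measurable_def using s(2)
    by (intro exI[of _ "\<lambda>k t. c *\<^sub>R s k t"]) (auto simp: mem)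
qed

lemma Bochner_L2D:
  assumes "v \<in> Bochner_L2 T X N"
  shows "strongly_measurable T X N v" "AE t in lebesgue_on {0<..<T}. v t \<in> X"
    "integrable (lebesgue_on {0<..<T}) (\<lambda>t. (N (v t))\<^sup>2)"
  using assms unfolding Bochner_L2_def by blast+

lemma Bochner_L2_ip_integrable:
  assumes u: "u \<in> Bochner_L2 T X N" and v: "v \<in> Bochner_L2 T X N"
  shows "integrable (lebesgue_on {0<..<T}) (\<lambda>t. ip (u t) (v t))"
proof (rule Bochner_Integration.integrable_bound)
  show "integrable (lebesgue_on {0<..<T}) (\<lambda>t. (N (u t))\<^sup>2 + (N (v t))\<^sup>2)"
    using Bochner_L2D[OF u] Bochner_L2D[OF v] by auto
  show "(\<lambda>t. ip (u t) (v t)) \<in> borel_measurable (lebesgue_on {0<..<T})"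
    using Bochner_L2D[OF u] Bochner_L2D[OF v] by (intro strongly_measurable_ip)
  show "AE t in lebesgue_on {0<..<T}. norm (ip (u t) (v t)) \<le> norm ((N (u t))\<^sup>2 + (N (v t))\<^sup>2)"
    using Bochner_L2D(2)[OF u] Bochner_L2D(2)[OF v]
  proof eventually_elim
    case (elim t)
    have "\<bar>ip (u t) (v t)\<bar> \<le> N (u t) * N (v t)" by (rule Cauchy_Schwarz[OF elim])
    also have "\<dots> \<le> (N (u t))\<^sup>2 + (N (v t))\<^sup>2"
      using sum_squares_bound[of "N (u t)" "N (v t)"] N_nonneg[OF elim(1)] N_nonneg[OF elim(2)]
        mult_nonneg_nonneg[of "N (u t)" "N (v t)"] by linarith
    finally show ?case by simp
  qed
qed

lemma Bochner_L2_ip_measurable: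
  assumes "u \<in> Bochner_L2 T X N" and "v \<in> Bochner_L2 T X N"
  shows "(\<lambda>t. ip (u t) (v t)) \<in> borel_measurable (lebesgue_on {0<..<T})"
  using Bochner_L2_ip_integrable[OF assms] by (rule borel_measurable_integrable)

lemma Bochner_L2I:
  assumes "strongly_measurable T X N v" "AE t in lebesgue_on {0<..<T}. v t \<in> X"
    and b: "integrable (lebesgue_on {0<..<T}) b" "AE t in lebesgue_on {0<..<T}. (N (v t))\<^sup>2 \<le> b t"
  shows "v \<in> Bochner_L2 T X N"
proof -
  have "(\<lambda>t. ip (v t) (v t)) \<in> borel_measurable (lebesgue_on {0<..<T})"
    using assms by (intro strongly_measurable_ip)
  moreover have "AE t in lebesgue_on {0<..<T}. ip (v t) (v t) = (N (v t))\<^sup>2"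
    using assms(2) by eventually_elim (simp add: N_square)
  ultimately have m: "(\<lambda>t. (N (v t))\<^sup>2) \<in> borel_measurable (lebesgue_on {0<..<T})"
    by (rule borel_measurable_lebesgue_on_AE[OF sets_lebesgue_Ioo])
  have "AE t in lebesgue_on {0<..<T}. norm ((N (v t))\<^sup>2) \<le> norm (b t)"
    using b(2) by eventually_elim (smt (verit) real_norm_def zero_le_power2)
  then show ?thesis
    using assms Bochner_Integration.integrable_bound[OF b(1) m] by (auto simp: Bochner_L2_def)
qed

lemma subspace_Bochner_L2: "Real_Vector_Spaces.subspace (Bochner_L2 T X N)"
proof (rule subspaceI)
  have "strongly_measurable T X N 0"
    unfolding strongly_measurable_def using mem_zero by (intro exI[of _ "\<lambda>k t. 0"]) (auto simp: N_zero)
  then show "0 \<in> Bochner_L2 T X N"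
    using mem_zero by (auto simp: Bochner_L2_def N_zero)
next
  fix u v assume u: "u \<in> Bochner_L2 T X N" and v: "v \<in> Bochner_L2 T X N"
  show "u + v \<in> Bochner_L2 T X N"
  proof (rule Bochner_L2I)
    show "strongly_measurable T X N (u + v)"
      using Bochner_L2D[OF u] Bochner_L2D[OF v] by (intro strongly_measurable_add)
    show "AE t in lebesgue_on {0<..<T}. (u + v) t \<in> X"
      using Bochner_L2D(2)[OF u] Bochner_L2D(2)[OF v] by eventually_elim (simp add: mem)
    show "integrable (lebesgue_on {0<..<T}) (\<lambda>t. 2 * (N (u t))\<^sup>2 + 2 * (N (v t))\<^sup>2)"
      using Bochner_L2D(3)[OF u] Bochner_L2D(3)[OF v] by auto
    show "AE t in lebesgue_on {0<..<T}. (N ((u + v) t))\<^sup>2 \<le> 2 * (N (u t))\<^sup>2 + 2 * (N (v t))\<^sup>2"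
      using Bochner_L2D(2)[OF u] Bochner_L2D(2)[OF v]
    proof eventually_elim
      case (elim t)
      have "(N (u t + v t))\<^sup>2 \<le> (N (u t) + N (v t))\<^sup>2"
        using N_triangle[OF elim] N_nonneg mem_add[OF elim] by (intro power_mono) auto
      also have "\<dots> \<le> 2 * (N (u t))\<^sup>2 + 2 * (N (v t))\<^sup>2"
        using sum_squares_bound[of "N (u t)" "N (v t)"] by (simp add: power2_sum)
      finally show ?case by simp
    qed
  qed
next
  fix c u assume u: "u \<in> Bochner_L2 T X N"
  show "c *\<^sub>R u \<in> Bochner_L2 T X N"
  proof (rule Bochner_L2I)
    show "strongly_measurable T X N (c *\<^sub>R u)"
      using Bochner_L2D[OF u] by (intro strongly_measurable_scaleR)
    show "AE t in lebesgue_on {0<..<T}. (c *\<^sub>R u) t \<in> X"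
      using Bochner_L2D(2)[OF u] by eventually_elim (simp add: mem)
    show "integrable (lebesgue_on {0<..<T}) (\<lambda>t. c\<^sup>2 * (N (u t))\<^sup>2)"
      using Bochner_L2D(3)[OF u] by auto
    show "AE t in lebesgue_on {0<..<T}. (N ((c *\<^sub>R u) t))\<^sup>2 \<le> c\<^sup>2 * (N (u t))\<^sup>2"
      using Bochner_L2D(2)[OF u] by eventually_elim (simp add: N_scale power_mult_distrib)
  qed
qed

lemma semi_inner_space_Bochner_L2:
  "semi_inner_space (Bochner_L2 T X N) (\<lambda>u v. LINT t|lebesgue_on {0<..<T}. ip (u t) (v t))
     (\<lambda>v. sqrt (LINT t|lebesgue_on {0<..<T}. ip (v t) (v t)))"
proof (rule semi_inner_space.intro)
  show "Real_Vector_Spaces.subspace (Bochner_L2 T X N)" by (rule subspace_Bochner_L2)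
next
  fix u v assume u: "u \<in> Bochner_L2 T X N" and v: "v \<in> Bochner_L2 T X N"
  show "(LINT t|lebesgue_on {0<..<T}. ip (u t) (v t)) = (LINT t|lebesgue_on {0<..<T}. ip (v t) (u t))"
  proof (rule integral_cong_AE)
    show "AE t in lebesgue_on {0<..<T}. ip (u t) (v t) = ip (v t) (u t)"
      using Bochner_L2D(2)[OF u] Bochner_L2D(2)[OF v] by eventually_elim (rule ip_sym)
  qed (rule Bochner_L2_ip_measurable[OF u v] Bochner_L2_ip_measurable[OF v u])+
next
  fix u v w assume u: "u \<in> Bochner_L2 T X N" and v: "v \<in> Bochner_L2 T X N" and w: "w \<in> Bochner_L2 T X N"
  have uv: "u + v \<in> Bochner_L2 T X N" using subspace_Bochner_L2 u v by (rule subspace_add)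
  have "(LINT t|lebesgue_on {0<..<T}. ip ((u + v) t) (w t)) = (LINT t|lebesgue_on {0<..<T}. ip (u t) (w t) + ip (v t) (w t))"
  proof (rule integral_cong_AE)
    show "AE t in lebesgue_on {0<..<T}. ip ((u + v) t) (w t) = ip (u t) (w t) + ip (v t) (w t)"
      using Bochner_L2D(2)[OF u] Bochner_L2D(2)[OF v] Bochner_L2D(2)[OF w]
      by eventually_elim (simp add: ip_add_left)
  qed (intro borel_measurable_add Bochner_L2_ip_measurable uv u v w)+
  also have "\<dots> = (LINT t|lebesgue_on {0<..<T}. ip (u t) (w t)) + (LINT t|lebesgue_on {0<..<T}. ip (v t) (w t))"
    using Bochner_L2_ip_integrable[OF u w] Bochner_L2_ip_integrable[OF v w] by simp
  finally show "(LINT t|lebesgue_on {0<..<T}. ip ((u + v) t) (w t)) =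
    (LINT t|lebesgue_on {0<..<T}. ip (u t) (w t)) + (LINT t|lebesgue_on {0<..<T}. ip (v t) (w t))" .
next
  fix c u v assume u: "u \<in> Bochner_L2 T X N" and v: "v \<in> Bochner_L2 T X N"
  have cu: "c *\<^sub>R u \<in> Bochner_L2 T X N" using subspace_Bochner_L2 u by (rule subspace_scale)
  have "(LINT t|lebesgue_on {0<..<T}. ip ((c *\<^sub>R u) t) (v t)) = (LINT t|lebesgue_on {0<..<T}. c * ip (u t) (v t))"
  proof (rule integral_cong_AE)
    show "AE t in lebesgue_on {0<..<T}. ip ((c *\<^sub>R u) t) (v t) = c * ip (u t) (v t)"
      using Bochner_L2D(2)[OF u] Bochner_L2D(2)[OF v]
      by eventually_elim (simp add: ip_scale_left)
  qed (intro borel_measurable_times borel_measurable_const Bochner_L2_ip_measurable cu u v)+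
  then show "(LINT t|lebesgue_on {0<..<T}. ip ((c *\<^sub>R u) t) (v t)) = c * (LINT t|lebesgue_on {0<..<T}. ip (u t) (v t))"
    by simp
next
  fix u assume u: "u \<in> Bochner_L2 T X N"
  show "0 \<le> (LINT t|lebesgue_on {0<..<T}. ip (u t) (u t))"
  proof (rule integral_nonneg_AE)
    show "AE t in lebesgue_on {0<..<T}. 0 \<le> ip (u t) (u t)"
      using Bochner_L2D(2)[OF u] by eventually_elim (rule ip_nonneg)
  qed
qed simp

lemma Bochner_L2_const:
  assumes "\<eta> \<in> X"
  shows "(\<lambda>t. \<eta>) \<in> Bochner_L2 T X N"
proof (rule Bochner_L2I)
  show "strongly_measurable T X N (\<lambda>t. \<eta>)"
    unfolding strongly_measurable_def using assms by (intro exI[of _ "\<lambda>k t. \<eta>"]) (auto simp: N_zero)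
  show "integrable (lebesgue_on {0<..<T}) (\<lambda>t. (N \<eta>)\<^sup>2)"
    by (intro finite_measure.integrable_const finite_measure_lebesgue_on) simp
qed (use assms in auto)

text \<open>Only Lipschitz bounds are asked of \<open>f\<close>, not linearity, because one instance
  is the Riesz lift, which is chosen by \<open>SOME\<close> and linear only up to seminorm
  zero.\<close>

lemma Bochner_L2_transform:
  assumes Y: "semi_inner_space Y ip' N'" and v: "v \<in> Bochner_L2 T X N"
    and f: "\<And>x. x \<in> X \<Longrightarrow> f x \<in> Y"
    and b: "\<And>x y. x \<in> X \<Longrightarrow> y \<in> X \<Longrightarrow> N' (f x - f y) \<le> C * N (x - y)" "\<And>x. x \<in> X \<Longrightarrow> N' (f x) \<le> C * N x"
  shows "(\<lambda>t. f (v t)) \<in> Bochner_L2 T Y N'"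
proof (rule semi_inner_space.Bochner_L2I[OF Y])
  interpret Y: semi_inner_space Y ip' N' by (rule Y)
  obtain s where s: "\<And>k. simple_function (lebesgue_on {0<..<T}) (s k)"
    "\<And>k t. t \<in> {0<..<T} \<Longrightarrow> s k t \<in> X"
    "AE t in lebesgue_on {0<..<T}. (\<lambda>k::nat. N (s k t - v t)) \<longlonglongrightarrow> 0"
    using strongly_measurableE[OF Bochner_L2D(1)[OF v]] by blast
  have "AE t in lebesgue_on {0<..<T}. t \<in> {0<..<T}" by (rule AE_I2) simp
  then have "AE t in lebesgue_on {0<..<T}. (\<lambda>k. N' (f (s k t) - f (v t))) \<longlonglongrightarrow> 0"
    using s(3) Bochner_L2D(2)[OF v]
  proof eventually_elim
    case (elim t)
    have b: "norm (N' (f (s k t) - f (v t))) \<le> C * N (s k t - v t)" for k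
      using b(1)[OF s(2)[OF elim(1)] elim(3)] Y.N_nonneg[OF Y.mem_diff[OF f f]] s(2) elim by simp
    have "(\<lambda>k. C * N (s k t - v t)) \<longlonglongrightarrow> 0" using elim(2) by (rule tendsto_mult_right_zero)
    then show ?case by (rule Lim_null_comparison[OF always_eventually[OF allI[OF b]]])
  qed
  moreover have "simple_function (lebesgue_on {0<..<T}) (\<lambda>t. f (s k t))" for k
    using simple_function_compose[OF s(1)[of k], of f] by (simp add: comp_def)
  ultimately show "strongly_measurable T Y N' (\<lambda>t. f (v t))"
    unfolding strongly_measurable_def using s(2) f
    by (intro exI[of _ "\<lambda>k t. f (s k t)"]) auto
  show "AE t in lebesgue_on {0<..<T}. f (v t) \<in> Y"
    using Bochner_L2D(2)[OF v] by eventually_elim (rule f)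
  show "integrable (lebesgue_on {0<..<T}) (\<lambda>t. C\<^sup>2 * (N (v t))\<^sup>2)"
    using Bochner_L2D(3)[OF v] by simp
  show "AE t in lebesgue_on {0<..<T}. (N' (f (v t)))\<^sup>2 \<le> C\<^sup>2 * (N (v t))\<^sup>2"
    using Bochner_L2D(2)[OF v]
  proof eventually_elim
    case (elim t)
    then have "(N' (f (v t)))\<^sup>2 \<le> (C * N (v t))\<^sup>2"
      using b(2)[OF elim] Y.N_nonneg[OF f[OF elim]] by (intro power_mono)
    then show ?case by (simp add: power_mult_distrib)
  qed
qed

text \<open>The values of the approximating simple functions form a countable set. Testing with
  \<open>D\<close> alone keeps exceptional null sets independent of the test element.\<close>

lemma strongly_measurable_separable:
  assumes "strongly_measurable T X N v"
  obtains D where "countable D" "D \<subseteq> X"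
    "AE t in lebesgue_on {0<..<T}. \<exists>s. (\<forall>k. s k \<in> D) \<and> (\<lambda>k::nat. N (s k - v t)) \<longlonglongrightarrow> 0"
proof -
  obtain s where s: "\<And>k. simple_function (lebesgue_on {0<..<T}) (s k)"
    "\<And>k t. t \<in> {0<..<T} \<Longrightarrow> s k t \<in> X"
    "AE t in lebesgue_on {0<..<T}. (\<lambda>k::nat. N (s k t - v t)) \<longlonglongrightarrow> 0"
    using strongly_measurableE[OF assms] by blast
  define D where "D = (\<Union>k. s k ` {0<..<T})"
  have "AE t in lebesgue_on {0<..<T}. t \<in> {0<..<T}" by (rule AE_I2) simp
  then have "AE t in lebesgue_on {0<..<T}. \<exists>s. (\<forall>k. s k \<in> D) \<and> (\<lambda>k::nat. N (s k - v t)) \<longlonglongrightarrow> 0"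
    using s(3)
  proof eventually_elim
    case (elim t)
    then show ?case by (intro exI[of _ "\<lambda>k. s k t"]) (auto simp: D_def intro!: exI imageI)
  qed
  moreover have "countable D"
    using simple_functionD(1)[OF s(1)] unfolding D_def
    by (intro countable_UN countableI_type) (simp add: countable_finite)
  moreover have "D \<subseteq> X" using s(2) by (auto simp: D_def)
  ultimately show ?thesis using that by blast
qed

end

section \<open>Square integrable functions\<close>

lemma L2_mult_integrable:
  assumes "u \<in> L2 \<Omega>" "v \<in> L2 \<Omega>"
  shows "integrable (lebesgue_on \<Omega>) (\<lambda>x. u x * v x)"
proof (rule Bochner_Integration.integrable_bound)
  show "integrable (lebesgue_on \<Omega>) (\<lambda>x. (u x)\<^sup>2 + (v x)\<^sup>2)"
    using assms unfolding L2_def by (intro Bochner_Integration.integrable_add) simp_all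
  show "(\<lambda>x. u x * v x) \<in> borel_measurable (lebesgue_on \<Omega>)"
    using assms unfolding L2_def by (intro borel_measurable_times) simp_all
  show "AE x in lebesgue_on \<Omega>. norm (u x * v x) \<le> norm ((u x)\<^sup>2 + (v x)\<^sup>2)"
  proof (rule AE_I2)
    fix x
    have "2 * (\<bar>u x\<bar> * \<bar>v x\<bar>) \<le> (u x)\<^sup>2 + (v x)\<^sup>2"
      using sum_squares_bound[of "\<bar>u x\<bar>" "\<bar>v x\<bar>"] by (simp add: mult.assoc)
    moreover have "0 \<le> \<bar>u x\<bar> * \<bar>v x\<bar>" by simp
    ultimately show "norm (u x * v x) \<le> norm ((u x)\<^sup>2 + (v x)\<^sup>2)"
      unfolding real_norm_def abs_mult by linarith
  qed
qed

lemma L2_add: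
  assumes "u \<in> L2 \<Omega>" "v \<in> L2 \<Omega>"
  shows "u + v \<in> L2 \<Omega>"
proof -
  have "integrable (lebesgue_on \<Omega>) (\<lambda>x. u x * u x + 2 * (u x * v x) + v x * v x)"
    by (intro Bochner_Integration.integrable_add Bochner_Integration.integrable_mult_right L2_mult_integrable assms)
  moreover have "(\<lambda>x. ((u + v) x)\<^sup>2) = (\<lambda>x. u x * u x + 2 * (u x * v x) + v x * v x)"
    by (auto simp: power2_eq_square algebra_simps)
  moreover have "(\<lambda>x. u x + v x) \<in> borel_measurable (lebesgue_on \<Omega>)"
    using assms unfolding L2_def by (intro borel_measurable_add) simp_all
  moreover have "u + v = (\<lambda>x. u x + v x)" by auto
  ultimately show ?thesis unfolding L2_def by simp
qed

lemma L2_scaleR: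
  assumes "u \<in> L2 \<Omega>"
  shows "c *\<^sub>R u \<in> L2 \<Omega>"
proof -
  have "integrable (lebesgue_on \<Omega>) (\<lambda>x. c\<^sup>2 * (u x)\<^sup>2)"
    using assms unfolding L2_def by (intro Bochner_Integration.integrable_mult_right) simp
  moreover have "(\<lambda>x. ((c *\<^sub>R u) x)\<^sup>2) = (\<lambda>x. c\<^sup>2 * (u x)\<^sup>2)"
    by (auto simp: power_mult_distrib)
  moreover have "(\<lambda>x. c * u x) \<in> borel_measurable (lebesgue_on \<Omega>)"
    using assms unfolding L2_def by (intro borel_measurable_times borel_measurable_const) simp_all
  moreover have "c *\<^sub>R u = (\<lambda>x. c * u x)" by auto
  ultimately show ?thesis unfolding L2_def by simp
qed

lemma semi_inner_space_L2: "semi_inner_space (L2 \<Omega>) (L2_inner \<Omega>) (L2_norm \<Omega>)"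
proof (rule semi_inner_space.intro)
  have "0 \<in> L2 \<Omega>" by (simp add: L2_def zero_fun_def)
  then show "subspace (L2 \<Omega>)" by (intro subspaceI L2_add L2_scaleR)
  show "L2_inner \<Omega> x y = L2_inner \<Omega> y x" for x y
    by (simp add: L2_inner_def mult.commute)
  show "L2_inner \<Omega> (x + y) z = L2_inner \<Omega> x z + L2_inner \<Omega> y z"
    if "x \<in> L2 \<Omega>" "y \<in> L2 \<Omega>" "z \<in> L2 \<Omega>" for x y z
    using L2_mult_integrable[OF that(1,3)] L2_mult_integrable[OF that(2,3)]
    by (simp add: L2_inner_def distrib_right)
  show "L2_inner \<Omega> (c *\<^sub>R x) y = c * L2_inner \<Omega> x y" for c x y
    by (simp add: L2_inner_def mult.assoc)
  show "0 \<le> L2_inner \<Omega> x x" for x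
    unfolding L2_inner_def by (rule integral_nonneg_AE) simp
  show "L2_norm \<Omega> x = sqrt (L2_inner \<Omega> x x)" for x
    by (rule L2_norm_def)
qed

interpretation L2: semi_inner_space "L2 \<Omega>" "L2_inner \<Omega>" "L2_norm \<Omega>" for \<Omega> :: "'a::euclidean_space set"
  by (rule semi_inner_space_L2)

lemma L2_norm_eq_0_iff:
  assumes "u \<in> L2 \<Omega>"
  shows "L2_norm \<Omega> u = 0 \<longleftrightarrow> (AE x in lebesgue_on \<Omega>. u x = 0)"
proof -
  have "L2_norm \<Omega> u = 0 \<longleftrightarrow> (LINT x|lebesgue_on \<Omega>. u x * u x) = 0"
    using L2.ip_nonneg[OF assms] by (simp add: L2_norm_def L2_inner_def)
  also have "\<dots> \<longleftrightarrow> (AE x in lebesgue_on \<Omega>. u x * u x = 0)"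
    using L2_mult_integrable[OF assms assms] by (rule integral_nonneg_eq_0_iff_AE) simp
  finally show ?thesis by simp
qed

section \<open>Completeness of L2\<close>

lemma nn_integral_L2_norm:
  assumes "u \<in> L2 \<Omega>"
  shows "(\<integral>\<^sup>+x. ennreal ((u x)\<^sup>2) \<partial>lebesgue_on \<Omega>) = ennreal ((L2_norm \<Omega> u)\<^sup>2)"
proof -
  have "integrable (lebesgue_on \<Omega>) (\<lambda>x. (u x)\<^sup>2)" using assms by (simp add: L2_def)
  then have "(\<integral>\<^sup>+x. ennreal ((u x)\<^sup>2) \<partial>lebesgue_on \<Omega>) = ennreal (LINT x|lebesgue_on \<Omega>. (u x)\<^sup>2)"
    by (rule nn_integral_eq_integral) simp
  then show ?thesis using L2.N_square[OF assms] by (simp add: L2_inner_def flip: power2_eq_square)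
qed

text \<open>The arithmetic-geometric mean inequality gives 2 * \<bar>d k\<bar> \<le> 2^-k + 2^k * (d
  k)^2. Pointwise summability is thus traded for a sum of squares whose integral is known from L2
  norms.\<close>

lemma summable_of_geometric_weighted_squares:
  fixes d :: "nat \<Rightarrow> real"
  assumes "(\<Sum>k. ennreal (2 ^ k * (d k)\<^sup>2)) \<noteq> \<infinity>"
  shows "summable d"
proof -
  have s: "summable (\<lambda>k. 2 ^ k * (d k)\<^sup>2)"
    by (rule summable_suminf_not_top) (use assms in auto)
  have "summable (\<lambda>k. (1/2::real) ^ k + 2 ^ k * (d k)\<^sup>2)"
    by (intro summable_add s summable_geometric) simp
  then show ?thesis
  proof (rule summable_comparison_test'[where N = 0])
    fix k :: nat assume "k \<ge> 0"
    have "0 \<le> 2 ^ k * ((1/2) ^ k - \<bar>d k\<bar>)\<^sup>2" by simp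
    also have "\<dots> = (1/2::real) ^ k - 2 * \<bar>d k\<bar> + 2 ^ k * (d k)\<^sup>2"
      by (simp add: power2_eq_square algebra_simps power_one_over)
    finally show "norm (d k) \<le> (1/2::real) ^ k + 2 ^ k * (d k)\<^sup>2"
      using abs_ge_zero[of "d k"] by simp
  qed
qed

text \<open>Riesz-Fischer: a subsequence with increments below 2^-k converges almost everywhere, and
  Fatou's lemma turns its pointwise limit into an L2 limit of the whole sequence.\<close>

lemma L2_complete: "semi_inner_space.complete_seminorm (L2 \<Omega>) (L2_norm \<Omega>)"
  unfolding L2.complete_seminorm_def
proof (intro allI impI)
  fix x :: "nat \<Rightarrow> 'a \<Rightarrow> real"
  assume "\<forall>k. x k \<in> L2 \<Omega>"
    and Cauchy: "\<forall>\<epsilon>>0. \<exists>k0. \<forall>j\<ge>k0. \<forall>k\<ge>k0. L2_norm \<Omega> (x j - x k) < \<epsilon>"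
  then have x: "x k \<in> L2 \<Omega>" for k by simp
  define M where "M = lebesgue_on \<Omega>"
  have meas: "u \<in> borel_measurable M" if "u \<in> L2 \<Omega>" for u using that by (simp add: L2_def M_def)
  have "\<forall>k. \<exists>n. \<forall>i\<ge>n. \<forall>j\<ge>n. L2_norm \<Omega> (x i - x j) < (1/2) ^ k"
    using Cauchy by simp
  then obtain n where n: "\<And>k i j. i \<ge> n k \<Longrightarrow> j \<ge> n k \<Longrightarrow> L2_norm \<Omega> (x i - x j) < (1/2) ^ k"
    by metis
  \<comment> \<open>The index is at least \<open>n i\<close> for all i up to k, and at least k,
    which gives small increments and cofinality together.\<close>
  define m where "m k = (\<Sum>i\<le>k. n i) + k" for k
  have m_ge: "m j \<ge> n k" "m j \<ge> j" if "j \<ge> k" for j k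
  proof -
    have "n k \<le> (\<Sum>i\<le>j. n i)" using that by (intro member_le_sum) auto
    then show "m j \<ge> n k" "m j \<ge> j" by (auto simp: m_def)
  qed
  define z where "z k = x (m k)" for k
  have z: "z k \<in> L2 \<Omega>" for k using x by (simp add: z_def)
  define d where "d k = z (Suc k) - z k" for k
  have d: "d k \<in> L2 \<Omega>" for k unfolding d_def by (intro L2.mem_diff z)
  have d_small: "(L2_norm \<Omega> (d k))\<^sup>2 \<le> (1/4) ^ k" for k
  proof -
    have "L2_norm \<Omega> (d k) \<le> (1/2) ^ k"
      unfolding d_def z_def by (rule less_imp_le, rule n; rule m_ge(1); simp)
    then have "(L2_norm \<Omega> (d k))\<^sup>2 \<le> ((1/2) ^ k)\<^sup>2"
      by (rule power_mono[OF _ L2.N_nonneg[OF d]])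
    then show ?thesis by (simp add: power2_eq_square power_mult_distrib[symmetric])
  qed
  have "(\<integral>\<^sup>+t. (\<Sum>k. ennreal (2 ^ k * (d k t)\<^sup>2)) \<partial>M) = (\<Sum>k. \<integral>\<^sup>+t. ennreal (2 ^ k * (d k t)\<^sup>2) \<partial>M)"
    using meas[OF d] by (intro nn_integral_suminf) measurable
  also have "\<dots> = (\<Sum>k. ennreal (2 ^ k * (L2_norm \<Omega> (d k))\<^sup>2))"
  proof (rule suminf_cong)
    fix k
    have "(\<integral>\<^sup>+t. ennreal (2 ^ k * (d k t)\<^sup>2) \<partial>M) = (\<integral>\<^sup>+t. ennreal (2 ^ k) * ennreal ((d k t)\<^sup>2) \<partial>M)"
      by (simp add: ennreal_mult)
    also have "\<dots> = ennreal (2 ^ k) * (\<integral>\<^sup>+t. ennreal ((d k t)\<^sup>2) \<partial>M)"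
      using meas[OF d] by (intro nn_integral_cmult) measurable
    also have "\<dots> = ennreal (2 ^ k * (L2_norm \<Omega> (d k))\<^sup>2)"
      unfolding M_def nn_integral_L2_norm[OF d] by (simp add: ennreal_mult)
    finally show "(\<integral>\<^sup>+t. ennreal (2 ^ k * (d k t)\<^sup>2) \<partial>M) = ennreal (2 ^ k * (L2_norm \<Omega> (d k))\<^sup>2)" .
  qed
  \<comment> \<open>The squares decay like 4^-k, so the weight 2^k still leaves a convergent
    series.\<close>
  also have "\<dots> \<le> (\<Sum>k. ennreal ((1/2) ^ k))"
  proof (intro suminf_le summableI ennreal_leI)
    fix k
    have "2 ^ k * (L2_norm \<Omega> (d k))\<^sup>2 \<le> 2 ^ k * (1/4) ^ k" using d_small by (intro mult_left_mono) auto
    also have "\<dots> = (1/2::real) ^ k" by (simp flip: power_mult_distrib)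
    finally show "2 ^ k * (L2_norm \<Omega> (d k))\<^sup>2 \<le> (1/2) ^ k" .
  qed
  also have "\<dots> = ennreal (\<Sum>k. (1/2) ^ k)"
    by (intro suminf_ennreal2 summable_geometric) auto
  also have "\<dots> < \<infinity>" by simp
  finally have fin: "(\<integral>\<^sup>+t. (\<Sum>k. ennreal (2 ^ k * (d k t)\<^sup>2)) \<partial>M) \<noteq> \<infinity>" by simp
  have "AE t in M. (\<Sum>k. ennreal (2 ^ k * (d k t)\<^sup>2)) \<noteq> \<infinity>"
    by (rule nn_integral_PInf_AE[OF _ fin]) (use meas[OF d] in measurable)
  then have conv: "AE t in M. (\<lambda>k. z k t) \<longlonglongrightarrow> lim (\<lambda>k. z k t)"
  proof eventually_elim
    case (elim t)
    then have "summable (\<lambda>k. d k t)" by (rule summable_of_geometric_weighted_squares)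
    then have "convergent (\<lambda>k. \<Sum>i<k. d i t)" by (simp add: summable_iff_convergent)
    moreover have "(\<Sum>i<k. d i t) = z k t - z 0 t" for k
      by (induction k) (auto simp: d_def)
    ultimately have "convergent (\<lambda>k. z k t)"
      by (simp add: convergent_diff_const_right_iff)
    then show ?case by (simp add: convergent_LIMSEQ_iff)
  qed
  define l where "l t = lim (\<lambda>k. z k t)" for t
  have l_meas: "l \<in> borel_measurable M"
    unfolding l_def using meas[OF z] by (rule borel_measurable_lim_metric)
  \<comment> \<open>Fatou's lemma for fixed i along the subsequence. It gives membership of the
    difference x i - l first; \<open>l\<close> itself is recovered afterwards by
    subtraction.\<close>
  have close: "x i - l \<in> L2 \<Omega> \<and> L2_norm \<Omega> (x i - l) \<le> \<epsilon>"
    if "\<epsilon> > 0" and i: "\<And>k. k \<ge> k0 \<Longrightarrow> L2_norm \<Omega> (x i - x k) < \<epsilon>" for i k0 \<epsilon>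
  proof -
    have "(\<integral>\<^sup>+t. ennreal ((x i t - l t)\<^sup>2) \<partial>M) = (\<integral>\<^sup>+t. liminf (\<lambda>k. ennreal ((x i t - z k t)\<^sup>2)) \<partial>M)"
    proof (rule nn_integral_cong_AE)
      show "AE t in M. ennreal ((x i t - l t)\<^sup>2) = liminf (\<lambda>k. ennreal ((x i t - z k t)\<^sup>2))"
        using conv
      proof eventually_elim
        case (elim t)
        have "(\<lambda>k. (x i t - z k t)\<^sup>2) \<longlonglongrightarrow> (x i t - l t)\<^sup>2"
          using elim unfolding l_def[symmetric] by (intro tendsto_power tendsto_diff tendsto_const)
        then have "(\<lambda>k. ennreal ((x i t - z k t)\<^sup>2)) \<longlonglongrightarrow> ennreal ((x i t - l t)\<^sup>2)"
          by (rule tendsto_ennrealI)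
        then show ?case by (intro lim_imp_Liminf[symmetric]) auto
      qed
    qed
    also have "\<dots> \<le> liminf (\<lambda>k. \<integral>\<^sup>+t. ennreal ((x i t - z k t)\<^sup>2) \<partial>M)"
      using meas[OF z] meas[OF x] by (intro nn_integral_liminf) measurable
    also have "\<dots> \<le> ennreal (\<epsilon>\<^sup>2)"
    proof -
      have "(\<integral>\<^sup>+t. ennreal ((x i t - z k t)\<^sup>2) \<partial>M) \<le> ennreal (\<epsilon>\<^sup>2)" if "k \<ge> k0" for k
      proof -
        have xz: "x i - z k \<in> L2 \<Omega>" by (intro L2.mem_diff x z)
        have "L2_norm \<Omega> (x i - z k) \<le> \<epsilon>"
          unfolding z_def using i[of "m k"] m_ge(2)[of k k] that by simp
        then have "(L2_norm \<Omega> (x i - z k))\<^sup>2 \<le> \<epsilon>\<^sup>2"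
          using L2.N_nonneg[OF xz] by (intro power_mono)
        then show ?thesis using nn_integral_L2_norm[OF xz] unfolding M_def by (simp add: ennreal_leI)
      qed
      then have "\<forall>\<^sub>F k in sequentially. (\<integral>\<^sup>+t. ennreal ((x i t - z k t)\<^sup>2) \<partial>M) \<le> ennreal (\<epsilon>\<^sup>2)"
        by (auto simp: eventually_sequentially)
      then have "liminf (\<lambda>k. \<integral>\<^sup>+t. ennreal ((x i t - z k t)\<^sup>2) \<partial>M) \<le> liminf (\<lambda>k::nat. ennreal (\<epsilon>\<^sup>2))"
        by (rule Liminf_mono)
      then show ?thesis by (simp add: Liminf_const)
    qed
    finally have le: "(\<integral>\<^sup>+t. ennreal ((x i t - l t)\<^sup>2) \<partial>M) \<le> ennreal (\<epsilon>\<^sup>2)" .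
    have mm: "(\<lambda>t. x i t - l t) \<in> borel_measurable M" using meas[OF x] l_meas by measurable
    have "integrable M (\<lambda>t. (x i t - l t)\<^sup>2)"
    proof (rule integrableI_bounded)
      show "(\<lambda>t. (x i t - l t)\<^sup>2) \<in> borel_measurable M" using mm by measurable
      show "(\<integral>\<^sup>+t. ennreal (norm ((x i t - l t)\<^sup>2)) \<partial>M) < \<infinity>"
        using le by (simp add: le_less_trans[OF _ ennreal_less_top])
    qed
    then have mem: "x i - l \<in> L2 \<Omega>" using mm by (simp add: L2_def M_def fun_diff_def)
    moreover have "ennreal ((L2_norm \<Omega> (x i - l))\<^sup>2) \<le> ennreal (\<epsilon>\<^sup>2)"
      using le nn_integral_L2_norm[OF mem] unfolding M_def by simp
    then have "(L2_norm \<Omega> (x i - l))\<^sup>2 \<le> \<epsilon>\<^sup>2" by simp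
    then have "L2_norm \<Omega> (x i - l) \<le> \<epsilon>" by (rule power2_le_imp_le) (use \<open>\<epsilon> > 0\<close> in simp)
    ultimately show ?thesis by simp
  qed
  obtain k1 where k1: "\<And>j k. j \<ge> k1 \<Longrightarrow> k \<ge> k1 \<Longrightarrow> L2_norm \<Omega> (x j - x k) < 1"
    using Cauchy zero_less_one by blast
  have "x k1 - l \<in> L2 \<Omega>" using close[of 1 k1 k1] k1 by simp
  then have "x k1 - (x k1 - l) \<in> L2 \<Omega>" by (rule L2.mem_diff[OF x])
  then have l: "l \<in> L2 \<Omega>" by simp
  have "(\<lambda>k. L2_norm \<Omega> (x k - l)) \<longlonglongrightarrow> 0"
  proof (rule LIMSEQ_I)
    fix \<epsilon> :: real assume "\<epsilon> > 0"
    then obtain k0 where k0: "\<And>j k. j \<ge> k0 \<Longrightarrow> k \<ge> k0 \<Longrightarrow> L2_norm \<Omega> (x j - x k) < \<epsilon> / 2"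
      using Cauchy[rule_format, of "\<epsilon> / 2"] by auto
    have "norm (L2_norm \<Omega> (x k - l) - 0) < \<epsilon>" if "k \<ge> k0" for k
    proof -
      have "L2_norm \<Omega> (x k - l) \<le> \<epsilon> / 2"
        using close[of "\<epsilon>/2" k0 k, OF _ k0[OF that]] \<open>\<epsilon> > 0\<close> by simp
      then show ?thesis using \<open>\<epsilon> > 0\<close> L2.N_nonneg[OF L2.mem_diff[OF x[of k] l]] by simp
    qed
    then show "\<exists>k0. \<forall>k\<ge>k0. norm (L2_norm \<Omega> (x k - l) - 0) < \<epsilon>" by blast
  qed
  then show "\<exists>l\<in>L2 \<Omega>. (\<lambda>k. L2_norm \<Omega> (x k - l)) \<longlonglongrightarrow> 0" using l by blast
qed

section \<open>Test functions\<close>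

text \<open>The power of t makes the span of the family closed under differentiation: the derivative
  of \<open>flat n\<close> combines \<open>flat (n + 2)\<close> and \<open>flat (n + 1)\<close>. The
  member \<open>flat 0\<close> is the classical smooth function that is flat at 0.\<close>

definition flat :: "nat \<Rightarrow> real \<Rightarrow> real" where
  "flat n t = (if t > 0 then exp (- 1 / t) / t ^ n else 0)"

lemma flat_tendsto_0: "(flat n \<longlongrightarrow> 0) (at 0)"
  unfolding filterlim_at_split
proof
  have "\<forall>\<^sub>F t in at_left (0::real). 0 = flat n t"
    unfolding eventually_at_left_field by (auto simp: flat_def intro: exI[of _ "-1"])
  then show "(flat n \<longlongrightarrow> 0) (at_left 0)" by (rule Lim_transform_eventually[OF tendsto_const])
  have "((\<lambda>t. (inverse t) ^ n / exp (inverse t)) \<longlongrightarrow> 0) (at_right (0::real))"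
    by (rule filterlim_compose[OF tendsto_power_div_exp_0 filterlim_inverse_at_top_right])
  moreover have "\<forall>\<^sub>F t in at_right (0::real). (inverse t) ^ n / exp (inverse t) = flat n t"
    unfolding eventually_at_right_field
    by (intro exI[of _ 1]) (auto simp: flat_def exp_minus field_simps)
  ultimately show "(flat n \<longlongrightarrow> 0) (at_right 0)" by (rule Lim_transform_eventually)
qed

lemma flat_has_real_derivative:
  "(flat n has_real_derivative (flat (n + 2) t - n * flat (n + 1) t)) (at t)"
proof -
  consider "t > 0" | "t < 0" | "t = 0" by linarith
  then show ?thesis
  proof cases
    case 1
    have "((\<lambda>t. exp (- 1 / t) / t ^ n) has_real_derivative flat (n + 2) t - n * flat (n + 1) t) (at t)"
    proof (cases n)
      case 0
      with 1 show ?thesis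
        by (auto intro!: derivative_eq_intros simp: flat_def power2_eq_square)
    next
      case (Suc k)
      have "((\<lambda>t. exp (- 1 / t)) has_real_derivative exp (- 1 / t) * (1 / t\<^sup>2)) (at t)"
        using 1 by (auto intro!: derivative_eq_intros simp: power2_eq_square)
      moreover have "((\<lambda>t. t ^ n) has_real_derivative real n * t ^ k) (at t)"
        using DERIV_pow[of n t UNIV] Suc by simp
      ultimately have "((\<lambda>t. exp (- 1 / t) / t ^ n) has_real_derivative
          (exp (- 1 / t) * (1 / t\<^sup>2) * t ^ n - exp (- 1 / t) * (real n * t ^ k)) / (t ^ n * t ^ n)) (at t)"
        using 1 by (intro DERIV_divide) auto
      also have "(exp (- 1 / t) * (1 / t\<^sup>2) * t ^ n - exp (- 1 / t) * (real n * t ^ k)) / (t ^ n * t ^ n)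
        = flat (n + 2) t - n * flat (n + 1) t"
        using 1 unfolding Suc by (simp add: flat_def field_simps power2_eq_square)
      finally show ?thesis .
    qed
    then show ?thesis
      by (rule DERIV_cong_ev[OF refl _ refl, THEN iffD1, rotated])
         (use 1 in \<open>auto simp: flat_def intro!: eventually_mono[OF eventually_nhds_in_open[of "{0<..}" t]]\<close>)
  next
    case 2
    have "\<forall>\<^sub>F s in nhds t. 0 = flat n s"
      by (rule eventually_mono[OF eventually_nhds_in_open[of "{..<0}" t]]) (use 2 in \<open>auto simp: flat_def\<close>)
    then have "(flat n has_real_derivative 0) (at t)"
      by (rule DERIV_cong_ev[OF refl _ refl, THEN iffD1]) simp
    then show ?thesis using 2 by (simp add: flat_def)
  next
    case 3
    \<comment> \<open>At 0 the difference quotient is the next member of the family, so it tends to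
      0.\<close>
    have "\<forall>\<^sub>F h in at (0::real). flat (n + 1) h = (flat n (0 + h) - flat n 0) / h"
      by (intro always_eventually allI) (auto simp: flat_def)
    then have "((\<lambda>h. (flat n (0 + h) - flat n 0) / h) \<longlongrightarrow> 0) (at 0)"
      by (rule Lim_transform_eventually[OF flat_tendsto_0])
    then have "(flat n has_real_derivative 0) (at 0)" by (simp add: DERIV_def)
    then show ?thesis using 3 by (simp add: flat_def)
  qed
qed

text \<open>A class generated by its syntax and closed under partial derivatives: one first-order
  statement then yields \<open>C_k\<close> for every k by induction.\<close>

inductive_set smooth_functions :: "('a::euclidean_space \<Rightarrow> real) set" where
  const: "(\<lambda>x. c) \<in> smooth_functions"
| inner: "(\<lambda>x. x \<bullet> b) \<in> smooth_functions"
| add: "f \<in> smooth_functions \<Longrightarrow> g \<in> smooth_functions \<Longrightarrow> (\<lambda>x. f x + g x) \<in> smooth_functions"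
| mult: "f \<in> smooth_functions \<Longrightarrow> g \<in> smooth_functions \<Longrightarrow> (\<lambda>x. f x * g x) \<in> smooth_functions"
| flat: "f \<in> smooth_functions \<Longrightarrow> (\<lambda>x. flat n (f x)) \<in> smooth_functions"

lemma smooth_functions_derivative:
  assumes "f \<in> smooth_functions"
  shows "\<exists>f'. (\<forall>x. (f has_derivative f' x) (at x)) \<and> (\<forall>i. (\<lambda>x. f' x i) \<in> smooth_functions)"
  using assms
proof induction
  case (const c)
  show ?case by (intro exI[of _ "\<lambda>x h. 0"]) (auto intro: smooth_functions.const)
next
  case (inner b)
  show ?case
    by (intro exI[of _ "\<lambda>x h. h \<bullet> b"])
       (auto intro!: smooth_functions.const bounded_linear_imp_has_derivative bounded_linear_inner_left)
next
  case (add f g)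
  then obtain f' g' where *: "\<And>x. (f has_derivative f' x) (at x)" "\<And>i. (\<lambda>x. f' x i) \<in> smooth_functions"
    "\<And>x. (g has_derivative g' x) (at x)" "\<And>i. (\<lambda>x. g' x i) \<in> smooth_functions" by metis
  show ?case
    by (intro exI[of _ "\<lambda>x h. f' x h + g' x h"] conjI allI has_derivative_add smooth_functions.add *)
next
  case (mult f g)
  then obtain f' g' where *: "\<And>x. (f has_derivative f' x) (at x)" "\<And>i. (\<lambda>x. f' x i) \<in> smooth_functions"
    "\<And>x. (g has_derivative g' x) (at x)" "\<And>i. (\<lambda>x. g' x i) \<in> smooth_functions" by metis
  show ?case
    by (intro exI[of _ "\<lambda>x h. f x * g' x h + f' x h * g x"] conjI allI has_derivative_mult
        smooth_functions.add smooth_functions.mult * mult.hyps)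
next
  case (flat f n)
  then obtain f' where *: "\<And>x. (f has_derivative f' x) (at x)" "\<And>i. (\<lambda>x. f' x i) \<in> smooth_functions"
    by metis
  have "((\<lambda>x. flat n (f x)) has_derivative
      (\<lambda>h. f' x h * (flat (n + 2) (f x) + (- real n) * flat (n + 1) (f x)))) (at x)" for x
  proof -
    have "(flat n has_derivative (\<lambda>h. h * (flat (n + 2) (f x) + (- real n) * flat (n + 1) (f x)))) (at (f x))"
      using flat_has_real_derivative[of n "f x"]
      by (simp add: has_field_derivative_def mult_commute_abs)
    from has_derivative_compose[OF *(1) this] show ?thesis .
  qed
  then show ?case
    by (intro exI[of _ "\<lambda>x h. f' x h * (flat (n + 2) (f x) + (- real n) * flat (n + 1) (f x))"] conjI allI
        smooth_functions.add smooth_functions.mult smooth_functions.const smooth_functions.flat * flat.hyps)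
qed

lemma smooth_functions_C_k: "f \<in> smooth_functions \<Longrightarrow> C_k k f"
proof (induction k arbitrary: f)
  case 0
  then obtain f' where "\<And>x. (f has_derivative f' x) (at x)" using smooth_functions_derivative by blast
  then show ?case
    by (auto intro!: continuous_at_imp_continuous_on has_derivative_continuous)
next
  case (Suc k)
  then obtain f' where f': "\<And>x. (f has_derivative f' x) (at x)" "\<And>i. (\<lambda>x. f' x i) \<in> smooth_functions"
    using smooth_functions_derivative by blast
  have "frechet_derivative f (at x) = f' x" for x using frechet_derivative_at[OF f'(1)] by simp
  then show ?case using Suc.IH[OF f'(2)] f'(1) by (auto simp: differentiable_def)
qed

lemma smooth_functions_sum:
  "(\<And>i. i \<in> A \<Longrightarrow> f i \<in> smooth_functions) \<Longrightarrow> (\<lambda>x. \<Sum>i\<in>A. f i x) \<in> smooth_functions"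
  by (induction A rule: infinite_finite_induct) (auto intro: smooth_functions.intros)

lemma smooth_functions_prod:
  "(\<And>i. i \<in> A \<Longrightarrow> f i \<in> smooth_functions) \<Longrightarrow> (\<lambda>x. \<Prod>i\<in>A. f i x) \<in> smooth_functions"
  by (induction A rule: infinite_finite_induct) (auto intro: smooth_functions.intros)

text \<open>Expanded in coordinates, with (-1) as a factor in place of subtraction, to match the
  rules of \<open>smooth_functions\<close>; \<open>bump_eq\<close> is the radial form. Increasing
  \<open>k\<close> pushes the values on the open ball to 1.\<close>

definition bump :: "'a::euclidean_space \<Rightarrow> real \<Rightarrow> nat \<Rightarrow> 'a \<Rightarrow> real" where
  "bump c r k x = flat 0 (real k * (r\<^sup>2 + (-1) * (\<Sum>i\<in>Basis. (x \<bullet> i + - (c \<bullet> i)) * (x \<bullet> i + - (c \<bullet> i)))))"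

lemma bump_eq: "bump c r k x = flat 0 (k * (r\<^sup>2 - (dist c x)\<^sup>2))"
proof -
  have "(dist c x)\<^sup>2 = (x - c) \<bullet> (x - c)"
    by (simp only: dist_commute[of c x] dist_norm[of x c] power2_norm_eq_inner)
  also have "\<dots> = (\<Sum>i\<in>Basis. (x \<bullet> i + - (c \<bullet> i)) * (x \<bullet> i + - (c \<bullet> i)))"
    by (subst euclidean_inner) (simp add: inner_diff_left)
  finally have "(\<Sum>i\<in>Basis. (x \<bullet> i + - (c \<bullet> i)) * (x \<bullet> i + - (c \<bullet> i))) = (dist c x)\<^sup>2" ..
  then show ?thesis by (simp add: bump_def)
qed

lemma bump_smooth: "bump c r k \<in> smooth_functions"
  unfolding bump_def[abs_def]
  by (intro smooth_functions.flat smooth_functions.mult smooth_functions.add smooth_functions.const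
      smooth_functions_sum smooth_functions.inner)

lemma flat_0_bounds: "0 \<le> flat 0 t" "flat 0 t \<le> 1"
  by (auto simp: flat_def)

lemma bump_bounds: "0 \<le> bump c r k x" "bump c r k x \<le> 1"
  by (simp_all add: bump_eq flat_0_bounds)

lemma bump_eq_0: "r > 0 \<Longrightarrow> x \<notin> ball c r \<Longrightarrow> bump c r k x = 0"
  by (auto simp: bump_eq flat_def zero_less_mult_iff power_mono not_less)

lemma bump_tendsto_1:
  assumes "x \<in> ball c r"
  shows "(\<lambda>k. bump c r k x) \<longlonglongrightarrow> 1"
proof -
  define s where "s = r\<^sup>2 - (dist c x)\<^sup>2"
  have s: "s > 0" using assms by (auto simp: s_def intro!: power_strict_mono)
  have "(\<lambda>k. exp (- (inverse s * inverse (real k)))) \<longlonglongrightarrow> exp (- (inverse s * 0))"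
    by (intro tendsto_intros tendsto_exp lim_inverse_n)
  moreover have "\<forall>\<^sub>F k in sequentially. exp (- (inverse s * inverse (real k))) = bump c r k x"
    using eventually_gt_at_top[of 0]
    by eventually_elim (use s in \<open>auto simp: bump_eq flat_def s_def[symmetric] inverse_eq_divide\<close>)
  ultimately show ?thesis using Lim_transform_eventually by force
qed

section \<open>Approximation of indicators and the fundamental lemma\<close>

lemma test_functionsI:
  assumes "\<phi> \<in> smooth_functions" "compact K" "K \<subseteq> \<Omega>" "\<And>x. x \<notin> K \<Longrightarrow> \<phi> x = 0"
  shows "\<phi> \<in> test_functions \<Omega>"
  using assms smooth_functions_C_k unfolding test_functions_def by blast

text \<open>An open set is a countable union of balls whose closures stay inside it. A product of
  factors 1 - bump is smooth and tends to 0 as soon as one factor does, so 1 minus the product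
  approximates the indicator within [0, 1].\<close>

lemma indicator_open_approx:
  fixes U :: "'a::euclidean_space set"
  assumes "open U" "U \<subseteq> \<Omega>"
  obtains \<phi> where "\<And>k. \<phi> k \<in> test_functions \<Omega>" "\<And>k x. 0 \<le> \<phi> k x" "\<And>k x. \<phi> k x \<le> 1"
    "\<And>x. (\<lambda>k::nat. \<phi> k x) \<longlonglongrightarrow> indicator U x"
proof (cases "U = {}")
  case True
  have "(\<lambda>x. 0) \<in> test_functions \<Omega>"
    by (rule test_functionsI[OF smooth_functions.const, of "{}"]) auto
  then show ?thesis using True by (intro that[of "\<lambda>k x. 0"]) auto
next
  case False
  \<comment> \<open>Closed balls inside \<open>U\<close> will provide the compact supports.\<close>
  define F where "F = {ball x r |x r. r > 0 \<and> cball x r \<subseteq> U}"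
  have "\<Union>F = U"
  proof
    show "\<Union>F \<subseteq> U"
      unfolding F_def using ball_subset_cball by blast
    show "U \<subseteq> \<Union>F"
    proof
      fix x assume "x \<in> U"
      then obtain r where "r > 0" "cball x r \<subseteq> U" using \<open>open U\<close> open_contains_cball by blast
      then show "x \<in> \<Union>F" unfolding F_def using centre_in_ball by blast
    qed
  qed
  moreover obtain F' where F': "F' \<subseteq> F" "countable F'" "\<Union>F' = \<Union>F"
    by (rule Lindelof[of F]) (auto simp: F_def)
  ultimately have F'_U: "\<Union>F' = U" by simp
  with False have ne: "F' \<noteq> {}" by auto
  have "\<forall>i. \<exists>x r. from_nat_into F' i = ball x r \<and> r > 0 \<and> cball x r \<subseteq> U"
    using from_nat_into[OF ne] F'(1) unfolding F_def by blast
  then obtain c \<rho> where c: "\<And>i. from_nat_into F' i = ball (c i) (\<rho> i)" "\<And>i. \<rho> i > 0" "\<And>i. cball (c i) (\<rho> i) \<subseteq> U"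
    by metis
  have U_eq: "U = (\<Union>i. ball (c i) (\<rho> i))"
    using range_from_nat_into[OF ne F'(2)] F'_U by (simp add: c(1)[symmetric])
  \<comment> \<open>\<open>k\<close> is both the number of factors and the sharpness of each, so one
    index gives compact supports and pointwise convergence.\<close>
  define P where "P k x = (\<Prod>i<k. 1 + (-1) * bump (c i) (\<rho> i) k x)" for k x
  have P_bounds: "0 \<le> P k x" "P k x \<le> 1" for k x
    unfolding P_def using bump_bounds by (auto intro!: prod_nonneg prod_le_1)
  define \<phi> where "\<phi> k x = 1 + (-1) * P k x" for k x
  show ?thesis
  proof (rule that)
    show "\<phi> k \<in> test_functions \<Omega>" for k
    proof (rule test_functionsI)
      show "\<phi> k \<in> smooth_functions"
        unfolding \<phi>_def P_def
        by (intro smooth_functions.add smooth_functions.mult smooth_functions.const smooth_functions_prod bump_smooth)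
      show "compact (\<Union>i<k. cball (c i) (\<rho> i))" by (intro compact_UN) auto
      show "(\<Union>i<k. cball (c i) (\<rho> i)) \<subseteq> \<Omega>" using c(3) assms(2) by blast
      show "\<phi> k x = 0" if "x \<notin> (\<Union>i<k. cball (c i) (\<rho> i))" for x
      proof -
        have "bump (c i) (\<rho> i) k x = 0" if "i < k" for i
          using \<open>x \<notin> _\<close> that ball_subset_cball[of "c i" "\<rho> i"] by (intro bump_eq_0 c) blast
        then show ?thesis by (simp add: \<phi>_def P_def)
      qed
    qed
    show "0 \<le> \<phi> k x" "\<phi> k x \<le> 1" for k x using P_bounds[of k x] by (auto simp: \<phi>_def)
    show "(\<lambda>k. \<phi> k x) \<longlonglongrightarrow> indicator U x" for x
    proof (cases "x \<in> U")
      case True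
      then obtain j where j: "x \<in> ball (c j) (\<rho> j)" using U_eq by blast
      \<comment> \<open>One factor bounds the product, since the others lie in [0, 1].\<close>
      have b: "P k x \<le> 1 - bump (c j) (\<rho> j) k x" if "k > j" for k
      proof -
        have "P k x = (1 + (-1) * bump (c j) (\<rho> j) k x) * (\<Prod>i\<in>{..<k} - {j}. 1 + (-1) * bump (c i) (\<rho> i) k x)"
          unfolding P_def using that by (intro prod.remove) auto
        also have "\<dots> \<le> (1 + (-1) * bump (c j) (\<rho> j) k x) * 1"
          using bump_bounds by (intro mult_left_mono prod_le_1) auto
        finally show ?thesis by simp
      qed
      have "(\<lambda>k. 1 - bump (c j) (\<rho> j) k x) \<longlonglongrightarrow> 1 - 1"
        by (intro tendsto_diff tendsto_const bump_tendsto_1 j)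
      then have "(\<lambda>k. 1 - bump (c j) (\<rho> j) k x) \<longlonglongrightarrow> 0" by simp
      then have "(\<lambda>k. P k x) \<longlonglongrightarrow> 0"
      proof (rule tendsto_sandwich[OF _ _ tendsto_const, rotated 2])
        show "\<forall>\<^sub>F k in sequentially. 0 \<le> P k x" using P_bounds by simp
        show "\<forall>\<^sub>F k in sequentially. P k x \<le> 1 - bump (c j) (\<rho> j) k x"
          using eventually_gt_at_top[of j] by eventually_elim (rule b)
      qed
      then have "(\<lambda>k. \<phi> k x) \<longlonglongrightarrow> 1 + (-1) * 0"
        unfolding \<phi>_def by (intro tendsto_add tendsto_mult tendsto_const)
      then show ?thesis using True by simp
    next
      case False
      have "bump (c i) (\<rho> i) k x = 0" for i k
        using False U_eq by (intro bump_eq_0 c) blast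
      then show ?thesis using False by (simp add: \<phi>_def P_def)
    qed
  qed
qed

lemma test_function_continuous: "\<phi> \<in> test_functions \<Omega> \<Longrightarrow> continuous_on UNIV \<phi>"
  unfolding test_functions_def using C_k.simps(1) by blast

lemma borel_measurable_lebesgue_on_continuous:
  fixes f :: "'a::euclidean_space \<Rightarrow> real"
  assumes "continuous_on UNIV f"
  shows "f \<in> borel_measurable (lebesgue_on \<Omega>)"
  using borel_measurable_continuous_onI[OF assms]
  by (intro measurable_restrict_space1 measurable_completion) simp

lemma test_function_measurable: "\<phi> \<in> test_functions \<Omega> \<Longrightarrow> \<phi> \<in> borel_measurable (lebesgue_on S)"
  by (rule borel_measurable_lebesgue_on_continuous[OF test_function_continuous])

text \<open>Dominated convergence with majorant \<bar>g\<bar> makes the integral of \<open>g\<close>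
  vanish over open sets and then over G_delta sets, hence over all measurable sets up to null sets.
  The sets where \<open>g\<close> is positive or negative conclude.\<close>

theorem fundamental_lemma:
  fixes g :: "'a::euclidean_space \<Rightarrow> real"
  assumes \<Omega>: "open \<Omega>" and g: "integrable (lebesgue_on \<Omega>) g"
    and zero: "\<And>\<phi>. \<phi> \<in> test_functions \<Omega> \<Longrightarrow> (LINT x|lebesgue_on \<Omega>. g x * \<phi> x) = 0"
  shows "AE x in lebesgue_on \<Omega>. g x = 0"
proof -
  define M where "M = lebesgue_on \<Omega>"
  have \<Omega>_sets: "\<Omega> \<in> sets lebesgue" using \<Omega> by simp
  have gm[measurable]: "g \<in> borel_measurable M" using g unfolding M_def by (rule borel_measurable_integrable)
  have dominated: "(\<lambda>k. LINT x|M. g x * f k x) \<longlonglongrightarrow> (LINT x|M. g x * indicator E x)"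
    if "\<And>k. f k \<in> borel_measurable M" "\<And>k x. \<bar>f k x\<bar> \<le> 1" "\<And>x. x \<in> \<Omega> \<Longrightarrow> (\<lambda>k. f k x) \<longlonglongrightarrow> indicator E x"
      "E \<inter> \<Omega> \<in> sets M"
    for f :: "nat \<Rightarrow> 'a \<Rightarrow> real" and E
  proof (rule integral_dominated_convergence[where w = "\<lambda>x. \<bar>g x\<bar>"])
    have "(\<lambda>x. g x * indicator (E \<inter> \<Omega>) x) \<in> borel_measurable M"
      using that(4) gm by (intro borel_measurable_times borel_measurable_indicator)
    then show "(\<lambda>x. g x * indicator E x) \<in> borel_measurable M"
      by (rule measurable_cong[THEN iffD1, rotated]) (auto simp: M_def indicator_def)
    show "(\<lambda>x. g x * f k x) \<in> borel_measurable M" for k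
      using that(1) gm by (intro borel_measurable_times)
    show "integrable M (\<lambda>x. \<bar>g x\<bar>)" using g unfolding M_def by (rule integrable_abs)
    show "AE x in M. (\<lambda>k. g x * f k x) \<longlonglongrightarrow> g x * indicator E x"
      using that(3) by (intro AE_I2 tendsto_mult tendsto_const) (simp add: M_def)
    show "AE x in M. norm (g x * f k x) \<le> \<bar>g x\<bar>" for k
    proof (rule AE_I2)
      fix x
      show "norm (g x * f k x) \<le> \<bar>g x\<bar>"
        using mult_left_mono[OF that(2)[of k x], of "\<bar>g x\<bar>"] by (simp add: abs_mult)
    qed
  qed
  have open_zero: "(LINT x|M. g x * indicator U x) = 0" if U: "open U" "U \<subseteq> \<Omega>" for U
  proof -
    obtain \<phi> where \<phi>: "\<And>k. \<phi> k \<in> test_functions \<Omega>" "\<And>k x. 0 \<le> \<phi> k x" "\<And>k x. \<phi> k x \<le> 1"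
      "\<And>x. (\<lambda>k::nat. \<phi> k x) \<longlonglongrightarrow> indicator U x"
      using indicator_open_approx[OF U] by blast
    have "(\<lambda>k. LINT x|M. g x * \<phi> k x) \<longlonglongrightarrow> (LINT x|M. g x * indicator U x)"
    proof (rule dominated)
      show "\<phi> k \<in> borel_measurable M" for k unfolding M_def by (rule test_function_measurable[OF \<phi>(1)])
      show "\<bar>\<phi> k x\<bar> \<le> 1" for k x using \<phi>(2,3)[of k x] by simp
      show "U \<inter> \<Omega> \<in> sets M"
        using U \<Omega>_sets \<Omega> by (simp add: M_def sets_restrict_space_iff borel_open)
    qed (rule \<phi>(4))
    moreover have "(LINT x|M. g x * \<phi> k x) = 0" for k unfolding M_def by (rule zero[OF \<phi>(1)])
    ultimately show ?thesis by (simp add: LIMSEQ_const_iff)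
  qed
  have set_zero: "(LINT x|M. g x * indicator E x) = 0" if E: "E \<in> sets M" for E
  proof -
    have E': "E \<in> sets lebesgue" "E \<subseteq> \<Omega>"
      using E \<Omega>_sets by (auto simp: M_def sets_restrict_space_iff)
    \<comment> \<open>A measurable set is a G_delta set up to a null set; intersecting with \<Omega>
      below keeps the approximating open sets inside the domain.\<close>
    obtain C Z where CZ: "gdelta C" "Z \<in> null_sets lebesgue" "E \<union> Z = C"
      using lebesgue_set_almost_gdelta[OF E'(1)] by blast
    from CZ(1) obtain W :: "nat \<Rightarrow> 'a set" where W: "\<And>n. open (W n)" "C = (\<Inter>n. W n)"
      by (cases rule: gdelta.cases) auto
    define U where "U n = \<Omega> \<inter> (\<Inter>i\<le>n. W i)" for n
    have U: "open (U n)" "U n \<subseteq> \<Omega>" for n using \<Omega> W(1) by (auto simp: U_def)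
    have "(\<lambda>n. LINT x|M. g x * indicator (U n) x) \<longlonglongrightarrow> (LINT x|M. g x * indicator C x)"
    proof (rule dominated)
      show "(indicator (U n) :: 'a \<Rightarrow> real) \<in> borel_measurable M" for n
        using U \<Omega>_sets by (intro borel_measurable_indicator) (simp add: M_def sets_restrict_space_iff borel_open)
      show "\<bar>indicator (U k) x\<bar> \<le> (1::real)" for k x by (simp add: indicator_def)
      have "C \<in> sets lebesgue" using E'(1) CZ by blast
      then show "C \<inter> \<Omega> \<in> sets M" using \<Omega>_sets by (simp add: M_def sets_restrict_space_iff)
      show "(\<lambda>n. indicator (U n) x) \<longlonglongrightarrow> (indicator C x :: real)" if "x \<in> \<Omega>" for x
      proof (cases "x \<in> C")
        case True
        then have "x \<in> U n" for n using W(2) that by (auto simp: U_def)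
        then show ?thesis using True by simp
      next
        case False
        then obtain j where "x \<notin> W j" using W(2) by blast
        then have "x \<notin> U n" if "n \<ge> j" for n using that by (auto simp: U_def)
        then have "\<forall>\<^sub>F n in sequentially. 0 = (indicator (U n) x :: real)"
          unfolding eventually_sequentially by (intro exI[of _ j]) simp
        then have "(\<lambda>n. indicator (U n) x :: real) \<longlonglongrightarrow> 0"
          by (rule Lim_transform_eventually[OF tendsto_const])
        then show ?thesis using False by simp
      qed
    qed
    then have C0: "(LINT x|M. g x * indicator C x) = 0"
      using open_zero[OF U] by (simp add: LIMSEQ_const_iff)
    have "AE x in lebesgue. x \<notin> Z" using CZ(2) by (rule AE_not_in)
    then have "AE x in M. x \<notin> Z" unfolding M_def using \<Omega>_sets
    by (subst AE_restrict_space_iff) (auto elim: eventually_mono)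
    then have "AE x in M. g x * indicator E x = g x * indicator (C \<inter> \<Omega>) x"
    proof (rule AE_mp[OF _ AE_I2], intro impI)
      fix x assume "x \<in> space M" "x \<notin> Z"
      then show "g x * indicator E x = g x * indicator (C \<inter> \<Omega>) x"
        using CZ(3) E'(2) by (auto simp: indicator_def M_def)
    qed
    moreover have "C \<inter> \<Omega> \<in> sets M"
      using E'(1) CZ \<Omega>_sets by (auto simp: M_def sets_restrict_space_iff)
    ultimately have "(LINT x|M. g x * indicator E x) = (LINT x|M. g x * indicator (C \<inter> \<Omega>) x)"
      using E by (intro integral_cong_AE borel_measurable_times gm borel_measurable_indicator)
    also have "\<dots> = (LINT x|M. g x * indicator C x)"
      by (rule Bochner_Integration.integral_cong) (auto simp: M_def indicator_def)
    finally show ?thesis using C0 by simp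
  qed
  \<comment> \<open>\<open>c\<close> will be 1 or -1 and makes the integrand nonnegative.\<close>
  have ae: "AE x in M. g x * indicator E x = 0"
    if "E \<in> sets M" "\<And>x. 0 \<le> c * (g x * indicator E x)" "c \<noteq> 0" for E and c :: real
  proof -
    have "integrable M (\<lambda>x. c * (g x * indicator E x))"
      using integrable_real_mult_indicator[OF that(1)] g
      by (intro Bochner_Integration.integrable_mult_right) (simp add: M_def mult.commute)
    moreover have "(LINT x|M. c * (g x * indicator E x)) = 0"
      using set_zero[OF that(1)] by simp
    ultimately have "AE x in M. c * (g x * indicator E x) = 0"
      by (subst (asm) integral_nonneg_eq_0_iff_AE[OF _ AE_I2[OF that(2)]])
    then show ?thesis using that(3) by simp
  qed
  have "AE x in M. g x * indicator {x\<in>space M. g x > 0} x = 0"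
    by (rule ae[of _ 1]) (auto simp: indicator_def)
  moreover have "AE x in M. g x * indicator {x\<in>space M. g x < 0} x = 0"
    by (rule ae[of _ "-1"]) (auto simp: indicator_def)
  moreover have "AE x in M. x \<in> space M" by (rule AE_I2) simp
  ultimately have "AE x in M. g x = 0"
  proof eventually_elim
    case (elim x)
    then show ?case by (cases "g x > 0"; cases "g x < 0") auto
  qed
  then show ?thesis unfolding M_def .
qed

section \<open>Integrals of partial derivatives with compact support\<close>

lemma integrable_continuous_compact_support:
  fixes F :: "'a::euclidean_space \<Rightarrow> real"
  assumes "continuous_on UNIV F" "compact K" "\<And>x. x \<notin> K \<Longrightarrow> F x = 0"
  shows "integrable lborel F"
proof -
  have "integrable lborel (\<lambda>x. indicator K x *\<^sub>R F x)"
    using assms by (intro borel_integrable_compact) (auto intro: continuous_on_subset)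
  moreover have "(\<lambda>x. indicator K x *\<^sub>R F x) = F" using assms(3) by (auto simp: indicator_def fun_eq_iff)
  ultimately show ?thesis by simp
qed

lemma bounded_continuous_compact_support:
  fixes F :: "'a::euclidean_space \<Rightarrow> real"
  assumes "continuous_on UNIV F" "compact K" "\<And>x. x \<notin> K \<Longrightarrow> F x = 0"
  obtains B where "B \<ge> 0" "\<And>x. \<bar>F x\<bar> \<le> B"
proof -
  have "bounded (F ` K)"
    using assms by (intro compact_imp_bounded compact_continuous_image) (auto intro: continuous_on_subset)
  then obtain B where B: "\<And>x. x \<in> K \<Longrightarrow> \<bar>F x\<bar> \<le> B" unfolding bounded_iff by auto
  have "\<bar>F x\<bar> \<le> max B 0" for x
    using B[of x] assms(3)[of x] by (cases "x \<in> K") auto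
  then show ?thesis using that[of "max B 0"] by simp
qed

lemma derivative_eq_0_outside_support:
  fixes F :: "'a::euclidean_space \<Rightarrow> real"
  assumes "(F has_derivative F') (at x)" "compact K" "\<And>x. x \<notin> K \<Longrightarrow> F x = 0" "x \<notin> K"
  shows "F' = (\<lambda>h. 0)"
proof -
  have "((\<lambda>x. 0) has_derivative F') (at x)"
    by (rule has_derivative_transform_within_open[OF assms(1), of "- K"])
       (use assms in \<open>auto simp: compact_imp_closed open_Compl\<close>)
  then show ?thesis using has_derivative_unique has_derivative_const by blast
qed

text \<open>Translation invariance makes the integral of every difference quotient vanish, and the
  quotients converge to the derivative under a common majorant. This replaces iterated integration
  along the direction \<open>i\<close>.\<close>

lemma integral_partial_derivative_eq_0:
  fixes F :: "'a::euclidean_space \<Rightarrow> real"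
  assumes F: "\<And>x. (F has_derivative F' x) (at x)" and cont: "continuous_on UNIV (\<lambda>x. F' x i)"
    and K: "compact K" "\<And>x. x \<notin> K \<Longrightarrow> F x = 0"
  shows "(LINT x|lborel. F' x i) = 0"
proof -
  have F_cont: "continuous_on UNIV F"
    by (intro continuous_at_imp_continuous_on ballI has_derivative_continuous[OF F])
  have F'_0: "F' x i = 0" if "x \<notin> K" for x
    using derivative_eq_0_outside_support[OF F K(1) K(2) that] by simp
  obtain B where B: "B \<ge> 0" "\<And>x. \<bar>F' x i\<bar> \<le> B"
    using bounded_continuous_compact_support[OF cont K(1) F'_0] by blast
  obtain R where R: "\<And>x. x \<in> K \<Longrightarrow> norm x \<le> R"
    using compact_imp_bounded[OF K(1)] unfolding bounded_iff by auto
  have line: "((\<lambda>s. F (x + s *\<^sub>R i)) has_real_derivative F' (x + s *\<^sub>R i) i) (at s)" for x s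
  proof -
    have "((\<lambda>s. x + s *\<^sub>R i) has_derivative (\<lambda>h. h *\<^sub>R i)) (at s)"
      by (auto intro!: derivative_eq_intros)
    from has_derivative_compose[OF this F]
    have "((\<lambda>s. F (x + s *\<^sub>R i)) has_derivative (\<lambda>h. F' (x + s *\<^sub>R i) (h *\<^sub>R i))) (at s)" .
    moreover have "F' (x + s *\<^sub>R i) (h *\<^sub>R i) = F' (x + s *\<^sub>R i) i * h" for h
      using linear_scale[OF has_derivative_linear[OF F]] by simp
    ultimately show ?thesis by (simp add: has_field_derivative_def)
  qed
  define q where "q k x = (F ((1 / Suc k) *\<^sub>R i + x) - F x) / (1 / Suc k)" for k x
  \<comment> \<open>The steps are at most 1, so all quotients vanish outside one ball; inside it the
    mean value theorem bounds them by \<open>B\<close>.\<close>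
  define w where "w x = B * indicator (cball 0 (R + norm i)) x" for x :: 'a
  have F_int: "integrable lborel F" by (rule integrable_continuous_compact_support[OF F_cont K])
  have shift: "integrable lborel (\<lambda>x. F (c + x))" "(LINT x|lborel. F (c + x)) = (LINT x|lborel. F x)" for c
  proof -
    have "integrable (distr lborel borel ((+) c)) F" using F_int by (simp add: lborel_distr_plus)
    then show "integrable lborel (\<lambda>x. F (c + x))" by (rule integrable_distr[rotated]) simp
    have "(LINT x|lborel. F x) = (LINT x|distr lborel borel ((+) c). F x)" by (simp add: lborel_distr_plus)
    also have "\<dots> = (LINT x|lborel. F (c + x))"
      using borel_measurable_continuous_onI[OF F_cont] by (intro integral_distr) auto
    finally show "(LINT x|lborel. F (c + x)) = (LINT x|lborel. F x)" ..
  qed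
  have "(\<lambda>k. LINT x|lborel. q k x) \<longlonglongrightarrow> (LINT x|lborel. F' x i)"
  proof (rule integral_dominated_convergence[where w = w])
    show "(\<lambda>x. F' x i) \<in> borel_measurable lborel"
      using borel_measurable_continuous_onI[OF cont] by simp
    show "q k \<in> borel_measurable lborel" for k
    proof -
      have "continuous_on UNIV (q k)"
        unfolding q_def by (intro continuous_intros continuous_on_compose2[OF F_cont]) auto
      then show ?thesis using borel_measurable_continuous_onI by simp
    qed
    show "integrable lborel w"
      unfolding w_def using emeasure_bounded_finite[OF bounded_cball]
      by (intro integrable_mult_right integrable_real_indicator) auto
    show "AE x in lborel. (\<lambda>k. q k x) \<longlonglongrightarrow> F' x i"
    proof (rule AE_I2)
      fix x
      have "((\<lambda>h. (F (x + (0 + h) *\<^sub>R i) - F (x + 0 *\<^sub>R i)) / h) \<longlongrightarrow> F' (x + 0 *\<^sub>R i) i) (at 0)"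
        using line[of x 0] by (simp add: DERIV_def)
      moreover have "filterlim (\<lambda>k. 1 / real (Suc k)) (at 0) sequentially"
        unfolding filterlim_at using LIMSEQ_Suc[OF lim_1_over_n] by simp
      ultimately have "(\<lambda>k. (F (x + (0 + 1 / real (Suc k)) *\<^sub>R i) - F (x + 0 *\<^sub>R i)) / (1 / real (Suc k)))
          \<longlonglongrightarrow> F' (x + 0 *\<^sub>R i) i"
        by (rule filterlim_compose)
      then show "(\<lambda>k. q k x) \<longlonglongrightarrow> F' x i"
        unfolding q_def by (simp add: add.commute)
    qed
    show "AE x in lborel. norm (q k x) \<le> w x" for k
    proof (rule AE_I2)
      fix x
      define h where "h = 1 / real (Suc k)"
      have h: "0 < h" "h \<le> 1" by (auto simp: h_def)
      obtain s where s: "F (x + h *\<^sub>R i) - F (x + 0 *\<^sub>R i) = (h - 0) * F' (x + s *\<^sub>R i) i"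
        using MVT2[OF h(1), of "\<lambda>s. F (x + s *\<^sub>R i)" "\<lambda>s. F' (x + s *\<^sub>R i) i"] line by blast
      have q_eq: "q k x = F' (x + s *\<^sub>R i) i"
        unfolding q_def h_def[symmetric] using s h by (simp add: add.commute)
      show "norm (q k x) \<le> w x"
      proof (cases "norm x \<le> R + norm i")
        case True
        then show ?thesis using B(2)[of "x + s *\<^sub>R i"] by (simp add: q_eq w_def)
      next
        case False
        have "x \<notin> K" using False R[of x] norm_ge_zero[of i] by linarith
        moreover have "x + h *\<^sub>R i \<notin> K"
        proof
          assume "x + h *\<^sub>R i \<in> K"
          then have "norm (x + h *\<^sub>R i) \<le> R" by (rule R)
          moreover have "norm x \<le> norm (x + h *\<^sub>R i) + norm (h *\<^sub>R i)"
            by (metis add_diff_cancel_right' norm_triangle_ineq4)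
          moreover have "norm (h *\<^sub>R i) \<le> norm i"
            using h mult_right_mono[of h 1 "norm i"] by simp
          ultimately show False using False by linarith
        qed
        ultimately have "q k x = 0"
          unfolding q_def h_def[symmetric] using K(2) by (simp add: add.commute)
        then show ?thesis using B(1) by (simp add: w_def)
      qed
    qed
  qed
  moreover have "(LINT x|lborel. q k x) = 0" for k
    unfolding q_def using shift[of "(1 / Suc k) *\<^sub>R i"] F_int by simp
  ultimately show ?thesis by (simp add: LIMSEQ_const_iff)
qed

section \<open>Linear structure and derivatives of test functions\<close>

lemma C_k_add: "C_k k f \<Longrightarrow> C_k k g \<Longrightarrow> C_k k (f + g)"
proof (induction k arbitrary: f g)
  case 0
  then show ?case by (simp add: plus_fun_def continuous_on_add)
next
  case (Suc k)
  have d: "((f + g) has_derivative (\<lambda>h. frechet_derivative f (at x) h + frechet_derivative g (at x) h)) (at x)" for x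
    unfolding plus_fun_def using Suc.prems
    by (intro has_derivative_add frechet_derivative_works[THEN iffD1]) auto
  have "(\<lambda>x. frechet_derivative (f + g) (at x) i)
      = (\<lambda>x. frechet_derivative f (at x) i) + (\<lambda>x. frechet_derivative g (at x) i)" for i
    unfolding frechet_derivative_at[OF d, symmetric] by (auto simp: fun_eq_iff)
  then have "C_k k (\<lambda>x. frechet_derivative (f + g) (at x) i)" if "i \<in> Basis" for i
    using Suc.IH Suc.prems that by (simp only: C_k.simps(2))
  moreover have "(f + g) differentiable at x" for x using d differentiable_def by blast
  ultimately show ?case unfolding C_k.simps(2) by blast
qed

lemma C_k_scaleR: "C_k k f \<Longrightarrow> C_k k (c *\<^sub>R f)"
proof (induction k arbitrary: f)
  case 0
  then show ?case by (simp add: scaleR_fun_def continuous_on_mult_left)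
next
  case (Suc k)
  have d: "((c *\<^sub>R f) has_derivative (\<lambda>h. c *\<^sub>R frechet_derivative f (at x) h)) (at x)" for x
    unfolding scaleR_fun_def using Suc.prems
    by (intro has_derivative_scaleR_right frechet_derivative_works[THEN iffD1]) auto
  have "(\<lambda>x. frechet_derivative (c *\<^sub>R f) (at x) i) = c *\<^sub>R (\<lambda>x. frechet_derivative f (at x) i)" for i
    unfolding frechet_derivative_at[OF d, symmetric] by (auto simp: fun_eq_iff)
  then have "C_k k (\<lambda>x. frechet_derivative (c *\<^sub>R f) (at x) i)" if "i \<in> Basis" for i
    using Suc.IH Suc.prems that by (simp only: C_k.simps(2))
  moreover have "(c *\<^sub>R f) differentiable at x" for x using d differentiable_def by blast
  ultimately show ?case unfolding C_k.simps(2) by blast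
qed

lemma test_functions_0: "0 \<in> test_functions \<Omega>"
  unfolding zero_fun_def by (rule test_functionsI[OF smooth_functions.const, of "{}"]) auto

lemma subspace_test_functions: "subspace (test_functions \<Omega>)"
proof (rule subspaceI)
  show "0 \<in> test_functions \<Omega>" by (rule test_functions_0)
next
  fix f g :: "'a \<Rightarrow> real" assume "f \<in> test_functions \<Omega>" "g \<in> test_functions \<Omega>"
  then obtain K L where "\<forall>k. C_k k f" "compact K" "K \<subseteq> \<Omega>" "\<forall>x. x \<notin> K \<longrightarrow> f x = 0"
    "\<forall>k. C_k k g" "compact L" "L \<subseteq> \<Omega>" "\<forall>x. x \<notin> L \<longrightarrow> g x = 0"
    unfolding test_functions_def by blast
  then have "(\<forall>k. C_k k (f + g)) \<and> compact (K \<union> L) \<and> K \<union> L \<subseteq> \<Omega> \<and> (\<forall>x. x \<notin> K \<union> L \<longrightarrow> (f + g) x = 0)"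
    by (auto intro: C_k_add)
  then show "f + g \<in> test_functions \<Omega>" unfolding test_functions_def by blast
next
  fix c :: real and f :: "'a \<Rightarrow> real" assume "f \<in> test_functions \<Omega>"
  then obtain K where "\<forall>k. C_k k f" "compact K" "K \<subseteq> \<Omega>" "\<forall>x. x \<notin> K \<longrightarrow> f x = 0"
    unfolding test_functions_def by blast
  then have "(\<forall>k. C_k k (c *\<^sub>R f)) \<and> compact K \<and> K \<subseteq> \<Omega> \<and> (\<forall>x. x \<notin> K \<longrightarrow> (c *\<^sub>R f) x = 0)"
    by (auto intro: C_k_scaleR)
  then show "c *\<^sub>R f \<in> test_functions \<Omega>" unfolding test_functions_def by blast
qed

lemma test_function_has_derivative:
  assumes "\<phi> \<in> test_functions \<Omega>"
  shows "(\<phi> has_derivative frechet_derivative \<phi> (at x)) (at x)"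
proof -
  have "C_k (Suc 0) \<phi>" using assms unfolding test_functions_def by blast
  then show ?thesis by (simp add: frechet_derivative_works)
qed

lemma test_function_pderiv:
  assumes "\<phi> \<in> test_functions \<Omega>" and i: "i \<in> Basis"
  shows "(\<lambda>x. frechet_derivative \<phi> (at x) i) \<in> test_functions \<Omega>"
proof -
  obtain K where K: "\<forall>k. C_k k \<phi>" "compact K" "K \<subseteq> \<Omega>" "\<forall>x. x \<notin> K \<longrightarrow> \<phi> x = 0"
    using assms(1) unfolding test_functions_def by blast
  have "C_k k (\<lambda>x. frechet_derivative \<phi> (at x) i)" for k
    using K(1)[rule_format, of "Suc k"] i by simp
  moreover have "frechet_derivative \<phi> (at x) i = 0" if "x \<notin> K" for x
    using derivative_eq_0_outside_support[OF test_function_has_derivative[OF assms(1)] K(2) _ that] K(4)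
    by simp
  ultimately show ?thesis using K unfolding test_functions_def by blast
qed

lemma test_function_support:
  assumes "\<phi> \<in> test_functions \<Omega>"
  obtains K where "compact K" "K \<subseteq> \<Omega>" "\<And>x. x \<notin> K \<Longrightarrow> \<phi> x = 0"
  using assms unfolding test_functions_def by blast

lemma test_function_bounded:
  assumes "\<phi> \<in> test_functions \<Omega>"
  obtains B where "B \<ge> 0" "\<And>x. \<bar>\<phi> x\<bar> \<le> B"
proof -
  obtain K where "compact K" "K \<subseteq> \<Omega>" "\<And>x. x \<notin> K \<Longrightarrow> \<phi> x = 0"
    by (rule test_function_support[OF assms]) blast
  then show ?thesis
    using bounded_continuous_compact_support[OF test_function_continuous[OF assms]] that by metis
qed

lemma integral_lebesgue_on_eq_lborel:
  fixes F :: "'a::euclidean_space \<Rightarrow> real"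
  assumes "\<Omega> \<in> sets lebesgue" "F \<in> borel_measurable borel" "\<And>x. x \<notin> \<Omega> \<Longrightarrow> F x = 0"
  shows "(LINT x|lebesgue_on \<Omega>. F x) = (LINT x|lborel. F x)"
proof -
  have "(LINT x|lebesgue_on \<Omega>. F x) = (LINT x|lebesgue. indicator \<Omega> x *\<^sub>R F x)"
    using assms(1) by (intro integral_restrict_space) simp
  also have "\<dots> = (LINT x|lebesgue. F x)"
    using assms(3) by (intro Bochner_Integration.integral_cong) (auto simp: indicator_def)
  also have "\<dots> = (LINT x|lborel. F x)" using assms(2) by (intro integral_completion) simp
  finally show ?thesis .
qed

lemma test_function_L2:
  assumes \<Omega>: "\<Omega> \<in> sets lebesgue" and \<phi>: "\<phi> \<in> test_functions \<Omega>"
  shows "\<phi> \<in> L2 \<Omega>"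
proof -
  obtain K where K: "compact K" "K \<subseteq> \<Omega>" "\<And>x. x \<notin> K \<Longrightarrow> \<phi> x = 0"
    by (rule test_function_support[OF \<phi>]) blast
  have c: "continuous_on UNIV (\<lambda>x. (\<phi> x)\<^sup>2)"
    by (intro continuous_on_power test_function_continuous[OF \<phi>])
  then have "integrable lborel (\<lambda>x. (\<phi> x)\<^sup>2)"
    using K by (intro integrable_continuous_compact_support) auto
  then have "integrable lebesgue (\<lambda>x. (\<phi> x)\<^sup>2)"
    using borel_measurable_continuous_onI[OF c] by (simp add: integrable_completion)
  then have "integrable lebesgue (\<lambda>x. indicator \<Omega> x *\<^sub>R (\<phi> x)\<^sup>2)"
    by (rule integrable_mult_indicator[OF \<Omega>])
  then have "integrable (lebesgue_on \<Omega>) (\<lambda>x. (\<phi> x)\<^sup>2)"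
    using \<Omega> by (subst integrable_restrict_space) simp_all
  then show ?thesis using test_function_measurable[OF \<phi>] by (simp add: L2_def)
qed

lemma test_function_integration_by_parts:
  assumes \<Omega>: "\<Omega> \<in> sets lebesgue" and \<phi>: "\<phi> \<in> test_functions \<Omega>" and \<psi>: "\<psi> \<in> test_functions \<Omega>" and i: "i \<in> Basis"
  shows "L2_inner \<Omega> \<phi> (\<lambda>x. frechet_derivative \<psi> (at x) i) = - L2_inner \<Omega> (\<lambda>x. frechet_derivative \<phi> (at x) i) \<psi>"
proof -
  let ?D\<phi> = "\<lambda>x. frechet_derivative \<phi> (at x) i" and ?D\<psi> = "\<lambda>x. frechet_derivative \<psi> (at x) i"
  obtain K where K: "compact K" "K \<subseteq> \<Omega>" "\<And>x. x \<notin> K \<Longrightarrow> \<phi> x = 0"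
    by (rule test_function_support[OF \<phi>]) blast
  note D\<phi> = test_function_pderiv[OF \<phi> i] and D\<psi> = test_function_pderiv[OF \<psi> i]
  note conts = test_function_continuous[OF \<phi>] test_function_continuous[OF \<psi>]
    test_function_continuous[OF D\<phi>] test_function_continuous[OF D\<psi>]
  have c: "continuous_on UNIV (\<lambda>x. \<phi> x * ?D\<psi> x + ?D\<phi> x * \<psi> x)"
    by (intro continuous_on_add continuous_on_mult conts)
  have "(LINT x|lborel. \<phi> x * ?D\<psi> x + ?D\<phi> x * \<psi> x) = 0"
    by (rule integral_partial_derivative_eq_0[where F = "\<lambda>x. \<phi> x * \<psi> x" and
        F' = "\<lambda>x h. \<phi> x * frechet_derivative \<psi> (at x) h + frechet_derivative \<phi> (at x) h * \<psi> x" and K = K])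
       (use K c in \<open>auto intro!: has_derivative_mult test_function_has_derivative[OF \<phi>] test_function_has_derivative[OF \<psi>]\<close>)
  moreover have "\<phi> x * ?D\<psi> x + ?D\<phi> x * \<psi> x = 0" if "x \<notin> \<Omega>" for x
  proof -
    obtain L where L: "compact L" "L \<subseteq> \<Omega>" "\<And>x. x \<notin> L \<Longrightarrow> \<psi> x = 0"
      by (rule test_function_support[OF \<psi>]) blast
    have "\<phi> x = 0" "\<psi> x = 0" using K(2,3) L(2,3) that by blast+
    then show ?thesis by simp
  qed
  ultimately have "(LINT x|lebesgue_on \<Omega>. \<phi> x * ?D\<psi> x + ?D\<phi> x * \<psi> x) = 0"
    using borel_measurable_continuous_onI[OF c] \<Omega> by (subst integral_lebesgue_on_eq_lborel) auto
  moreover have "integrable (lebesgue_on \<Omega>) (\<lambda>x. \<phi> x * ?D\<psi> x)" "integrable (lebesgue_on \<Omega>) (\<lambda>x. ?D\<phi> x * \<psi> x)"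
    by (intro L2_mult_integrable test_function_L2 \<Omega> \<phi> \<psi> D\<phi> D\<psi>)+
  ultimately show ?thesis by (simp add: L2_inner_def)
qed

section \<open>Weak derivatives on an interval\<close>

lemma test_function_has_real_derivative:
  assumes "\<phi> \<in> test_functions (\<Omega> :: real set)"
  shows "(\<phi> has_real_derivative deriv \<phi> t) (at t)"
  using test_function_has_derivative[OF assms, of t]
  by (metis DERIV_deriv_iff_real_differentiable differentiable_def)

lemma test_function_deriv:
  assumes "\<phi> \<in> test_functions (\<Omega> :: real set)"
  shows "deriv \<phi> \<in> test_functions \<Omega>"
proof -
  have "frechet_derivative \<phi> (at t) 1 = deriv \<phi> t" for t
    using test_function_has_real_derivative[OF assms, of t]
    by (simp add: has_field_derivative_def frechet_derivative_at[symmetric])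
  then show ?thesis using test_function_pderiv[OF assms, of 1] by simp
qed

lemma C_k_antiderivative:
  fixes \<phi> :: "real \<Rightarrow> real"
  assumes "\<And>t. (\<phi> has_real_derivative \<psi> t) (at t)" "\<And>k. C_k k \<psi>"
  shows "C_k k \<phi>"
proof (cases k)
  case 0
  have "continuous_on UNIV \<phi>"
    by (intro continuous_at_imp_continuous_on ballI DERIV_isCont[OF assms(1)])
  then show ?thesis using 0 by simp
next
  case (Suc j)
  have "frechet_derivative \<phi> (at t) = (*) (\<psi> t)" for t
    using frechet_derivative_at[OF assms(1)[of t, unfolded has_field_derivative_def]] by simp
  then show ?thesis
    using Suc assms by (auto simp: differentiable_def has_field_derivative_def)
qed

text \<open>To the left of the support a primitive from 0 vanishes by construction; integral zero is
  what makes it vanish to the right as well.\<close>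

lemma test_function_antiderivative:
  fixes \<psi> :: "real \<Rightarrow> real"
  assumes \<psi>: "\<psi> \<in> test_functions {0<..<T}" and mean: "(LINT t|lebesgue_on {0<..<T}. \<psi> t) = 0"
  obtains \<phi> where "\<phi> \<in> test_functions {0<..<T}" "deriv \<phi> = \<psi>"
proof (cases "\<forall>t. \<psi> t = 0")
  case True
  then have "deriv (\<lambda>t::real. 0::real) = \<psi>" by (auto simp: fun_eq_iff)
  then show ?thesis using that[of "\<lambda>t. 0"] test_functions_0[of "{0<..<T}"] unfolding zero_fun_def by blast
next
  case False
  obtain K where K: "compact K" "K \<subseteq> {0<..<T}" "\<And>t. t \<notin> K \<Longrightarrow> \<psi> t = 0"
    by (rule test_function_support[OF \<psi>]) blast
  have "K \<noteq> {}" using False K(3) by blast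
  then obtain \<alpha> \<beta> where ab: "\<alpha> \<in> K" "\<beta> \<in> K" "\<And>t. t \<in> K \<Longrightarrow> \<alpha> \<le> t \<and> t \<le> \<beta>"
    using compact_attains_inf[OF K(1)] compact_attains_sup[OF K(1)] by metis
  have ab': "0 < \<alpha>" "\<alpha> \<le> \<beta>" "\<beta> < T" using ab K(2) by auto
  have \<psi>_0: "\<psi> t = 0" if "t < \<alpha> \<or> t > \<beta>" for t using K(3)[of t] ab(3)[of t] that by fastforce
  have cont: "continuous_on S \<psi>" for S using test_function_continuous[OF \<psi>] continuous_on_subset by blast
  define \<phi> where "\<phi> t = integral {0..t} \<psi>" for t
  have low: "\<phi> t = 0" if "t < \<alpha>" for t
  proof -
    have "integral {0..t} \<psi> = integral {0..t} (\<lambda>t. 0)"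
      using that by (intro Henstock_Kurzweil_Integration.integral_cong \<psi>_0) auto
    then show ?thesis by (simp add: \<phi>_def)
  qed
  have high: "\<phi> t = 0" if "t > \<beta>" for t
  proof -
    \<comment> \<open>Past the support the primitive keeps its value at T, also for t > T, since
      \<psi> is zero in between.\<close>
    have sp: "integral {0..t} \<psi> = integral {0..T} \<psi>"
    proof (rule integral_spike_set)
      have nz: "x \<le> \<beta>" if "\<psi> x \<noteq> 0" for x using \<psi>_0[of x] that by (cases "x \<le> \<beta>") auto
      have "{x \<in> {0..t} - {0..T}. \<psi> x \<noteq> 0} = {}" "{x \<in> {0..T} - {0..t}. \<psi> x \<noteq> 0} = {}"
        using that ab' by (auto dest!: nz)
      then show "negligible {x \<in> {0..t} - {0..T}. \<psi> x \<noteq> 0}" "negligible {x \<in> {0..T} - {0..t}. \<psi> x \<noteq> 0}"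
        by (simp_all only: negligible_empty)
    qed
    have "\<psi> absolutely_integrable_on {0..T}" using absolutely_integrable_continuous_real[OF cont] .
    then have "\<psi> absolutely_integrable_on {0<..<T}" by (rule set_integrable_subset) auto
    then have "integrable (lebesgue_on {0<..<T}) \<psi>"
      by (simp add: integrable_restrict_space set_integrable_def)
    then have "integral {0<..<T} \<psi> = 0"
      using mean lebesgue_integral_eq_integral by fastforce
    then show ?thesis using sp by (simp add: \<phi>_def integral_open_interval_real)
  qed
  have der: "(\<phi> has_real_derivative \<psi> t) (at t)" for t
  proof (cases "t < \<alpha>")
    case True
    have "\<forall>\<^sub>F s in nhds t. 0 = \<phi> s"
      by (rule eventually_mono[OF eventually_nhds_in_open[of "{..<\<alpha>}" t]]) (use True low in auto)
    then have "(\<phi> has_real_derivative 0) (at t)"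
      by (rule DERIV_cong_ev[OF refl _ refl, THEN iffD1]) simp
    then show ?thesis using \<psi>_0 True by simp
  next
    case False
    \<comment> \<open>Here t \<ge> \<alpha> > 0, so t is interior to {0..t+1} and the derivative
      within that interval is the full derivative.\<close>
    have "(\<phi> has_vector_derivative \<psi> t) (at t within {0..t+1})"
      unfolding \<phi>_def using False ab' by (intro integral_has_vector_derivative cont) auto
    then show ?thesis
      using False ab' by (simp add: has_real_derivative_iff_has_vector_derivative at_within_Icc_at)
  qed
  have "C_k k \<phi>" for k
    by (rule C_k_antiderivative[OF der]) (use \<psi> in \<open>auto simp: test_functions_def\<close>)
  moreover have "{\<alpha>..\<beta>} \<subseteq> {0<..<T}" using ab' by auto
  moreover have "\<phi> t = 0" if "t \<notin> {\<alpha>..\<beta>}" for t using low high that by fastforce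
  ultimately have "\<phi> \<in> test_functions {0<..<T}" unfolding test_functions_def by (auto intro!: exI[of _ "{\<alpha>..\<beta>}"])
  moreover have "deriv \<phi> = \<psi>" using der by (auto simp: fun_eq_iff DERIV_imp_deriv)
  ultimately show ?thesis by (rule that)
qed

lemma integrable_test_function_mult:
  assumes "integrable (lebesgue_on S) n" "\<phi> \<in> test_functions \<Omega>"
  shows "integrable (lebesgue_on S) (\<lambda>t. n t * \<phi> t)"
proof -
  obtain B where B: "B \<ge> 0" "\<And>x. \<bar>\<phi> x\<bar> \<le> B" by (rule test_function_bounded[OF assms(2)]) blast
  show ?thesis
  proof (rule Bochner_Integration.integrable_bound)
    show "integrable (lebesgue_on S) (\<lambda>t. B * n t)" using assms(1) by simp
    show "(\<lambda>t. n t * \<phi> t) \<in> borel_measurable (lebesgue_on S)"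
      by (intro borel_measurable_times test_function_measurable[OF assms(2)] borel_measurable_integrable[OF assms(1)])
    show "AE t in lebesgue_on S. norm (n t * \<phi> t) \<le> norm (B * n t)"
    proof (rule AE_I2)
      fix t
      show "norm (n t * \<phi> t) \<le> norm (B * n t)"
        using mult_right_mono[OF B(2)[of t], of "\<bar>n t\<bar>"] B(1) by (simp add: abs_mult mult.commute)
    qed
  qed
qed

lemma finite_measure_Ioo: "finite_measure (lebesgue_on {a<..<b::real})"
  by (rule finite_measure_lebesgue_on) simp

lemma integrable_const_Ioo: "integrable (lebesgue_on {a<..<b::real}) (\<lambda>t. c::real)"
  by (rule finite_measure.integrable_const[OF finite_measure_Ioo])

text \<open>Up to a multiple of one fixed \<open>\<psi>0\<close> with nonzero integral, every test
  function is the derivative of a test function. Orthogonality to derivatives therefore leaves only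
  a constant.\<close>

lemma du_Bois_Reymond:
  fixes n :: "real \<Rightarrow> real"
  assumes T: "T > 0" and n: "integrable (lebesgue_on {0<..<T}) n"
    and zero: "\<And>\<phi>. \<phi> \<in> test_functions {0<..<T} \<Longrightarrow> (LINT t|lebesgue_on {0<..<T}. n t * deriv \<phi> t) = 0"
  shows "\<exists>c. AE t in lebesgue_on {0<..<T}. n t = c"
proof -
  let ?M = "lebesgue_on {0<..<T}"
  have one: "integrable ?M (\<lambda>t. 1::real)" by (rule integrable_const_Ioo)
  have int: "integrable ?M \<psi>" if "\<psi> \<in> test_functions {0<..<T}" for \<psi>
    using integrable_test_function_mult[OF one that] by simp
  \<comment> \<open>Otherwise the fundamental lemma would make the constant 1 vanish almost
    everywhere.\<close>
  have "\<exists>\<psi>\<in>test_functions {0<..<T}. (LINT t|?M. \<psi> t) \<noteq> 0"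
  proof (rule ccontr)
    assume "\<not> ?thesis"
    then have "(LINT t|?M. 1 * \<psi> t) = 0" if "\<psi> \<in> test_functions {0<..<T}" for \<psi> using that by simp
    then have "AE t in ?M. (1::real) = 0" by (rule fundamental_lemma[OF open_greaterThanLessThan one])
    then have "(LINT t|?M. 1::real) = (LINT t|?M. 0)" by (intro integral_cong_AE) auto
    then show False using T by (simp add: measure_restrict_space)
  qed
  then obtain \<psi>0 where \<psi>0: "\<psi>0 \<in> test_functions {0<..<T}" "(LINT t|?M. \<psi>0 t) \<noteq> 0" by blast
  \<comment> \<open>The only candidate, since n - c has to integrate to 0 against
    \<open>\<psi>0\<close>.\<close>
  define c where "c = (LINT t|?M. n t * \<psi>0 t) / (LINT t|?M. \<psi>0 t)"
  have "AE t in ?M. n t - c = 0"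
  proof (rule fundamental_lemma)
    show "integrable ?M (\<lambda>t. n t - c)" using n integrable_const_Ioo by (intro Bochner_Integration.integrable_diff)
    fix \<psi> :: "real \<Rightarrow> real" assume \<psi>: "\<psi> \<in> test_functions {0<..<T}"
    define r where "r = (LINT t|?M. \<psi> t) / (LINT t|?M. \<psi>0 t)"
    define \<psi>1 where "\<psi>1 = \<psi> - r *\<^sub>R \<psi>0"
    have \<psi>1: "\<psi>1 \<in> test_functions {0<..<T}"
      unfolding \<psi>1_def by (intro subspace_diff subspace_scale subspace_test_functions \<psi> \<psi>0)
    have "(LINT t|?M. \<psi>1 t) = (LINT t|?M. \<psi> t) - r * (LINT t|?M. \<psi>0 t)"
      unfolding \<psi>1_def using int[OF \<psi>] int[OF \<psi>0(1)] by simp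
    also have "\<dots> = 0" using \<psi>0(2) by (simp add: r_def)
    finally obtain \<phi> where \<phi>: "\<phi> \<in> test_functions {0<..<T}" "deriv \<phi> = \<psi>1"
      by (rule test_function_antiderivative[OF \<psi>1])
    have i1: "integrable ?M (\<lambda>t. n t * \<psi> t)" "integrable ?M (\<lambda>t. n t * \<psi>0 t)"
      by (rule integrable_test_function_mult[OF n \<psi>] integrable_test_function_mult[OF n \<psi>0(1)])+
    have "0 = (LINT t|?M. n t * \<psi>1 t)" using zero[OF \<phi>(1)] \<phi>(2) by simp
    also have "\<dots> = (LINT t|?M. n t * \<psi> t - r * (n t * \<psi>0 t))"
      unfolding \<psi>1_def by (intro Bochner_Integration.integral_cong) (auto simp: algebra_simps)
    also have "\<dots> = (LINT t|?M. n t * \<psi> t) - r * (LINT t|?M. n t * \<psi>0 t)"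
      using i1 by simp
    also have "r * (LINT t|?M. n t * \<psi>0 t) = c * (LINT t|?M. \<psi> t)" by (simp add: r_def c_def)
    finally have "(LINT t|?M. n t * \<psi> t) - c * (LINT t|?M. \<psi> t) = 0" ..
    moreover have "(LINT t|?M. (n t - c) * \<psi> t) = (LINT t|?M. n t * \<psi> t - c * \<psi> t)"
      by (simp add: left_diff_distrib)
    ultimately show "(LINT t|?M. (n t - c) * \<psi> t) = 0" using i1 int[OF \<psi>] by simp
  qed simp
  then show ?thesis by (intro exI[of _ c]) (auto elim: eventually_mono)
qed

text \<open>Fubini on the triangle s < t: the integral of \<open>deriv \<phi>\<close> from s to T is
  - \<phi> s, because \<phi> vanishes at T. The argument asks for integrability of \<open>k\<close>
  alone and bypasses pointwise differentiation of its primitive.\<close>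

lemma indefinite_integral_by_parts:
  fixes k :: "real \<Rightarrow> real"
  assumes k: "integrable (lebesgue_on {0<..<T}) k" and \<phi>: "\<phi> \<in> test_functions {0<..<T}"
  shows "integrable (lebesgue_on {0<..<T}) (\<lambda>t. LINT s|lebesgue_on {0<..<T}. indicator {..<t} s * k s)"
    and "(LINT t|lebesgue_on {0<..<T}. (LINT s|lebesgue_on {0<..<T}. indicator {..<t} s * k s) * deriv \<phi> t)
      = - (LINT t|lebesgue_on {0<..<T}. k t * \<phi> t)"
proof -
  define M where "M = lebesgue_on {0<..<T}"
  interpret finite_measure M unfolding M_def by (rule finite_measure_Ioo)
  interpret P: pair_sigma_finite M M ..
  have [measurable]: "k \<in> borel_measurable M" using k unfolding M_def by (rule borel_measurable_integrable)
  have [measurable]: "(\<lambda>t. t) \<in> borel_measurable M"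
    unfolding M_def by (rule borel_measurable_lebesgue_on_continuous) simp
  have [measurable]: "deriv \<phi> \<in> borel_measurable M"
    unfolding M_def by (rule test_function_measurable[OF test_function_deriv[OF \<phi>]])
  obtain B where B: "B \<ge> 0" "\<And>t. \<bar>deriv \<phi> t\<bar> \<le> B"
    by (rule test_function_bounded[OF test_function_deriv[OF \<phi>]]) blast
  have k_pair: "integrable (M \<Otimes>\<^sub>M M) (\<lambda>(s, t). k s)"
  proof (rule P.Fubini_integrable)
    show "(\<lambda>(s, t). k s) \<in> borel_measurable (M \<Otimes>\<^sub>M M)" by measurable
    show "integrable M (\<lambda>s. LINT t|M. norm (case (s, t) of (s, t) \<Rightarrow> k s))"
      using k by (simp add: M_def)
    show "AE s in M. integrable M (\<lambda>t. case (s, t) of (s, t) \<Rightarrow> k s)" by simp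
  qed
  have i1: "integrable (M \<Otimes>\<^sub>M M) (\<lambda>(s, t). indicator {..<t} s * k s)"
  proof (rule Bochner_Integration.integrable_bound[OF k_pair])
    \<comment> \<open>The conditional form of the indicator exposes s < t as a measurable condition
      on the product space.\<close>
    have "(\<lambda>(s, t). (if s < t then 1 else 0) * k s) \<in> borel_measurable (M \<Otimes>\<^sub>M M)" by measurable
    moreover have "(\<lambda>(s, t). indicator {..<t} s * k s) = (\<lambda>(s, t). (if s < t then 1 else 0) * k s)"
      by (auto simp: indicator_def fun_eq_iff)
    ultimately show "(\<lambda>(s, t). indicator {..<t} s * k s) \<in> borel_measurable (M \<Otimes>\<^sub>M M)" by simp
  qed (auto simp: indicator_def intro!: AE_I2)
  then have "integrable M (\<lambda>t. LINT s|M. indicator {..<t} s * k s)" by (rule P.integrable_snd)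
  then show "integrable (lebesgue_on {0<..<T}) (\<lambda>t. LINT s|lebesgue_on {0<..<T}. indicator {..<t} s * k s)"
    by (simp add: M_def)
  have i2: "integrable (M \<Otimes>\<^sub>M M) (\<lambda>(s, t). indicator {..<t} s * k s * deriv \<phi> t)"
  proof (rule Bochner_Integration.integrable_bound)
    show "integrable (M \<Otimes>\<^sub>M M) (\<lambda>p. B * (case p of (s, t) \<Rightarrow> k s))"
      using k_pair by (rule integrable_mult_right)
    have "(\<lambda>(s, t). (if s < t then 1 else 0) * k s * deriv \<phi> t) \<in> borel_measurable (M \<Otimes>\<^sub>M M)" by measurable
    moreover have "(\<lambda>(s, t). indicator {..<t} s * k s * deriv \<phi> t) = (\<lambda>(s, t). (if s < t then 1 else 0) * k s * deriv \<phi> t)"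
      by (auto simp: indicator_def fun_eq_iff)
    ultimately show "(\<lambda>(s, t). indicator {..<t} s * k s * deriv \<phi> t) \<in> borel_measurable (M \<Otimes>\<^sub>M M)" by simp
    show "AE p in M \<Otimes>\<^sub>M M. norm (case p of (s, t) \<Rightarrow> indicator {..<t} s * k s * deriv \<phi> t) \<le> norm (B * (case p of (s, t) \<Rightarrow> k s))"
    proof (rule AE_I2)
      fix p :: "real \<times> real"
      obtain s t where p: "p = (s, t)" by (cases p)
      show "norm (case p of (s, t) \<Rightarrow> indicator {..<t} s * k s * deriv \<phi> t) \<le> norm (B * (case p of (s, t) \<Rightarrow> k s))"
        using mult_left_mono[OF B(2)[of t], of "\<bar>k s\<bar>"] B(1) by (simp add: p indicator_def abs_mult mult.commute)
    qed
  qed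
  have inner: "(LINT t|M. indicator {..<t} s * k s * deriv \<phi> t) = - (k s * \<phi> s)" if s: "0 < s" "s < T" for s
  proof -
    obtain K where K: "compact K" "K \<subseteq> {0<..<T}" "\<And>x. x \<notin> K \<Longrightarrow> \<phi> x = 0"
      by (rule test_function_support[OF \<phi>]) blast
    have "T \<notin> K" using K(2) by auto
    then have \<phi>T: "\<phi> T = 0" by (rule K(3))
    have "(LINT t|M. indicator {..<t} s * deriv \<phi> t) = (LINT t|lebesgue. indicator {s<..<T} t *\<^sub>R deriv \<phi> t)"
      unfolding M_def using s
      by (subst integral_restrict_space) (auto intro!: Bochner_Integration.integral_cong simp: indicator_def)
    also have "\<dots> = (LINT t|lebesgue_on {s<..<T}. deriv \<phi> t)"
      by (subst integral_restrict_space) auto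
    also have "\<dots> = integral {s<..<T} (deriv \<phi>)"
    proof (rule lebesgue_integral_eq_integral)
      show "integrable (lebesgue_on {s<..<T}) (deriv \<phi>)"
        using integrable_test_function_mult[OF integrable_const_Ioo[of s T 1] test_function_deriv[OF \<phi>]] by simp
    qed simp
    also have "\<dots> = integral {s..T} (deriv \<phi>)" by (rule integral_open_interval_real[symmetric])
    also have "\<dots> = \<phi> T - \<phi> s"
    proof (rule integral_unique, rule fundamental_theorem_of_calculus)
      show "s \<le> T" using s by simp
      show "(\<phi> has_vector_derivative deriv \<phi> t) (at t within {s..T})" for t
        using test_function_has_real_derivative[OF \<phi>, of t]
        by (simp add: has_real_derivative_iff_has_vector_derivative has_vector_derivative_at_within)
    qed
    finally have "(LINT t|M. k s * (indicator {..<t} s * deriv \<phi> t)) = k s * - \<phi> s" using \<phi>T by simp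
    then show ?thesis by (simp add: mult_ac)
  qed
  have "(LINT t|M. (LINT s|M. indicator {..<t} s * k s) * deriv \<phi> t) = (LINT t|M. LINT s|M. indicator {..<t} s * k s * deriv \<phi> t)"
    by simp
  also have "\<dots> = (LINT s|M. LINT t|M. indicator {..<t} s * k s * deriv \<phi> t)"
    by (rule P.Fubini_integral[OF i2])
  also have "\<dots> = (LINT s|M. - (k s * \<phi> s))"
    by (intro Bochner_Integration.integral_cong refl inner) (auto simp: M_def)
  finally show "(LINT t|lebesgue_on {0<..<T}. (LINT s|lebesgue_on {0<..<T}. indicator {..<t} s * k s) * deriv \<phi> t)
      = - (LINT t|lebesgue_on {0<..<T}. k t * \<phi> t)"
    by (simp add: M_def)
qed

text \<open>The difference between \<open>m\<close> and the primitive of \<open>k\<close> has weak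
  derivative zero, so du Bois-Reymond applies to it.\<close>

lemma weak_derivative_imp_indefinite_integral:
  fixes m k :: "real \<Rightarrow> real"
  assumes T: "T > 0" and m: "integrable (lebesgue_on {0<..<T}) m" and k: "integrable (lebesgue_on {0<..<T}) k"
    and weak: "\<And>\<phi>. \<phi> \<in> test_functions {0<..<T} \<Longrightarrow>
      (LINT t|lebesgue_on {0<..<T}. m t * deriv \<phi> t) = - (LINT t|lebesgue_on {0<..<T}. k t * \<phi> t)"
  shows "\<exists>c. AE t in lebesgue_on {0<..<T}. m t = c + (LINT s|lebesgue_on {0<..<T}. indicator {..<t} s * k s)"
proof -
  let ?M = "lebesgue_on {0<..<T}"
  let ?K = "\<lambda>t. LINT s|?M. indicator {..<t} s * k s"
  have K: "integrable ?M ?K" by (rule indefinite_integral_by_parts(1)[OF k test_functions_0])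
  have "\<exists>c. AE t in ?M. m t - ?K t = c"
  proof (rule du_Bois_Reymond[OF T])
    show "integrable ?M (\<lambda>t. m t - ?K t)" using m K by (rule Bochner_Integration.integrable_diff)
    fix \<phi> :: "real \<Rightarrow> real" assume \<phi>: "\<phi> \<in> test_functions {0<..<T}"
    have "integrable ?M (\<lambda>t. m t * deriv \<phi> t)" "integrable ?M (\<lambda>t. ?K t * deriv \<phi> t)"
      by (rule integrable_test_function_mult[OF m test_function_deriv[OF \<phi>]]
          integrable_test_function_mult[OF K test_function_deriv[OF \<phi>]])+
    then show "(LINT t|?M. (m t - ?K t) * deriv \<phi> t) = 0"
      using weak[OF \<phi>] indefinite_integral_by_parts(2)[OF k \<phi>] by (simp add: left_diff_distrib)
  qed
  then obtain c where "AE t in ?M. m t - ?K t = c" by blast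
  then have "AE t in ?M. m t = c + ?K t" by eventually_elim linarith
  then show ?thesis by blast
qed

section \<open>Sobolev spaces\<close>

lemma (in semi_inner_space) subspace_dual_space: "Real_Vector_Spaces.subspace (dual_space X N)"
proof (rule subspaceI)
  show "0 \<in> dual_space X N"
    unfolding dual_space_def linear_functional_on_def by (auto intro: exI[of _ 0])
next
  fix F G assume F: "F \<in> dual_space X N" and G: "G \<in> dual_space X N"
  obtain B C where B: "\<And>x. x \<in> X \<Longrightarrow> \<bar>F x\<bar> \<le> B * N x" and C: "\<And>x. x \<in> X \<Longrightarrow> \<bar>G x\<bar> \<le> C * N x"
    using F G unfolding dual_space_def by blast
  have "\<bar>(F + G) x\<bar> \<le> (B + C) * N x" if "x \<in> X" for x
    using B[OF that] C[OF that] by (simp add: distrib_right)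
  then have "\<exists>C. \<forall>x\<in>X. \<bar>(F + G) x\<bar> \<le> C * N x" by blast
  moreover have "linear_functional_on X (F + G)"
    using F G unfolding dual_space_def linear_functional_on_def by (simp add: distrib_left)
  ultimately show "F + G \<in> dual_space X N" unfolding dual_space_def by simp
next
  fix c :: real and F assume F: "F \<in> dual_space X N"
  obtain B where B: "\<And>x. x \<in> X \<Longrightarrow> \<bar>F x\<bar> \<le> B * N x" using F unfolding dual_space_def by blast
  have "\<bar>(c *\<^sub>R F) x\<bar> \<le> (\<bar>c\<bar> * B) * N x" if "x \<in> X" for x
    using mult_left_mono[OF B[OF that], of "\<bar>c\<bar>"] by (simp add: abs_mult mult.assoc)
  then have "\<exists>C. \<forall>x\<in>X. \<bar>(c *\<^sub>R F) x\<bar> \<le> C * N x" by blast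
  moreover have "linear_functional_on X (c *\<^sub>R F)"
    using F unfolding dual_space_def linear_functional_on_def by (simp add: distrib_left)
  ultimately show "c *\<^sub>R F \<in> dual_space X N" unfolding dual_space_def by simp
qed

lemma L2_inner_nonneg: "0 \<le> L2_inner \<Omega> u u"
  unfolding L2_inner_def by (rule integral_nonneg_AE) simp

lemma L2_norm_square: "(L2_norm \<Omega> u)\<^sup>2 = L2_inner \<Omega> u u"
  by (simp add: L2_norm_def L2_inner_nonneg)

section \<open>The spaces H1 and H10\<close>

locale bounded_domain =
  fixes \<Omega> :: "'a::euclidean_space set"
  assumes open_domain: "open \<Omega>" and bounded_domain: "bounded \<Omega>"
begin

lemma sets_domain: "\<Omega> \<in> sets lebesgue"
  using open_domain by simp

text \<open>A bounded domain has finite measure, so L2 lies in L1, the setting of the fundamental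
  lemma.\<close>

lemma L2_integrable:
  assumes "u \<in> L2 \<Omega>"
  shows "integrable (lebesgue_on \<Omega>) u"
proof -
  have "\<Omega> \<in> lmeasurable" using bounded_domain sets_domain by (rule bounded_set_imp_lmeasurable)
  then have "integrable (lebesgue_on \<Omega>) (\<lambda>x. 1::real)"
    by (intro finite_measure.integrable_const finite_measure_lebesgue_on)
  then have "(\<lambda>x. 1) \<in> L2 \<Omega>" by (simp add: L2_def)
  from L2_mult_integrable[OF assms this] show ?thesis by simp
qed

lemma L2_fundamental_lemma:
  assumes "u \<in> L2 \<Omega>" "\<And>\<phi>. \<phi> \<in> test_functions \<Omega> \<Longrightarrow> L2_inner \<Omega> u \<phi> = 0"
  shows "L2_norm \<Omega> u = 0"
  unfolding L2_norm_eq_0_iff[OF assms(1)]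
  by (rule fundamental_lemma[OF open_domain L2_integrable[OF assms(1)] assms(2)[unfolded L2_inner_def]])

lemma H1_L2: "u \<in> H1 \<Omega> \<Longrightarrow> u \<in> L2 \<Omega>"
  by (simp add: H1_def)

lemma weak_pderiv:
  assumes "u \<in> H1 \<Omega>" "i \<in> Basis"
  shows "weak_pderiv \<Omega> i u \<in> L2 \<Omega>" "has_weak_pderiv \<Omega> i u (weak_pderiv \<Omega> i u)"
proof -
  have "\<exists>g. g \<in> L2 \<Omega> \<and> has_weak_pderiv \<Omega> i u g" using assms unfolding H1_def by blast
  then have "weak_pderiv \<Omega> i u \<in> L2 \<Omega> \<and> has_weak_pderiv \<Omega> i u (weak_pderiv \<Omega> i u)"
    unfolding weak_pderiv_def by (rule someI_ex)
  then show "weak_pderiv \<Omega> i u \<in> L2 \<Omega>" "has_weak_pderiv \<Omega> i u (weak_pderiv \<Omega> i u)" by auto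
qed

lemma H1I:
  assumes "u \<in> L2 \<Omega>" "\<And>i. i \<in> Basis \<Longrightarrow> g i \<in> L2 \<Omega>" "\<And>i. i \<in> Basis \<Longrightarrow> has_weak_pderiv \<Omega> i u (g i)"
  shows "u \<in> H1 \<Omega>"
  using assms unfolding H1_def by blast

text \<open>Makes the choice in \<open>weak_pderiv\<close> harmless: it is how linearity of the
  chosen derivative, up to L2 seminorm zero, is obtained.\<close>

lemma weak_pderiv_unique:
  assumes u: "u \<in> H1 \<Omega>" and i: "i \<in> Basis" and g: "g \<in> L2 \<Omega>" "has_weak_pderiv \<Omega> i u g"
  shows "L2_norm \<Omega> (weak_pderiv \<Omega> i u - g) = 0"
proof (rule L2_fundamental_lemma)
  note w = weak_pderiv[OF u i]
  show "weak_pderiv \<Omega> i u - g \<in> L2 \<Omega>" by (intro L2.mem_diff w g)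
  fix \<phi> :: "'a \<Rightarrow> real" assume \<phi>: "\<phi> \<in> test_functions \<Omega>"
  have "L2_inner \<Omega> (weak_pderiv \<Omega> i u) \<phi> = L2_inner \<Omega> g \<phi>"
    using w(2) g(2) \<phi> unfolding has_weak_pderiv_def by (metis neg_equal_iff_equal)
  then show "L2_inner \<Omega> (weak_pderiv \<Omega> i u - g) \<phi> = 0"
    using L2.ip_diff_left[OF w(1) g(1) test_function_L2[OF sets_domain \<phi>]] by simp
qed

lemma test_pderiv_L2: "\<phi> \<in> test_functions \<Omega> \<Longrightarrow> i \<in> Basis \<Longrightarrow> (\<lambda>x. frechet_derivative \<phi> (at x) i) \<in> L2 \<Omega>"
  by (rule test_function_L2[OF sets_domain test_function_pderiv])

lemma has_weak_pderiv_add: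
  assumes "u \<in> L2 \<Omega>" "v \<in> L2 \<Omega>" "g \<in> L2 \<Omega>" "h \<in> L2 \<Omega>" "i \<in> Basis"
    and "has_weak_pderiv \<Omega> i u g" "has_weak_pderiv \<Omega> i v h"
  shows "has_weak_pderiv \<Omega> i (u + v) (g + h)"
  unfolding has_weak_pderiv_def
proof
  fix \<phi> :: "'a \<Rightarrow> real" assume \<phi>: "\<phi> \<in> test_functions \<Omega>"
  show "L2_inner \<Omega> (u + v) (\<lambda>x. frechet_derivative \<phi> (at x) i) = - L2_inner \<Omega> (g + h) \<phi>"
    using assms(6,7) \<phi> L2.ip_add_left[OF assms(1,2) test_pderiv_L2[OF \<phi> assms(5)]]
      L2.ip_add_left[OF assms(3,4) test_function_L2[OF sets_domain \<phi>]]
    unfolding has_weak_pderiv_def by simp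
qed

lemma has_weak_pderiv_scaleR:
  assumes "u \<in> L2 \<Omega>" "g \<in> L2 \<Omega>" "i \<in> Basis" "has_weak_pderiv \<Omega> i u g"
  shows "has_weak_pderiv \<Omega> i (c *\<^sub>R u) (c *\<^sub>R g)"
  unfolding has_weak_pderiv_def
proof
  fix \<phi> :: "'a \<Rightarrow> real" assume \<phi>: "\<phi> \<in> test_functions \<Omega>"
  show "L2_inner \<Omega> (c *\<^sub>R u) (\<lambda>x. frechet_derivative \<phi> (at x) i) = - L2_inner \<Omega> (c *\<^sub>R g) \<phi>"
    using assms(4) \<phi> L2.ip_scale_left[OF assms(1) test_pderiv_L2[OF \<phi> assms(3)]]
      L2.ip_scale_left[OF assms(2) test_function_L2[OF sets_domain \<phi>]]
    unfolding has_weak_pderiv_def by simp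
qed

lemma H1_add: "u \<in> H1 \<Omega> \<Longrightarrow> v \<in> H1 \<Omega> \<Longrightarrow> u + v \<in> H1 \<Omega>"
  by (rule H1I[where g = "\<lambda>i. weak_pderiv \<Omega> i u + weak_pderiv \<Omega> i v"])
     (intro L2.mem_add has_weak_pderiv_add H1_L2 weak_pderiv; assumption)+

lemma H1_scaleR: "u \<in> H1 \<Omega> \<Longrightarrow> c *\<^sub>R u \<in> H1 \<Omega>"
  by (rule H1I[where g = "\<lambda>i. c *\<^sub>R weak_pderiv \<Omega> i u"])
     (intro L2.mem_scale has_weak_pderiv_scaleR H1_L2 weak_pderiv; assumption)+

lemma weak_pderiv_add:
  assumes "u \<in> H1 \<Omega>" "v \<in> H1 \<Omega>" "i \<in> Basis"
  shows "L2_norm \<Omega> (weak_pderiv \<Omega> i (u + v) - (weak_pderiv \<Omega> i u + weak_pderiv \<Omega> i v)) = 0"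
  by (intro weak_pderiv_unique H1_add has_weak_pderiv_add L2.mem_add weak_pderiv H1_L2 assms)

lemma weak_pderiv_scaleR:
  assumes "u \<in> H1 \<Omega>" "i \<in> Basis"
  shows "L2_norm \<Omega> (weak_pderiv \<Omega> i (c *\<^sub>R u) - c *\<^sub>R weak_pderiv \<Omega> i u) = 0"
  by (intro weak_pderiv_unique H1_scaleR has_weak_pderiv_scaleR L2.mem_scale weak_pderiv H1_L2 assms)

lemma L2_norm_self_diff: "L2_norm \<Omega> (u - u) = 0"
  by (simp add: L2.N_zero)

definition H1_inner :: "('a \<Rightarrow> real) \<Rightarrow> ('a \<Rightarrow> real) \<Rightarrow> real" where
  "H1_inner u v = L2_inner \<Omega> u v + (\<Sum>i\<in>Basis. L2_inner \<Omega> (weak_pderiv \<Omega> i u) (weak_pderiv \<Omega> i v))"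

lemma semi_inner_space_H1: "semi_inner_space (H1 \<Omega>) H1_inner (H1_norm \<Omega>)"
proof (rule semi_inner_space.intro)
  have "0 \<in> H1 \<Omega>"
    by (rule H1I[where g = "\<lambda>i. 0"])
       (auto simp: L2.mem_zero has_weak_pderiv_def L2.ip_zero_left test_pderiv_L2 test_function_L2 sets_domain)
  then show "subspace (H1 \<Omega>)" by (intro subspaceI H1_add H1_scaleR)
  show "H1_inner u v = H1_inner v u" for u v
    unfolding H1_inner_def L2_inner_def by (simp add: mult.commute)
  show "H1_inner (u + v) w = H1_inner u w + H1_inner v w" if "u \<in> H1 \<Omega>" "v \<in> H1 \<Omega>" "w \<in> H1 \<Omega>" for u v w
  proof -
    have "L2_inner \<Omega> (weak_pderiv \<Omega> i (u + v)) (weak_pderiv \<Omega> i w) =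
      L2_inner \<Omega> (weak_pderiv \<Omega> i u) (weak_pderiv \<Omega> i w) + L2_inner \<Omega> (weak_pderiv \<Omega> i v) (weak_pderiv \<Omega> i w)"
      if "i \<in> Basis" for i
    proof -
      note w = weak_pderiv(1)[OF \<open>u \<in> _\<close> that] weak_pderiv(1)[OF \<open>v \<in> _\<close> that] weak_pderiv(1)[OF \<open>w \<in> _\<close> that]
      have "L2_inner \<Omega> (weak_pderiv \<Omega> i (u + v)) (weak_pderiv \<Omega> i w) =
          L2_inner \<Omega> (weak_pderiv \<Omega> i u + weak_pderiv \<Omega> i v) (weak_pderiv \<Omega> i w)"
        by (intro L2.ip_cong weak_pderiv(1) H1_add L2.mem_add w \<open>u \<in> _\<close> \<open>v \<in> _\<close> that weak_pderiv_add L2_norm_self_diff)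
      also have "\<dots> = L2_inner \<Omega> (weak_pderiv \<Omega> i u) (weak_pderiv \<Omega> i w) + L2_inner \<Omega> (weak_pderiv \<Omega> i v) (weak_pderiv \<Omega> i w)"
        by (rule L2.ip_add_left[OF w])
      finally show ?thesis .
    qed
    then show ?thesis
      using L2.ip_add_left[OF H1_L2 H1_L2 H1_L2] that by (simp add: H1_inner_def sum.distrib)
  qed
  show "H1_inner (c *\<^sub>R u) w = c * H1_inner u w" if "u \<in> H1 \<Omega>" "w \<in> H1 \<Omega>" for c u w
  proof -
    have "L2_inner \<Omega> (weak_pderiv \<Omega> i (c *\<^sub>R u)) (weak_pderiv \<Omega> i w) = c * L2_inner \<Omega> (weak_pderiv \<Omega> i u) (weak_pderiv \<Omega> i w)"
      if "i \<in> Basis" for i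
    proof -
      note w = weak_pderiv(1)[OF \<open>u \<in> _\<close> that] weak_pderiv(1)[OF \<open>w \<in> _\<close> that]
      have "L2_inner \<Omega> (weak_pderiv \<Omega> i (c *\<^sub>R u)) (weak_pderiv \<Omega> i w) =
          L2_inner \<Omega> (c *\<^sub>R weak_pderiv \<Omega> i u) (weak_pderiv \<Omega> i w)"
        by (intro L2.ip_cong weak_pderiv(1) H1_scaleR L2.mem_scale w \<open>u \<in> _\<close> that weak_pderiv_scaleR L2_norm_self_diff)
      also have "\<dots> = c * L2_inner \<Omega> (weak_pderiv \<Omega> i u) (weak_pderiv \<Omega> i w)"
        by (rule L2.ip_scale_left[OF w])
      finally show ?thesis .
    qed
    then show ?thesis
      using L2.ip_scale_left[OF H1_L2 H1_L2] that by (simp add: H1_inner_def sum_distrib_left distrib_left)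
  qed
  show "0 \<le> H1_inner u u" for u
    unfolding H1_inner_def by (intro add_nonneg_nonneg sum_nonneg L2_inner_nonneg)
  show "H1_norm \<Omega> u = sqrt (H1_inner u u)" for u
    by (simp add: H1_norm_def H1_inner_def L2_norm_square)
qed

sublocale H1: semi_inner_space "H1 \<Omega>" H1_inner "H1_norm \<Omega>"
  by (rule semi_inner_space_H1)

lemma L2_norm_le_H1_norm: "L2_norm \<Omega> u \<le> H1_norm \<Omega> u"
  unfolding H1_norm_def by (intro real_le_rsqrt) (simp add: sum_nonneg)

lemma weak_pderiv_norm_le_H1_norm: "i \<in> Basis \<Longrightarrow> L2_norm \<Omega> (weak_pderiv \<Omega> i u) \<le> H1_norm \<Omega> u"
  unfolding H1_norm_def
  by (intro real_le_rsqrt)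
     (meson add_increasing member_le_sum finite_Basis zero_le_power2)

lemma weak_pderiv_norm_diff:
  assumes "u \<in> H1 \<Omega>" "i \<in> Basis" "v \<in> H1 \<Omega>" "h \<in> L2 \<Omega>" "has_weak_pderiv \<Omega> i v h"
  shows "L2_norm \<Omega> (weak_pderiv \<Omega> i (u - v)) = L2_norm \<Omega> (weak_pderiv \<Omega> i u - h)"
proof -
  note w = weak_pderiv[OF assms(1,2)]
  have "has_weak_pderiv \<Omega> i (u + (-1) *\<^sub>R v) (weak_pderiv \<Omega> i u + (-1) *\<^sub>R h)"
    by (intro has_weak_pderiv_add has_weak_pderiv_scaleR L2.mem_scale H1_L2 w assms)
  then have "has_weak_pderiv \<Omega> i (u - v) (weak_pderiv \<Omega> i u - h)" by simp
  then have 0: "L2_norm \<Omega> (weak_pderiv \<Omega> i (u - v) - (weak_pderiv \<Omega> i u - h)) = 0"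
    by (intro weak_pderiv_unique H1.mem_diff L2.mem_diff w assms)
  have "weak_pderiv \<Omega> i (u - v) \<in> L2 \<Omega>" "weak_pderiv \<Omega> i u - h \<in> L2 \<Omega>"
    by (intro weak_pderiv H1.mem_diff L2.mem_diff w assms)+
  from L2.N_abs_diff_le[OF this] 0 show ?thesis by simp
qed

text \<open>Weak differentiation is a closed operation: both sides of its defining identity pass to
  L2 limits.\<close>

lemma H1_complete:
  assumes x: "\<And>k. x k \<in> H1 \<Omega>" and Cauchy: "\<And>\<epsilon>. \<epsilon> > 0 \<Longrightarrow> \<exists>k0. \<forall>j\<ge>k0. \<forall>k\<ge>k0. H1_norm \<Omega> (x j - x k) < \<epsilon>"
  obtains l where "l \<in> H1 \<Omega>" "(\<lambda>k::nat. H1_norm \<Omega> (x k - l)) \<longlonglongrightarrow> 0"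
proof -
  have lim: "\<exists>l\<in>L2 \<Omega>. (\<lambda>k. L2_norm \<Omega> (z k - l)) \<longlonglongrightarrow> 0"
    if z: "\<And>k. z k \<in> L2 \<Omega>" "\<And>j k. L2_norm \<Omega> (z j - z k) \<le> H1_norm \<Omega> (x j - x k)" for z
  proof (rule L2_complete[unfolded L2.complete_seminorm_def, rule_format])
    show "z k \<in> L2 \<Omega>" for k by (rule z)
    fix \<epsilon> :: real assume "\<epsilon> > 0"
    from Cauchy[OF this] show "\<exists>k0. \<forall>j\<ge>k0. \<forall>k\<ge>k0. L2_norm \<Omega> (z j - z k) < \<epsilon>"
      using z(2) le_less_trans by blast
  qed
  have "\<exists>l\<in>L2 \<Omega>. (\<lambda>k. L2_norm \<Omega> (x k - l)) \<longlonglongrightarrow> 0"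
    by (rule lim) (auto intro: H1_L2 x L2_norm_le_H1_norm)
  then obtain l where l: "l \<in> L2 \<Omega>" "(\<lambda>k. L2_norm \<Omega> (x k - l)) \<longlonglongrightarrow> 0" by blast
  have "\<exists>g\<in>L2 \<Omega>. (\<lambda>k. L2_norm \<Omega> (weak_pderiv \<Omega> i (x k) - g)) \<longlonglongrightarrow> 0" if i: "i \<in> Basis" for i
  proof (rule lim)
    show "weak_pderiv \<Omega> i (x k) \<in> L2 \<Omega>" for k by (rule weak_pderiv[OF x i])
    show "L2_norm \<Omega> (weak_pderiv \<Omega> i (x j) - weak_pderiv \<Omega> i (x k)) \<le> H1_norm \<Omega> (x j - x k)" for j k
      using weak_pderiv_norm_diff[OF x i x weak_pderiv[OF x i], of j k] weak_pderiv_norm_le_H1_norm[OF i] by metis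
  qed
  then obtain g where g: "\<And>i. i \<in> Basis \<Longrightarrow> g i \<in> L2 \<Omega>"
    "\<And>i. i \<in> Basis \<Longrightarrow> (\<lambda>k. L2_norm \<Omega> (weak_pderiv \<Omega> i (x k) - g i)) \<longlonglongrightarrow> 0" by metis
  have self: "(\<lambda>k::nat. L2_norm \<Omega> (u - u)) \<longlonglongrightarrow> 0" for u by (simp add: L2.N_zero)
  have der: "has_weak_pderiv \<Omega> i l (g i)" if i: "i \<in> Basis" for i
    unfolding has_weak_pderiv_def
  proof
    fix \<phi> :: "'a \<Rightarrow> real" assume \<phi>: "\<phi> \<in> test_functions \<Omega>"
    note \<phi>L = test_function_L2[OF sets_domain \<phi>] and D\<phi>L = test_pderiv_L2[OF \<phi> i]
    have "(\<lambda>k. L2_inner \<Omega> (x k) (\<lambda>x. frechet_derivative \<phi> (at x) i)) \<longlonglongrightarrow> L2_inner \<Omega> l (\<lambda>x. frechet_derivative \<phi> (at x) i)"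
      by (rule L2.tendsto_ip[OF H1_L2[OF x] l D\<phi>L D\<phi>L self])
    moreover have "(\<lambda>k. - L2_inner \<Omega> (weak_pderiv \<Omega> i (x k)) \<phi>) \<longlonglongrightarrow> - L2_inner \<Omega> (g i) \<phi>"
      by (rule tendsto_minus[OF L2.tendsto_ip[OF weak_pderiv(1)[OF x i] g[OF i] \<phi>L \<phi>L self]])
    moreover have "L2_inner \<Omega> (x k) (\<lambda>x. frechet_derivative \<phi> (at x) i) = - L2_inner \<Omega> (weak_pderiv \<Omega> i (x k)) \<phi>" for k
      using weak_pderiv(2)[OF x i] \<phi> unfolding has_weak_pderiv_def by blast
    ultimately show "L2_inner \<Omega> l (\<lambda>x. frechet_derivative \<phi> (at x) i) = - L2_inner \<Omega> (g i) \<phi>"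
      using LIMSEQ_unique by simp
  qed
  have l_H1: "l \<in> H1 \<Omega>" by (rule H1I[OF l(1) g(1) der])
  have "H1_norm \<Omega> (x k - l) = sqrt ((L2_norm \<Omega> (x k - l))\<^sup>2 + (\<Sum>i\<in>Basis. (L2_norm \<Omega> (weak_pderiv \<Omega> i (x k) - g i))\<^sup>2))" for k
    unfolding H1_norm_def using weak_pderiv_norm_diff[OF x _ l_H1 g(1) der] by simp
  moreover have "(\<lambda>k. sqrt ((L2_norm \<Omega> (x k - l))\<^sup>2 + (\<Sum>i\<in>Basis. (L2_norm \<Omega> (weak_pderiv \<Omega> i (x k) - g i))\<^sup>2)))
    \<longlonglongrightarrow> sqrt (0\<^sup>2 + (\<Sum>i\<in>(Basis::'a set). 0\<^sup>2))"
    by (intro tendsto_real_sqrt tendsto_add tendsto_sum tendsto_power l g)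
  ultimately have "(\<lambda>k. H1_norm \<Omega> (x k - l)) \<longlonglongrightarrow> 0" by simp
  then show ?thesis using that l_H1 by blast
qed

lemma test_function_H1:
  assumes "\<phi> \<in> test_functions \<Omega>"
  shows "\<phi> \<in> H1 \<Omega>"
  by (rule H1I[where g = "\<lambda>i x. frechet_derivative \<phi> (at x) i"])
     (auto intro!: test_function_L2 sets_domain test_pderiv_L2 assms test_function_integration_by_parts
       simp: has_weak_pderiv_def)

lemma H10_H1: "u \<in> H10 \<Omega> \<Longrightarrow> u \<in> H1 \<Omega>"
  by (simp add: H10_def)

lemma H10_L2: "u \<in> H10 \<Omega> \<Longrightarrow> u \<in> L2 \<Omega>"
  by (rule H1_L2[OF H10_H1])

text \<open>The epsilon form allows closure properties to be shown without combining approximating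
  sequences.\<close>

lemma H10_iff_approx:
  "u \<in> H10 \<Omega> \<longleftrightarrow> u \<in> H1 \<Omega> \<and> (\<forall>\<epsilon>>0. \<exists>\<phi>\<in>test_functions \<Omega>. H1_norm \<Omega> (u - \<phi>) < \<epsilon>)"
proof
  assume "u \<in> H10 \<Omega>"
  then obtain \<phi> where u: "u \<in> H1 \<Omega>" and \<phi>: "\<And>k. \<phi> k \<in> test_functions \<Omega>" "(\<lambda>k. H1_norm \<Omega> (u - \<phi> k)) \<longlonglongrightarrow> 0"
    unfolding H10_def by blast
  have "\<exists>\<psi>\<in>test_functions \<Omega>. H1_norm \<Omega> (u - \<psi>) < \<epsilon>" if "\<epsilon> > 0" for \<epsilon>
  proof -
    have "\<forall>\<^sub>F k in sequentially. H1_norm \<Omega> (u - \<phi> k) < \<epsilon>" using order_tendstoD(2)[OF \<phi>(2) that] .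
    then obtain k where "H1_norm \<Omega> (u - \<phi> k) < \<epsilon>" by (auto simp: eventually_sequentially)
    then show ?thesis using \<phi>(1) by blast
  qed
  then show "u \<in> H1 \<Omega> \<and> (\<forall>\<epsilon>>0. \<exists>\<phi>\<in>test_functions \<Omega>. H1_norm \<Omega> (u - \<phi>) < \<epsilon>)" using u by blast
next
  assume u: "u \<in> H1 \<Omega> \<and> (\<forall>\<epsilon>>0. \<exists>\<phi>\<in>test_functions \<Omega>. H1_norm \<Omega> (u - \<phi>) < \<epsilon>)"
  then have "\<forall>k. \<exists>\<phi>\<in>test_functions \<Omega>. H1_norm \<Omega> (u - \<phi>) < 1 / Suc k" by simp
  then obtain \<phi> where \<phi>: "\<And>k. \<phi> k \<in> test_functions \<Omega>" "\<And>k. H1_norm \<Omega> (u - \<phi> k) < 1 / Suc k" by metis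
  have b: "norm (H1_norm \<Omega> (u - \<phi> k)) \<le> 1 / Suc k" for k
    using \<phi>(2)[of k] H1.N_nonneg[OF H1.mem_diff[OF conjunct1[OF u] test_function_H1[OF \<phi>(1)[of k]]]] by simp
  have "(\<lambda>k. H1_norm \<Omega> (u - \<phi> k)) \<longlonglongrightarrow> 0"
    by (rule Lim_null_comparison[OF always_eventually[OF allI[OF b]] LIMSEQ_Suc[OF lim_1_over_n]])
  then show "u \<in> H10 \<Omega>" using u \<phi>(1) unfolding H10_def by blast
qed

lemma H10_approx: "u \<in> H10 \<Omega> \<Longrightarrow> \<epsilon> > 0 \<Longrightarrow> \<exists>\<phi>\<in>test_functions \<Omega>. H1_norm \<Omega> (u - \<phi>) < \<epsilon>"
  unfolding H10_iff_approx by blast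

lemma subspace_H10: "subspace (H10 \<Omega>)"
proof (rule subspaceI)
  show "0 \<in> H10 \<Omega>"
    unfolding H10_iff_approx using test_functions_0 H1.mem_zero by (auto simp: H1.N_zero intro!: bexI[of _ 0])
next
  fix u v assume u: "u \<in> H10 \<Omega>" and v: "v \<in> H10 \<Omega>"
  have "\<exists>\<phi>\<in>test_functions \<Omega>. H1_norm \<Omega> (u + v - \<phi>) < \<epsilon>" if "\<epsilon> > 0" for \<epsilon>
  proof -
    obtain \<phi> \<psi> where \<phi>: "\<phi> \<in> test_functions \<Omega>" "H1_norm \<Omega> (u - \<phi>) < \<epsilon> / 2"
      and \<psi>: "\<psi> \<in> test_functions \<Omega>" "H1_norm \<Omega> (v - \<psi>) < \<epsilon> / 2"
      using H10_approx[OF u half_gt_zero[OF \<open>\<epsilon> > 0\<close>]] H10_approx[OF v half_gt_zero[OF \<open>\<epsilon> > 0\<close>]] by blast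
    have "H1_norm \<Omega> ((u - \<phi>) + (v - \<psi>)) \<le> H1_norm \<Omega> (u - \<phi>) + H1_norm \<Omega> (v - \<psi>)"
      by (intro H1.N_triangle H1.mem_diff H10_H1 u v test_function_H1 \<phi> \<psi>)
    also have "(u - \<phi>) + (v - \<psi>) = u + v - (\<phi> + \<psi>)" by simp
    finally have "H1_norm \<Omega> (u + v - (\<phi> + \<psi>)) < \<epsilon>" using \<phi>(2) \<psi>(2) by linarith
    then show ?thesis using subspace_add[OF subspace_test_functions \<phi>(1) \<psi>(1)] by blast
  qed
  then show "u + v \<in> H10 \<Omega>" unfolding H10_iff_approx using H1.mem_add[OF H10_H1[OF u] H10_H1[OF v]] by blast
next
  fix c :: real and u assume u: "u \<in> H10 \<Omega>"
  have "\<exists>\<phi>\<in>test_functions \<Omega>. H1_norm \<Omega> (c *\<^sub>R u - \<phi>) < \<epsilon>" if "\<epsilon> > 0" for \<epsilon>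
  proof -
    \<comment> \<open>The added 1 covers c = 0.\<close>
    have "\<epsilon> / (\<bar>c\<bar> + 1) > 0" using that by simp
    then obtain \<phi> where \<phi>: "\<phi> \<in> test_functions \<Omega>" "H1_norm \<Omega> (u - \<phi>) < \<epsilon> / (\<bar>c\<bar> + 1)"
      using u unfolding H10_iff_approx by blast
    have "H1_norm \<Omega> (c *\<^sub>R (u - \<phi>)) = \<bar>c\<bar> * H1_norm \<Omega> (u - \<phi>)"
      by (intro H1.N_scale H1.mem_diff H10_H1 u test_function_H1 \<phi>)
    also have "\<dots> \<le> (\<bar>c\<bar> + 1) * H1_norm \<Omega> (u - \<phi>)"
      by (intro mult_right_mono H1.N_nonneg H1.mem_diff H10_H1 u test_function_H1 \<phi>) simp
    also have "\<dots> < (\<bar>c\<bar> + 1) * (\<epsilon> / (\<bar>c\<bar> + 1))"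
      using \<phi>(2) by (intro mult_strict_left_mono) auto
    also have "\<dots> = \<epsilon>" by simp
    finally have "H1_norm \<Omega> (c *\<^sub>R u - c *\<^sub>R \<phi>) < \<epsilon>" by (simp add: scaleR_diff_right)
    then show ?thesis using subspace_scale[OF subspace_test_functions \<phi>(1)] by blast
  qed
  then show "c *\<^sub>R u \<in> H10 \<Omega>" unfolding H10_iff_approx using H1.mem_scale[OF H10_H1[OF u]] by blast
qed

lemma H10_closed:
  assumes x: "\<And>k. x k \<in> H10 \<Omega>" and l: "l \<in> H1 \<Omega>" "(\<lambda>k::nat. H1_norm \<Omega> (x k - l)) \<longlonglongrightarrow> 0"
  shows "l \<in> H10 \<Omega>"
proof -
  have "\<exists>\<phi>\<in>test_functions \<Omega>. H1_norm \<Omega> (l - \<phi>) < \<epsilon>" if "\<epsilon> > 0" for \<epsilon>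
  proof -
    have "\<forall>\<^sub>F k in sequentially. H1_norm \<Omega> (x k - l) < \<epsilon> / 2"
      using order_tendstoD(2)[OF l(2), of "\<epsilon> / 2"] that by simp
    then obtain k where k: "H1_norm \<Omega> (x k - l) < \<epsilon> / 2" by (auto simp: eventually_sequentially)
    obtain \<phi> where \<phi>: "\<phi> \<in> test_functions \<Omega>" "H1_norm \<Omega> (x k - \<phi>) < \<epsilon> / 2"
      using H10_approx[OF x half_gt_zero[OF \<open>\<epsilon> > 0\<close>]] by blast
    have "H1_norm \<Omega> (l - \<phi>) \<le> H1_norm \<Omega> (l - x k) + H1_norm \<Omega> (x k - \<phi>)"
      by (intro H1.N_triangle_diff H10_H1 x l test_function_H1 \<phi>)
    also have "H1_norm \<Omega> (l - x k) = H1_norm \<Omega> (x k - l)" by (intro H1.N_minus_commute H10_H1 x l)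
    finally have "H1_norm \<Omega> (l - \<phi>) < \<epsilon>" using k \<phi>(2) by linarith
    then show ?thesis using \<phi>(1) by blast
  qed
  then show ?thesis unfolding H10_iff_approx using l(1) by blast
qed

end

section \<open>Energy inner product, Riesz lift and dual space\<close>

locale energy_space = bounded_domain \<Omega> for \<Omega> :: "'a::euclidean_space set" +
  fixes a :: "'a form"
  assumes admissible: "admissible_form \<Omega> a"
begin

lemma coercive:
  obtains \<alpha> where "\<alpha> > 0" "\<And>u. u \<in> H10 \<Omega> \<Longrightarrow> \<alpha> * (H1_norm \<Omega> u)\<^sup>2 \<le> a u u"
  using admissible unfolding admissible_form_def by blast

lemma semi_inner_space_V: "semi_inner_space (H10 \<Omega>) a (V_norm a)"
proof (rule semi_inner_space.intro)
  show "subspace (H10 \<Omega>)" by (rule subspace_H10)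
  show "a u v = a v u" if "u \<in> H10 \<Omega>" "v \<in> H10 \<Omega>" for u v
    using admissible that unfolding admissible_form_def by blast
  have lin: "linear_functional_on (H10 \<Omega>) (\<lambda>u. a u v)" if "v \<in> H10 \<Omega>" for v
    using admissible that unfolding admissible_form_def by blast
  show "a (u + v) w = a u w + a v w" if "u \<in> H10 \<Omega>" "v \<in> H10 \<Omega>" "w \<in> H10 \<Omega>" for u v w
    using lin[OF that(3)] that(1,2) unfolding linear_functional_on_def by blast
  show "a (c *\<^sub>R u) w = c * a u w" if "u \<in> H10 \<Omega>" "w \<in> H10 \<Omega>" for c u w
    using lin[OF that(2)] that(1) unfolding linear_functional_on_def by blast
  show "0 \<le> a u u" if "u \<in> H10 \<Omega>" for u
  proof -
    obtain \<alpha> where "\<alpha> > 0" "\<And>u. u \<in> H10 \<Omega> \<Longrightarrow> \<alpha> * (H1_norm \<Omega> u)\<^sup>2 \<le> a u u" by (rule coercive) blast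
    then show ?thesis using that by (meson less_imp_le mult_nonneg_nonneg order_trans zero_le_power2)
  qed
  show "V_norm a u = sqrt (a u u)" for u by (rule V_norm_def)
qed

sublocale V: semi_inner_space "H10 \<Omega>" a "V_norm a"
  by (rule semi_inner_space_V)

lemma H1_norm_le_V_norm:
  obtains C where "C > 0" "\<And>u. u \<in> H10 \<Omega> \<Longrightarrow> H1_norm \<Omega> u \<le> C * V_norm a u"
proof -
  obtain \<alpha> where \<alpha>: "\<alpha> > 0" "\<And>u. u \<in> H10 \<Omega> \<Longrightarrow> \<alpha> * (H1_norm \<Omega> u)\<^sup>2 \<le> a u u" by (rule coercive) blast
  have "H1_norm \<Omega> u \<le> (1 / sqrt \<alpha>) * V_norm a u" if u: "u \<in> H10 \<Omega>" for u
  proof (rule power2_le_imp_le)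
    have "(H1_norm \<Omega> u)\<^sup>2 \<le> a u u / \<alpha>" using \<alpha>(1) \<alpha>(2)[OF u] by (simp add: field_simps)
    also have "\<dots> = (1 / sqrt \<alpha> * V_norm a u)\<^sup>2"
      using \<alpha>(1) V.N_square[OF u] by (simp add: power_mult_distrib power_divide)
    finally show "(H1_norm \<Omega> u)\<^sup>2 \<le> (1 / sqrt \<alpha> * V_norm a u)\<^sup>2" .
    show "0 \<le> 1 / sqrt \<alpha> * V_norm a u" using \<alpha>(1) V.N_nonneg[OF u] by simp
  qed
  then show ?thesis using that[of "1 / sqrt \<alpha>"] \<alpha>(1) by simp
qed

lemma L2_norm_le_V_norm:
  obtains C where "C > 0" "\<And>u. u \<in> H10 \<Omega> \<Longrightarrow> L2_norm \<Omega> u \<le> C * V_norm a u"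
  using H1_norm_le_V_norm L2_norm_le_H1_norm order_trans by metis

lemma V_norm_le_H1_norm:
  obtains C where "C > 0" "\<And>u. u \<in> H10 \<Omega> \<Longrightarrow> V_norm a u \<le> C * H1_norm \<Omega> u"
proof -
  obtain M where M: "\<And>u v. u \<in> H10 \<Omega> \<Longrightarrow> v \<in> H10 \<Omega> \<Longrightarrow> \<bar>a u v\<bar> \<le> M * H1_norm \<Omega> u * H1_norm \<Omega> v"
    using admissible unfolding admissible_form_def by blast
  have "V_norm a u \<le> sqrt (\<bar>M\<bar> + 1) * H1_norm \<Omega> u" if u: "u \<in> H10 \<Omega>" for u
  proof (rule power2_le_imp_le)
    have "(V_norm a u)\<^sup>2 \<le> M * (H1_norm \<Omega> u)\<^sup>2"
      using M[OF u u] V.N_square[OF u] by (simp add: power2_eq_square mult.assoc)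
    also have "\<dots> \<le> (\<bar>M\<bar> + 1) * (H1_norm \<Omega> u)\<^sup>2" by (intro mult_right_mono) auto
    also have "\<dots> = (sqrt (\<bar>M\<bar> + 1) * H1_norm \<Omega> u)\<^sup>2" by (simp add: power_mult_distrib)
    finally show "(V_norm a u)\<^sup>2 \<le> (sqrt (\<bar>M\<bar> + 1) * H1_norm \<Omega> u)\<^sup>2" .
    show "0 \<le> sqrt (\<bar>M\<bar> + 1) * H1_norm \<Omega> u" using H1.N_nonneg[OF H10_H1[OF u]] by simp
  qed
  then show ?thesis using that[of "sqrt (\<bar>M\<bar> + 1)"] by simp
qed

text \<open>Coercivity carries Cauchy sequences into H1, and continuity of the form carries
  convergence back.\<close>

lemma V_complete: "V.complete_seminorm"
  unfolding V.complete_seminorm_def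
proof (intro allI impI)
  fix x :: "nat \<Rightarrow> 'a \<Rightarrow> real"
  assume "\<forall>k. x k \<in> H10 \<Omega>" and Cauchy: "\<forall>\<epsilon>>0. \<exists>k0. \<forall>j\<ge>k0. \<forall>k\<ge>k0. V_norm a (x j - x k) < \<epsilon>"
  then have x: "x k \<in> H10 \<Omega>" for k by simp
  obtain C where C: "C > 0" "\<And>u. u \<in> H10 \<Omega> \<Longrightarrow> H1_norm \<Omega> u \<le> C * V_norm a u" by (rule H1_norm_le_V_norm) blast
  obtain l where l: "l \<in> H1 \<Omega>" "(\<lambda>k. H1_norm \<Omega> (x k - l)) \<longlonglongrightarrow> 0"
  proof (rule H1_complete[OF H10_H1[OF x]])
    fix \<epsilon> :: real assume "\<epsilon> > 0"
    then have "\<epsilon> / C > 0" using C(1) by simp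
    then obtain k0 where k0: "\<forall>j\<ge>k0. \<forall>k\<ge>k0. V_norm a (x j - x k) < \<epsilon> / C" using Cauchy by blast
    have "H1_norm \<Omega> (x j - x k) < \<epsilon>" if "j \<ge> k0" "k \<ge> k0" for j k
    proof -
      have "H1_norm \<Omega> (x j - x k) \<le> C * V_norm a (x j - x k)" by (intro C V.mem_diff x)
      also have "\<dots> < C * (\<epsilon> / C)" using k0 that C(1) by (intro mult_strict_left_mono) auto
      finally show ?thesis using C(1) by simp
    qed
    then show "\<exists>k0. \<forall>j\<ge>k0. \<forall>k\<ge>k0. H1_norm \<Omega> (x j - x k) < \<epsilon>" by blast
  qed blast
  have l': "l \<in> H10 \<Omega>" by (rule H10_closed[OF x l])
  obtain B where B: "B > 0" "\<And>u. u \<in> H10 \<Omega> \<Longrightarrow> V_norm a u \<le> B * H1_norm \<Omega> u" by (rule V_norm_le_H1_norm) blast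
  have b: "norm (V_norm a (x k - l)) \<le> B * H1_norm \<Omega> (x k - l)" for k
    using B(2)[OF V.mem_diff[OF x l']] V.N_nonneg[OF V.mem_diff[OF x l']] by simp
  have "(\<lambda>k. V_norm a (x k - l)) \<longlonglongrightarrow> 0"
    by (rule Lim_null_comparison[OF always_eventually[OF allI[OF b]] tendsto_mult_right_zero[OF l(2)]])
  then show "\<exists>l\<in>H10 \<Omega>. (\<lambda>k. V_norm a (x k - l)) \<longlonglongrightarrow> 0" using l' by blast
qed

abbreviation R where "R \<equiv> riesz_lift \<Omega> a"

lemma riesz_lift:
  assumes "F \<in> V_dual \<Omega> a"
  shows "R F \<in> H10 \<Omega>" "\<And>v. v \<in> H10 \<Omega> \<Longrightarrow> a (R F) v = F v"
proof -
  obtain r where "r \<in> H10 \<Omega>" "\<And>v. v \<in> H10 \<Omega> \<Longrightarrow> a r v = F v"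
    by (rule V.Riesz_representation[OF V_complete assms[unfolded V_dual_def]]) blast
  then have "\<exists>r. r \<in> H10 \<Omega> \<and> (\<forall>v\<in>H10 \<Omega>. a r v = F v)" by blast
  then have "R F \<in> H10 \<Omega> \<and> (\<forall>v\<in>H10 \<Omega>. a (R F) v = F v)" unfolding riesz_lift_def by (rule someI_ex)
  then show "R F \<in> H10 \<Omega>" "\<And>v. v \<in> H10 \<Omega> \<Longrightarrow> a (R F) v = F v" by auto
qed

lemma V_norm_eq_0I: "x \<in> H10 \<Omega> \<Longrightarrow> (\<And>v. v \<in> H10 \<Omega> \<Longrightarrow> a x v = 0) \<Longrightarrow> V_norm a x = 0"
  by (simp add: V_norm_def)

lemma subspace_V_dual: "subspace (V_dual \<Omega> a)"
  unfolding V_dual_def by (rule V.subspace_dual_space)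

lemma V_dual_mem:
  "F \<in> V_dual \<Omega> a \<Longrightarrow> G \<in> V_dual \<Omega> a \<Longrightarrow> F + G \<in> V_dual \<Omega> a"
  "F \<in> V_dual \<Omega> a \<Longrightarrow> G \<in> V_dual \<Omega> a \<Longrightarrow> F - G \<in> V_dual \<Omega> a"
  "F \<in> V_dual \<Omega> a \<Longrightarrow> c *\<^sub>R F \<in> V_dual \<Omega> a"
  using subspace_V_dual by (auto intro: subspace_add subspace_diff subspace_scale)

text \<open>Additivity is exact although the Riesz lift is linear only up to seminorm zero:
  \<open>a (R F) (R K)\<close> equals \<open>F (R K)\<close>, an evaluation of F at a fixed
  element.\<close>

lemma semi_inner_space_V_dual: "semi_inner_space (V_dual \<Omega> a) (V_dual_inner \<Omega> a) (V_dual_norm \<Omega> a)"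
proof (rule semi_inner_space.intro)
  show "subspace (V_dual \<Omega> a)" by (rule subspace_V_dual)
  show "V_dual_inner \<Omega> a F G = V_dual_inner \<Omega> a G F" if "F \<in> V_dual \<Omega> a" "G \<in> V_dual \<Omega> a" for F G
    unfolding V_dual_inner_def using that by (intro V.ip_sym riesz_lift)
  show "V_dual_inner \<Omega> a (F + G) K = V_dual_inner \<Omega> a F K + V_dual_inner \<Omega> a G K"
    if "F \<in> V_dual \<Omega> a" "G \<in> V_dual \<Omega> a" "K \<in> V_dual \<Omega> a" for F G K
    unfolding V_dual_inner_def using that riesz_lift(1)[OF that(3)]
    by (simp add: riesz_lift(2) V_dual_mem)
  show "V_dual_inner \<Omega> a (c *\<^sub>R F) K = c * V_dual_inner \<Omega> a F K"
    if "F \<in> V_dual \<Omega> a" "K \<in> V_dual \<Omega> a" for c F K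
    unfolding V_dual_inner_def using that riesz_lift(1)[OF that(2)]
    by (simp add: riesz_lift(2) V_dual_mem)
  show "0 \<le> V_dual_inner \<Omega> a F F" if "F \<in> V_dual \<Omega> a" for F
    unfolding V_dual_inner_def using that by (intro V.ip_nonneg riesz_lift)
  show "V_dual_norm \<Omega> a F = sqrt (V_dual_inner \<Omega> a F F)" for F by (rule V_dual_norm_def)
qed

sublocale V_dual: semi_inner_space "V_dual \<Omega> a" "V_dual_inner \<Omega> a" "V_dual_norm \<Omega> a"
  by (rule semi_inner_space_V_dual)

lemma V_norm_riesz_lift: "V_norm a (R F) = V_dual_norm \<Omega> a F"
  by (simp add: V_norm_def V_dual_norm_def V_dual_inner_def)

lemma riesz_lift_diff:
  assumes "F \<in> V_dual \<Omega> a" "G \<in> V_dual \<Omega> a"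
  shows "V_norm a (R (F - G) - (R F - R G)) = 0"
proof (rule V_norm_eq_0I)
  show "R (F - G) - (R F - R G) \<in> H10 \<Omega>" by (intro V.mem_diff riesz_lift V_dual_mem assms)
  show "a (R (F - G) - (R F - R G)) v = 0" if "v \<in> H10 \<Omega>" for v
    using that assms by (simp add: V.ip_bilinear V.mem riesz_lift V_dual_mem)
qed

text \<open>The isometry on differences is the Lipschitz bound that
  \<open>Bochner_L2_transform\<close> asks of the Riesz lift.\<close>

lemma V_norm_riesz_lift_diff:
  assumes "F \<in> V_dual \<Omega> a" "G \<in> V_dual \<Omega> a"
  shows "V_norm a (R F - R G) = V_dual_norm \<Omega> a (F - G)"
proof -
  have "\<bar>V_norm a (R (F - G)) - V_norm a (R F - R G)\<bar> \<le> V_norm a (R (F - G) - (R F - R G))"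
    by (intro V.N_abs_diff_le V.mem_diff riesz_lift V_dual_mem assms)
  then show ?thesis using riesz_lift_diff[OF assms] by (simp add: V_norm_riesz_lift)
qed

lemma V_dual_bound:
  assumes "F \<in> V_dual \<Omega> a" "v \<in> H10 \<Omega>"
  shows "\<bar>F v\<bar> \<le> V_dual_norm \<Omega> a F * V_norm a v"
  using V.Cauchy_Schwarz[OF riesz_lift(1)[OF assms(1)] assms(2)] riesz_lift(2)[OF assms]
  by (simp add: V_norm_riesz_lift)

end

section \<open>Continuity in time\<close>

text \<open>For \<open>v \<in> W(0,T)\<close>, \<open>nv\<close> is the \<open>V\<close>-norm of \<open>v\<close>, and \<open>\<rho>\<close>, \<open>\<mu>\<close> are primitives of
  \<open>\<parallel>v\<^sub>t\<parallel>\<close> and \<open>\<parallel>v\<^sub>t\<parallel>\<^sup>2 + \<parallel>v\<parallel>\<^sup>2\<close>; \<open>S\<close> is a set of full measure.\<close>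

locale trace_curve = semi_inner_space X ip N
  for X :: "'x::real_vector set" and ip N +
  fixes v :: "real \<Rightarrow> 'x" and nv \<rho> \<mu> :: "real \<Rightarrow> real" and S :: "real set" and T :: real
  assumes curve_mem: "\<And>t. t \<in> S \<Longrightarrow> v t \<in> X"
    and S_subset: "S \<subseteq> {0<..<T}"
    and nv_nonneg: "\<And>t. t \<in> S \<Longrightarrow> 0 \<le> nv t"
    and increment: "\<And>s t r. s \<in> S \<Longrightarrow> t \<in> S \<Longrightarrow> r \<in> S \<Longrightarrow> s < t \<Longrightarrow>
      \<bar>ip (v t - v s) (v r)\<bar> \<le> nv r * (\<rho> t - \<rho> s)"
    and young: "\<And>c s t. 0 \<le> c \<Longrightarrow> 0 \<le> s \<Longrightarrow> s \<le> t \<Longrightarrow> t \<le> T \<Longrightarrow>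
      c * (\<rho> t - \<rho> s) \<le> (c\<^sup>2 * (t - s) + (\<mu> t - \<mu> s)) / 2"
    and good_point: "\<And>s t. 0 \<le> s \<Longrightarrow> s < t \<Longrightarrow> t \<le> T \<Longrightarrow>
      \<exists>r\<in>S. s < r \<and> r < t \<and> (nv r)\<^sup>2 * (t - s) \<le> \<mu> t - \<mu> s"
    and \<rho>_mono: "\<And>s t. 0 \<le> s \<Longrightarrow> s \<le> t \<Longrightarrow> t \<le> T \<Longrightarrow> \<rho> s \<le> \<rho> t"
    and \<mu>_mono: "\<And>s t. 0 \<le> s \<Longrightarrow> s \<le> t \<Longrightarrow> t \<le> T \<Longrightarrow> \<mu> s \<le> \<mu> t"
    and \<rho>_cont: "continuous_on {0..T} \<rho>" and \<mu>_cont: "continuous_on {0..T} \<mu>"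
begin

lemma S_bounds: "t \<in> S \<Longrightarrow> 0 < t" "t \<in> S \<Longrightarrow> t < T"
  using S_subset by auto

text \<open>Young's inequality separates two quantities: interval length times the squared energy
  norm at \<open>w\<close>, which is small at good points, and the energy spent in the
  interval.\<close>

lemma increment_interval:
  assumes "p \<in> S" "q \<in> S" "w \<in> S" "s \<le> p" "p \<le> t" "s \<le> q" "q \<le> t" "0 \<le> s" "t \<le> T"
  shows "\<bar>ip (v p - v q) (v w)\<bar> \<le> ((nv w)\<^sup>2 * (t - s) + (\<mu> t - \<mu> s)) / 2"
proof -
  have ordered: "\<bar>ip (v p - v q) (v w)\<bar> \<le> nv w * (\<rho> t - \<rho> s)"
    if "p \<in> S" "q \<in> S" "s \<le> q" "q < p" "p \<le> t" for p q
  proof -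
    have "\<bar>ip (v p - v q) (v w)\<bar> \<le> nv w * (\<rho> p - \<rho> q)"
      using that assms by (intro increment) auto
    also have "\<dots> \<le> nv w * (\<rho> t - \<rho> s)"
      using that assms \<rho>_mono[of p t] \<rho>_mono[of s q] S_bounds[of p] S_bounds[of q] nv_nonneg
      by (intro mult_left_mono) auto
    finally show ?thesis .
  qed
  have "\<bar>ip (v p - v q) (v w)\<bar> \<le> nv w * (\<rho> t - \<rho> s)"
  proof (cases p q rule: linorder_cases)
    case less
    have "ip (v p - v q) (v w) = - ip (v q - v p) (v w)"
      using assms by (simp add: ip_diff_left curve_mem)
    then show ?thesis using ordered[of q p] less assms by simp
  next
    case equal
    have "0 \<le> nv w * (\<rho> t - \<rho> s)"
      using assms \<rho>_mono[of s t] nv_nonneg by (intro mult_nonneg_nonneg) auto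
    then show ?thesis using equal assms by (simp add: ip_zero_left curve_mem)
  next
    case greater
    then show ?thesis using ordered[of p q] assms by simp
  qed
  also have "\<dots> \<le> ((nv w)\<^sup>2 * (t - s) + (\<mu> t - \<mu> s)) / 2"
    using assms by (intro young nv_nonneg) auto
  finally show ?thesis .
qed

text \<open>Polarisation writes a change of norm through increments tested at the two end points.
  Both are values of the curve, the test elements for which \<open>increment\<close> gives a
  bound.\<close>

lemma N_square_diff:
  assumes "x \<in> X" "y \<in> X"
  shows "(N x)\<^sup>2 - (N y)\<^sup>2 = ip (x - y) x + ip (x - y) y"
  using assms ip_sym[OF assms] by (simp add: N_square ip_diff_left)

text \<open>The point \<open>t\<close> is approached through good points of the dyadic intervals
  \<open>(z (k + 1), z k)\<close>. The increments of \<open>N\<^sup>2\<close> along them telescope, and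
  \<open>v\<close> is weakly continuous at \<open>t\<close> when tested with points of the curve.\<close>

lemma dyadic_estimate:
  assumes t: "t \<in> S" and r: "r \<in> S" "t < r" "r < b" and b: "b \<le> T"
    and good: "(nv r)\<^sup>2 * (b - t) \<le> \<mu> b - \<mu> t"
  shows "(N (v t - v r))\<^sup>2 \<le> 14 * (\<mu> b - \<mu> t)"
proof -
  define L where "L = b - t"
  define M where "M = \<mu> b - \<mu> t"
  have t0: "0 < t" "t < T" using S_bounds[OF t] by auto
  have L: "L > 0" using r by (simp add: L_def)
  have M: "M \<ge> 0" unfolding M_def using \<mu>_mono[of t b] t0 r b by simp
  define z where "z k = t + L / 2 ^ k" for k
  have z0: "z 0 = b" by (simp add: z_def L_def)
  have z_gt: "t < z k" for k using L by (simp add: z_def)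
  have z_step: "z k - z (Suc k) = L / 2 ^ Suc k" for k by (simp add: z_def field_simps)
  have z_dec: "z (Suc k) < z k" for k using z_step[of k] L by (smt (verit) divide_pos_pos zero_less_power)
  have z_le: "z k \<le> b" for k
    by (induction k) (use z0 z_dec less_imp_le order_trans in \<open>auto intro: order_trans[OF less_imp_le[OF z_dec]]\<close>)
  have "\<exists>r\<in>S. z (Suc k) < r \<and> r < z k \<and> (nv r)\<^sup>2 * (z k - z (Suc k)) \<le> \<mu> (z k) - \<mu> (z (Suc k))" for k
    using z_gt[of "Suc k"] t0 z_dec z_le[of k] b by (intro good_point) auto
  then obtain p where p: "\<And>k. p k \<in> S" "\<And>k. z (Suc k) < p k" "\<And>k. p k < z k"
    "\<And>k. (nv (p k))\<^sup>2 * (z k - z (Suc k)) \<le> \<mu> (z k) - \<mu> (z (Suc k))" by metis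
  have p_X: "v (p k) \<in> X" for k by (rule curve_mem[OF p(1)])
  have \<mu>z: "\<mu> (z (Suc k)) \<le> \<mu> (z k)" "\<mu> t \<le> \<mu> (z k)" "\<mu> (z k) \<le> \<mu> b" for k
    using z_gt[of "Suc k"] z_gt[of k] t0 z_dec[of k] z_le[of k] b by (auto intro!: \<mu>_mono)
  have p_ge: "t \<le> p k" "p k \<le> b" for k
    using p(2)[of k] p(3)[of k] z_gt[of "Suc k"] z_le[of k] by auto
  have step: "\<bar>(N (v (p k)))\<^sup>2 - (N (v (p (Suc k))))\<^sup>2\<bar> \<le> 4 * (\<mu> (z k) - \<mu> (z (Suc (Suc k))))" for k
  proof -
    let ?\<Delta> = "\<mu> (z k) - \<mu> (z (Suc (Suc k)))"
    \<comment> \<open>The interval (z (k + 2), z k) holds both \<open>p k\<close> and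
      \<open>p (Suc k)\<close> and is 3/2, respectively 3, times as long as their own dyadic
      intervals. The larger factor gives the common bound by 3 times the energy.\<close>
    have len: "z k - z (Suc (Suc k)) = 3/2 * (z k - z (Suc k))"
      "z k - z (Suc (Suc k)) = 3 * (z (Suc k) - z (Suc (Suc k)))"
      by (simp_all add: z_def field_simps)
    have pos: "z (Suc (Suc k)) \<le> p (Suc k)" "p (Suc k) \<le> z k" "z (Suc (Suc k)) \<le> p k" "p k \<le> z k"
      using p(2,3)[of k] p(2,3)[of "Suc k"] z_dec[of k] z_dec[of "Suc k"] by auto
    have e: "\<bar>ip (v (p k) - v (p (Suc k))) (v w)\<bar> \<le> 2 * ?\<Delta>"
      if w: "w \<in> S" "(nv w)\<^sup>2 * (z k - z (Suc (Suc k))) \<le> 3 * ?\<Delta>" for w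
    proof -
      have "\<bar>ip (v (p k) - v (p (Suc k))) (v w)\<bar> \<le> ((nv w)\<^sup>2 * (z k - z (Suc (Suc k))) + ?\<Delta>) / 2"
        using pos z_gt[of "Suc (Suc k)"] t0 z_le[of k] b
        by (intro increment_interval p w) auto
      then show ?thesis using w(2) by simp
    qed
    have h1: "(nv (p k))\<^sup>2 * (z k - z (Suc (Suc k))) \<le> 3 * ?\<Delta>"
    proof -
      have "(nv (p k))\<^sup>2 * (3/2 * (z k - z (Suc k))) = 3/2 * ((nv (p k))\<^sup>2 * (z k - z (Suc k)))" by simp
      also have "\<dots> \<le> 3/2 * (\<mu> (z k) - \<mu> (z (Suc k)))" by (intro mult_left_mono p) simp
      also have "\<dots> \<le> 3 * ?\<Delta>" using \<mu>z(1)[of "Suc k"] \<mu>z(1)[of k] by simp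
      finally show ?thesis unfolding len(1) .
    qed
    have h2: "(nv (p (Suc k)))\<^sup>2 * (z k - z (Suc (Suc k))) \<le> 3 * ?\<Delta>"
    proof -
      have "(nv (p (Suc k)))\<^sup>2 * (3 * (z (Suc k) - z (Suc (Suc k)))) = 3 * ((nv (p (Suc k)))\<^sup>2 * (z (Suc k) - z (Suc (Suc k))))" by simp
      also have "\<dots> \<le> 3 * (\<mu> (z (Suc k)) - \<mu> (z (Suc (Suc k))))" by (intro mult_left_mono p) simp
      also have "\<dots> \<le> 3 * ?\<Delta>" using \<mu>z(1)[of k] by simp
      finally show ?thesis unfolding len(2) .
    qed
    show ?thesis unfolding N_square_diff[OF p_X p_X] using e[OF p(1) h1] e[OF p(1) h2] by linarith
  qed
  \<comment> \<open>Consecutive intervals overlap, so the sum telescopes with stride two and keeps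
    two terms at each end.\<close>
  have "\<bar>(N (v (p n)))\<^sup>2 - (N (v (p 0)))\<^sup>2\<bar> \<le> 4 * (\<mu> (z 0) + \<mu> (z 1) - \<mu> (z n) - \<mu> (z (Suc n)))" for n
  proof (induction n)
    case (Suc n)
    then show ?case using step[of n] by argo
  qed simp
  then have far: "\<bar>(N (v (p n)))\<^sup>2 - (N (v (p 0)))\<^sup>2\<bar> \<le> 8 * M" for n
    using \<mu>z(2)[of n] \<mu>z(2)[of "Suc n"] \<mu>z(3)[of 0] \<mu>z(3)[of 1] unfolding M_def by (smt (verit))
  have rough: "\<bar>ip (v q - v q') (v w)\<bar> \<le> ((nv w)\<^sup>2 * L + M) / 2"
    if "q \<in> S" "q' \<in> S" "w \<in> S" "t \<le> q" "q \<le> b" "t \<le> q'" "q' \<le> b" for q q' w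
    unfolding L_def M_def using that t0 b by (intro increment_interval) auto
  have r_X: "v r \<in> X" and t_X: "v t \<in> X" by (intro curve_mem r t)+
  have good_r: "(nv r)\<^sup>2 * L \<le> M" using good by (simp add: L_def M_def)
  have good_p0: "(nv (p 0))\<^sup>2 * L \<le> 2 * M"
  proof -
    have "(nv (p 0))\<^sup>2 * (L / 2) \<le> \<mu> (z 0) - \<mu> (z (Suc 0))" using p(4)[of 0] z_step[of 0] by simp
    also have "\<dots> \<le> M" using \<mu>z(2)[of "Suc 0"] z0 by (simp add: M_def)
    finally show ?thesis by simp
  qed
  \<comment> \<open>Transition from the dyadic points to the prescribed good point \<open>r\<close>:
    testing with \<open>p 0\<close> costs 3/2 * M, testing with \<open>r\<close> costs M.\<close>
  have near: "\<bar>(N (v (p 0)))\<^sup>2 - (N (v r))\<^sup>2\<bar> \<le> 5/2 * M"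
  proof -
    note rough0 = rough[OF p(1) r(1) _ p_ge(1)[of 0] p_ge(2)[of 0] less_imp_le[OF r(2)] less_imp_le[OF r(3)]]
    show ?thesis unfolding N_square_diff[OF p_X r_X]
      using good_r good_p0 rough0[OF p(1)[of 0]] rough0[OF r(1)] by argo
  qed
  \<comment> \<open>The constants are 8 from the telescoped norms, 5/2 from the transition and 2
    from the mixed term; their sum is rounded up to 14.\<close>
  have bound: "(N (v (p n) - v r))\<^sup>2 \<le> 14 * M" for n
  proof -
    have "(N (v (p n) - v r))\<^sup>2 = (N (v (p n)))\<^sup>2 - (N (v r))\<^sup>2 - 2 * ip (v (p n) - v r) (v r)"
      using p_X[of n] r_X ip_sym[OF p_X r_X] by (simp add: N_square ip_bilinear mem)
    moreover have "\<bar>ip (v (p n) - v r) (v r)\<bar> \<le> ((nv r)\<^sup>2 * L + M) / 2"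
      using r p_ge[of n] by (intro rough p) auto
    ultimately show ?thesis using far[of n] near good_r M by argo
  qed
  have "(\<lambda>n. L / 2 ^ n) \<longlonglongrightarrow> 0"
    by (rule LIMSEQ_divide_realpow_zero) simp
  then have "(\<lambda>n. t + L / 2 ^ n) \<longlonglongrightarrow> t + 0" by (intro tendsto_add tendsto_const)
  then have z_lim: "z \<longlonglongrightarrow> t" by (simp add: z_def[abs_def])
  have "p \<longlonglongrightarrow> t"
    by (rule tendsto_sandwich[OF always_eventually always_eventually tendsto_const z_lim])
       (use p_ge(1) less_imp_le[OF p(3)] in auto)
  then have "(\<lambda>n. \<rho> (p n)) \<longlonglongrightarrow> \<rho> t"
    using continuous_on_tendsto_compose[OF \<rho>_cont, of p t] t0 p(1) S_bounds
    by (simp add: less_imp_le)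
  then have \<rho>0: "(\<lambda>n. nv w * (\<rho> (p n) - \<rho> t)) \<longlonglongrightarrow> 0" for w
    by (intro tendsto_mult_right_zero) (simp add: LIM_zero)
  have weak: "(\<lambda>n. ip (v (p n) - v t) (v w)) \<longlonglongrightarrow> 0" if "w \<in> S" for w
  proof -
    have b: "norm (ip (v (p n) - v t) (v w)) \<le> nv w * (\<rho> (p n) - \<rho> t)" for n
      using p(2)[of n] z_gt[of "Suc n"] by (simp, intro increment p t that) simp
    show ?thesis by (rule Lim_null_comparison[OF always_eventually[OF allI[OF b]] \<rho>0])
  qed
  define y where "y = v t - v r"
  have y: "y \<in> X" unfolding y_def by (intro mem t_X r_X)
  \<comment> \<open>Weak lower semicontinuity of the norm by hand: the test element \<open>y\<close>
    is a difference of two values of the curve, so \<open>weak\<close> applies to both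
    parts.\<close>
  have "(\<lambda>n. ip (v (p n) - v t) (v t) - ip (v (p n) - v t) (v r) + ip y y) \<longlonglongrightarrow> 0 - 0 + ip y y"
    by (intro tendsto_intros weak t r)
  moreover have "ip (v (p n) - v t) (v t) - ip (v (p n) - v t) (v r) + ip y y = ip (v (p n) - v r) y" for n
    unfolding y_def using p_X[of n] t_X r_X by (simp add: ip_bilinear mem)
  ultimately have "(\<lambda>n. ip (v (p n) - v r) y) \<longlonglongrightarrow> ip y y" by simp
  moreover have "ip (v (p n) - v r) y \<le> sqrt (14 * M) * N y" for n
  proof -
    have pr: "v (p n) - v r \<in> X" by (intro mem p_X r_X)
    have "ip (v (p n) - v r) y \<le> N (v (p n) - v r) * N y" using Cauchy_Schwarz[OF pr y] by linarith
    also have "\<dots> \<le> sqrt (14 * M) * N y"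
      using bound[of n] by (intro mult_right_mono N_nonneg y real_le_rsqrt)
    finally show ?thesis .
  qed
  ultimately have "ip y y \<le> sqrt (14 * M) * N y" by (intro LIMSEQ_le_const2) auto
  then have "N y * N y \<le> sqrt (14 * M) * N y" using N_square[OF y] by (simp add: power2_eq_square)
  then have "N y \<le> sqrt (14 * M)" using N_nonneg[OF y] M by (cases "N y = 0") auto
  then have "(N y)\<^sup>2 \<le> (sqrt (14 * M))\<^sup>2" by (intro power_mono N_nonneg y)
  then show ?thesis using M by (simp add: y_def M_def)
qed

text \<open>Time reversal. The minus signs keep the reversed primitives nondecreasing, so the
  one-sided dyadic estimate becomes available from the left.\<close>

lemma reflection:
  "trace_curve X ip N (\<lambda>t. v (T - t)) (\<lambda>t. nv (T - t)) (\<lambda>t. - \<rho> (T - t)) (\<lambda>t. - \<mu> (T - t)) ((-) T -` S) T"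
proof (intro trace_curve.intro semi_inner_space_axioms trace_curve_axioms.intro)
  fix s t r assume "s \<in> (-) T -` S" "t \<in> (-) T -` S" "r \<in> (-) T -` S" "s < t"
  then have "\<bar>ip (v (T - s) - v (T - t)) (v (T - r))\<bar> \<le> nv (T - r) * (\<rho> (T - s) - \<rho> (T - t))"
    by (intro increment) auto
  moreover have "ip (v (T - t) - v (T - s)) (v (T - r)) = - ip (v (T - s) - v (T - t)) (v (T - r))"
    using \<open>s \<in> _\<close> \<open>t \<in> _\<close> \<open>r \<in> _\<close> by (simp add: ip_diff_left curve_mem)
  ultimately show "\<bar>ip (v (T - t) - v (T - s)) (v (T - r))\<bar> \<le> nv (T - r) * (- \<rho> (T - t) - - \<rho> (T - s))" by simp
next
  fix c s t :: real assume "0 \<le> c" "0 \<le> s" "s \<le> t" "t \<le> T"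
  then show "c * (- \<rho> (T - t) - - \<rho> (T - s)) \<le> (c\<^sup>2 * (t - s) + (- \<mu> (T - t) - - \<mu> (T - s))) / 2"
    using young[of c "T - t" "T - s"] by simp
next
  fix s t :: real assume "0 \<le> s" "s < t" "t \<le> T"
  then have "\<exists>r\<in>S. T - t < r \<and> r < T - s \<and> (nv r)\<^sup>2 * (T - s - (T - t)) \<le> \<mu> (T - s) - \<mu> (T - t)"
    by (intro good_point) auto
  then obtain r where "r \<in> S" "T - t < r" "r < T - s" "(nv r)\<^sup>2 * (T - s - (T - t)) \<le> \<mu> (T - s) - \<mu> (T - t)" by blast
  then show "\<exists>r\<in>(-) T -` S. s < r \<and> r < t \<and> (nv (T - r))\<^sup>2 * (t - s) \<le> - \<mu> (T - t) - - \<mu> (T - s)"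
    by (intro bexI[of _ "T - r"]) auto
next
  have c: "continuous_on {0..T} (\<lambda>t. f (T - t))" if "continuous_on {0..T} f" for f :: "real \<Rightarrow> real"
    by (rule continuous_on_compose2[OF that]) (auto intro!: continuous_intros)
  show "continuous_on {0..T} (\<lambda>t. - \<rho> (T - t))" "continuous_on {0..T} (\<lambda>t. - \<mu> (T - t))"
    by (intro continuous_on_minus c \<rho>_cont \<mu>_cont)+
next
  show "(-) T -` S \<subseteq> {0<..<T}" using S_bounds by fastforce
qed (auto intro: curve_mem nv_nonneg \<rho>_mono \<mu>_mono)

text \<open>A good point \<open>r\<close> between the times is compared with s by the dyadic
  estimate and with t by its reflection. The triangle inequality doubles sqrt (14 * M), and 56 = 4 *
  14.\<close>

lemma modulus_of_continuity:
  assumes s: "s \<in> S" and t: "t \<in> S" and "s < t"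
  shows "(N (v s - v t))\<^sup>2 \<le> 56 * (\<mu> t - \<mu> s)"
proof -
  define M where "M = \<mu> t - \<mu> s"
  have M: "M \<ge> 0" unfolding M_def using \<mu>_mono[of s t] S_bounds[OF s] S_bounds[OF t] \<open>s < t\<close> by simp
  obtain r where r: "r \<in> S" "s < r" "r < t" "(nv r)\<^sup>2 * (t - s) \<le> \<mu> t - \<mu> s"
    using good_point[of s t] S_bounds[OF s] S_bounds[OF t] \<open>s < t\<close> by auto
  have 1: "(N (v s - v r))\<^sup>2 \<le> 14 * M"
    unfolding M_def using S_bounds[OF t] by (intro dyadic_estimate s r) auto
  interpret rev: trace_curve X ip N "\<lambda>t. v (T - t)" "\<lambda>t. nv (T - t)" "\<lambda>t. - \<rho> (T - t)" "\<lambda>t. - \<mu> (T - t)" "(-) T -` S" T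
    by (rule reflection)
  have "(N (v (T - (T - t)) - v (T - (T - r))))\<^sup>2 \<le> 14 * (- \<mu> (T - (T - s)) - - \<mu> (T - (T - t)))"
    using s t r S_bounds[OF s] by (intro rev.dyadic_estimate) auto
  then have 2: "(N (v t - v r))\<^sup>2 \<le> 14 * M" by (simp add: M_def)
  have X: "v s \<in> X" "v t \<in> X" "v r \<in> X" by (intro curve_mem s t r)+
  have "N (v s - v t) \<le> N (v s - v r) + N (v r - v t)" by (intro N_triangle_diff X)
  also have "N (v r - v t) = N (v t - v r)" by (intro N_minus_commute X)
  also have "N (v s - v r) + N (v t - v r) \<le> sqrt (14 * M) + sqrt (14 * M)"
    using 1 2 by (intro add_mono real_le_rsqrt)
  finally have "(N (v s - v t))\<^sup>2 \<le> (2 * sqrt (14 * M))\<^sup>2"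
    by (intro power_mono N_nonneg mem X) simp
  then show ?thesis using M by (simp add: M_def power_mult_distrib)
qed

lemma modulus_of_continuity_abs:
  assumes "s \<in> S" "t \<in> S"
  shows "N (v s - v t) \<le> sqrt (56 * \<bar>\<mu> t - \<mu> s\<bar>)"
proof (cases s t rule: linorder_cases)
  case less
  then show ?thesis using modulus_of_continuity[OF assms less] abs_ge_self[of "\<mu> t - \<mu> s"]
    by (intro real_le_rsqrt) argo
next
  case equal
  then show ?thesis by (simp add: N_zero)
next
  case greater
  have eq: "N (v s - v t) = N (v t - v s)" using assms by (intro N_minus_commute curve_mem)
  show ?thesis
    unfolding eq using modulus_of_continuity[OF assms(2,1) greater] abs_ge_minus_self[of "\<mu> t - \<mu> s"]
    by (intro real_le_rsqrt) argo
qed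

text \<open>Every subinterval contains a good point; the windows around \<open>s\<close> are clipped
  to [0, T] so that the end points are reached too.\<close>

lemma S_dense:
  assumes "s \<in> {0..T}" "T > 0"
  obtains p where "\<And>k::nat. p k \<in> S" "p \<longlonglongrightarrow> s"
proof -
  have "\<exists>r\<in>S. \<bar>r - s\<bar> \<le> T / Suc k" for k :: nat
  proof -
    have pos: "T / Suc k > 0" "T / Suc k \<le> T" using assms(2) by (auto simp: field_simps)
    obtain r where "r \<in> S" "max 0 (s - T / Suc k) < r" "r < min T (s + T / Suc k)"
      using good_point[of "max 0 (s - T / Suc k)" "min T (s + T / Suc k)"] assms pos by auto
    then show ?thesis by (intro bexI[of _ r]) auto
  qed
  then obtain p where p: "\<And>k. p k \<in> S" "\<And>k. norm (p k - s) \<le> T / real (Suc k)"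
    unfolding real_norm_def by metis
  have "(\<lambda>k. T / real (Suc k)) \<longlonglongrightarrow> 0" by (rule LIMSEQ_Suc[OF lim_const_over_n])
  then have "(\<lambda>k. p k - s) \<longlonglongrightarrow> 0"
    by (rule Lim_null_comparison[OF always_eventually[OF allI[OF p(2)]]])
  then show ?thesis using that[OF p(1)] by (simp add: LIM_zero_iff)
qed

lemma \<mu>_tendsto: "(\<And>k. p k \<in> S) \<Longrightarrow> p \<longlonglongrightarrow> s \<Longrightarrow> s \<in> {0..T} \<Longrightarrow> (\<lambda>k. \<mu> (p k)) \<longlonglongrightarrow> \<mu> s"
  using continuous_on_tendsto_compose[OF \<mu>_cont, of p s] S_bounds by (simp add: less_imp_le)

text \<open>Extension of a uniformly continuous map from a dense set. The estimate against every
  point of \<open>S\<close> is part of the choice at each time, so approximating sequences at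
  different times never have to be matched.\<close>

lemma extension:
  assumes complete: complete_seminorm and T: "T > 0"
  obtains u where "\<And>s. s \<in> {0..T} \<Longrightarrow> u s \<in> X"
    "\<And>s t. s \<in> {0..T} \<Longrightarrow> t \<in> S \<Longrightarrow> N (u s - v t) \<le> sqrt (56 * \<bar>\<mu> s - \<mu> t\<bar>)"
    "\<And>s t. s \<in> {0..T} \<Longrightarrow> t \<in> {0..T} \<Longrightarrow> N (u s - u t) \<le> sqrt (56 * \<bar>\<mu> s - \<mu> t\<bar>)"
proof -
  have "\<exists>l\<in>X. \<forall>t\<in>S. N (l - v t) \<le> sqrt (56 * \<bar>\<mu> s - \<mu> t\<bar>)" if s: "s \<in> {0..T}" for s
  proof -
    obtain p where p: "\<And>k. p k \<in> S" "p \<longlonglongrightarrow> s" using S_dense[OF s T] by blast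
    have p_X: "v (p k) \<in> X" for k by (rule curve_mem[OF p(1)])
    note \<mu>p = \<mu>_tendsto[OF p s]
    have "\<exists>l\<in>X. (\<lambda>k. N (v (p k) - l)) \<longlonglongrightarrow> 0"
    proof (rule complete[unfolded complete_seminorm_def, rule_format])
      show "v (p k) \<in> X" for k by (rule p_X)
      fix \<epsilon> :: real assume "\<epsilon> > 0"
      then have "\<epsilon>\<^sup>2 / 56 > 0" by simp
      then obtain k0 where k0: "\<And>j k. j \<ge> k0 \<Longrightarrow> k \<ge> k0 \<Longrightarrow> dist (\<mu> (p j)) (\<mu> (p k)) < \<epsilon>\<^sup>2 / 56"
        using LIMSEQ_imp_Cauchy[OF \<mu>p] unfolding Cauchy_def by blast
      have "N (v (p j) - v (p k)) < \<epsilon>" if "j \<ge> k0" "k \<ge> k0" for j k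
      proof -
        have "56 * \<bar>\<mu> (p k) - \<mu> (p j)\<bar> < \<epsilon>\<^sup>2" using k0[OF that] by (simp add: dist_real_def abs_minus_commute)
        then have "sqrt (56 * \<bar>\<mu> (p k) - \<mu> (p j)\<bar>) < \<epsilon>"
          using \<open>\<epsilon> > 0\<close> by (intro real_less_lsqrt) auto
        then show ?thesis using modulus_of_continuity_abs[OF p(1) p(1), of j k] by linarith
      qed
      then show "\<exists>k0. \<forall>j\<ge>k0. \<forall>k\<ge>k0. N (v (p j) - v (p k)) < \<epsilon>" by blast
    qed
    then obtain l where l: "l \<in> X" "(\<lambda>k. N (v (p k) - l)) \<longlonglongrightarrow> 0" by blast
    have "N (l - v t) \<le> sqrt (56 * \<bar>\<mu> s - \<mu> t\<bar>)" if t: "t \<in> S" for t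
    proof -
      have "N (l - v t) \<le> N (v (p k) - l) + sqrt (56 * \<bar>\<mu> (p k) - \<mu> t\<bar>)" for k
        using N_triangle_diff[OF l(1) p_X[of k] curve_mem[OF t]] N_minus_commute[OF l(1) p_X[of k]]
          modulus_of_continuity_abs[OF p(1)[of k] t] by (simp add: abs_minus_commute)
      moreover have "(\<lambda>k. N (v (p k) - l) + sqrt (56 * \<bar>\<mu> (p k) - \<mu> t\<bar>)) \<longlonglongrightarrow> 0 + sqrt (56 * \<bar>\<mu> s - \<mu> t\<bar>)"
        by (intro tendsto_add l tendsto_real_sqrt tendsto_mult tendsto_rabs tendsto_diff tendsto_const \<mu>p)
      ultimately show ?thesis by (intro LIMSEQ_le_const[of _ "sqrt (56 * \<bar>\<mu> s - \<mu> t\<bar>)"]) auto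
    qed
    then show ?thesis using l(1) by blast
  qed
  then obtain u where u: "\<And>s. s \<in> {0..T} \<Longrightarrow> u s \<in> X"
    "\<And>s t. s \<in> {0..T} \<Longrightarrow> t \<in> S \<Longrightarrow> N (u s - v t) \<le> sqrt (56 * \<bar>\<mu> s - \<mu> t\<bar>)"
    by metis
  have "N (u s - u t) \<le> sqrt (56 * \<bar>\<mu> s - \<mu> t\<bar>)" if s: "s \<in> {0..T}" and t: "t \<in> {0..T}" for s t
  proof -
    obtain p where p: "\<And>k. p k \<in> S" "p \<longlonglongrightarrow> t" using S_dense[OF t T] by blast
    have "N (u s - u t) \<le> sqrt (56 * \<bar>\<mu> s - \<mu> (p k)\<bar>) + sqrt (56 * \<bar>\<mu> t - \<mu> (p k)\<bar>)" for k
      using N_triangle_diff[OF u(1)[OF s] curve_mem[OF p(1)[of k]] u(1)[OF t]]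
        N_minus_commute[OF u(1)[OF t] curve_mem[OF p(1)[of k]]] u(2)[OF s p(1)[of k]] u(2)[OF t p(1)[of k]]
      by linarith
    moreover have "(\<lambda>k. sqrt (56 * \<bar>\<mu> s - \<mu> (p k)\<bar>) + sqrt (56 * \<bar>\<mu> t - \<mu> (p k)\<bar>))
        \<longlonglongrightarrow> sqrt (56 * \<bar>\<mu> s - \<mu> t\<bar>) + sqrt (56 * \<bar>\<mu> t - \<mu> t\<bar>)"
      by (intro tendsto_add tendsto_real_sqrt tendsto_mult tendsto_rabs tendsto_diff tendsto_const \<mu>_tendsto[OF p t])
    ultimately show ?thesis by (intro LIMSEQ_le_const[of _ "sqrt (56 * \<bar>\<mu> s - \<mu> t\<bar>)"]) auto
  qed
  with u show ?thesis using that by blast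
qed

end

text \<open>The running time appears only in an indicator over the fixed interval. This is the form
  delivered by \<open>weak_derivative_imp_indefinite_integral\<close>, and it lets dominated
  convergence give continuity.\<close>

definition primitive :: "real \<Rightarrow> (real \<Rightarrow> real) \<Rightarrow> real \<Rightarrow> real" where
  "primitive T k t = (LINT s|lebesgue_on {0<..<T}. indicator {..<t} s * k s)"

context
  fixes T :: real and k :: "real \<Rightarrow> real"
  assumes k: "integrable (lebesgue_on {0<..<T}) k"
begin

lemma indicator_Iio_measurable: "indicator {..<t} \<in> borel_measurable (lebesgue_on {0<..<T})" for t :: real
  by (rule measurable_restrict_space1, rule measurable_completion, rule borel_measurable_indicator) simp

lemma primitive_integrable: "integrable (lebesgue_on {0<..<T}) (\<lambda>s. indicator {..<t} s * k s)"
proof (rule Bochner_Integration.integrable_bound[OF k])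
  show "(\<lambda>s. indicator {..<t} s * k s) \<in> borel_measurable (lebesgue_on {0<..<T})"
    by (intro borel_measurable_times indicator_Iio_measurable borel_measurable_integrable[OF k])
qed (auto intro!: AE_I2 simp: indicator_def)

lemma primitive_diff:
  assumes "s \<le> t"
  shows "primitive T k t - primitive T k s = (LINT r|lebesgue_on {0<..<T}. indicator {s..<t} r * k r)"
    and "integrable (lebesgue_on {0<..<T}) (\<lambda>r. indicator {s..<t} r * k r)"
proof -
  have eq: "(\<lambda>r. indicator {s..<t} r * k r) = (\<lambda>r. indicator {..<t} r * k r - indicator {..<s} r * k r)"
    using assms by (auto simp: fun_eq_iff indicator_def)
  show "primitive T k t - primitive T k s = (LINT r|lebesgue_on {0<..<T}. indicator {s..<t} r * k r)"
    unfolding primitive_def eq by (rule Bochner_Integration.integral_diff[symmetric]) (rule primitive_integrable)+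
  show "integrable (lebesgue_on {0<..<T}) (\<lambda>r. indicator {s..<t} r * k r)"
    unfolding eq by (intro Bochner_Integration.integrable_diff primitive_integrable)
qed

lemma primitive_continuous: "continuous_on A (primitive T k)"
proof -
  have "(\<lambda>n. primitive T k (x n)) \<longlonglongrightarrow> primitive T k t" if x: "x \<longlonglongrightarrow> t" for x :: "nat \<Rightarrow> real" and t
    unfolding primitive_def
  proof (rule integral_dominated_convergence[where w = "\<lambda>s. \<bar>k s\<bar>"])
    show "(\<lambda>s. indicator {..<t} s * k s) \<in> borel_measurable (lebesgue_on {0<..<T})"
      "(\<lambda>s. indicator {..<x n} s * k s) \<in> borel_measurable (lebesgue_on {0<..<T})" for n
      using borel_measurable_integrable[OF primitive_integrable] by auto
    show "integrable (lebesgue_on {0<..<T}) (\<lambda>s. \<bar>k s\<bar>)" using k by (rule integrable_abs)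
    have "AE s in lebesgue_on {0<..<T}. s \<noteq> t"
      by (subst AE_restrict_space_iff) (auto intro!: AE_completion eventually_mono[OF AE_lborel_singleton[of t]])
    then show "AE s in lebesgue_on {0<..<T}. (\<lambda>n. indicator {..<x n} s * k s) \<longlonglongrightarrow> indicator {..<t} s * k s"
    proof eventually_elim
      case (elim s)
      have "\<forall>\<^sub>F n in sequentially. indicator {..<t} s * k s = indicator {..<x n} s * k s"
      proof (cases "s < t")
        case True
        from order_tendstoD(1)[OF x True] show ?thesis by (rule eventually_mono) (use True in simp)
      next
        case False
        then have "t < s" using elim by simp
        from order_tendstoD(2)[OF x this] show ?thesis by (rule eventually_mono) (use False in simp)
      qed
      then show ?case by (rule Lim_transform_eventually[OF tendsto_const])
    qed
    show "AE s in lebesgue_on {0<..<T}. norm (indicator {..<x n} s * k s) \<le> \<bar>k s\<bar>" for n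
      by (auto intro!: AE_I2 simp: indicator_def)
  qed
  then show ?thesis
    by (intro continuous_at_imp_continuous_on ballI) (simp add: continuous_at_sequentially comp_def)
qed

lemma primitive_mono:
  assumes "AE t in lebesgue_on {0<..<T}. 0 \<le> k t" "s \<le> t"
  shows "primitive T k s \<le> primitive T k t"
proof -
  have "0 \<le> (LINT r|lebesgue_on {0<..<T}. indicator {s..<t} r * k r)"
    by (rule integral_nonneg_AE) (use assms(1) in \<open>auto elim!: eventually_mono\<close>)
  then show ?thesis using primitive_diff(1)[OF assms(2)] by simp
qed

lemma primitive_total: "primitive T k T - primitive T k 0 = (LINT t|lebesgue_on {0<..<T}. k t)"
proof -
  have "primitive T k T = (LINT t|lebesgue_on {0<..<T}. k t)"
    unfolding primitive_def by (intro Bochner_Integration.integral_cong) auto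
  moreover have "primitive T k 0 = (LINT t|lebesgue_on {0<..<T}. 0)"
    unfolding primitive_def by (intro Bochner_Integration.integral_cong) auto
  ultimately show ?thesis by simp
qed

end

lemma integral_indicator_Ico:
  fixes s t T c :: real
  assumes "0 \<le> s" "s \<le> t" "t \<le> T"
  shows "(LINT r|lebesgue_on {0<..<T}. indicator {s..<t} r * c) = c * (t - s)"
proof -
  have "(LINT r|lebesgue_on {0<..<T}. indicator {s..<t} r * c) = (LINT r|lebesgue. indicator ({s..<t} \<inter> {0<..<T}) r * c)"
  proof (subst integral_restrict_space)
    show "(LINT r|lebesgue. indicator {0<..<T} r *\<^sub>R (indicator {s..<t} r * c)) = (LINT r|lebesgue. indicator ({s..<t} \<inter> {0<..<T}) r * c)"
      by (intro Bochner_Integration.integral_cong) (simp_all only: indicator_inter_arith real_scaleR_def mult_ac)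
  qed simp
  also have "\<dots> = (LINT r|lebesgue. indicator {s..<t} r * c)"
  proof (rule integral_cong_AE)
    \<comment> \<open>For s = 0 the point 0 lies in {s..<t} but not in the open interval.\<close>
    have "AE r in lebesgue. r \<noteq> 0" by (rule AE_completion[OF AE_lborel_singleton])
    then show "AE r in lebesgue. indicator ({s..<t} \<inter> {0<..<T}) r * c = indicator {s..<t} r * c"
      by (rule eventually_mono) (use assms in \<open>auto simp: indicator_def\<close>)
  qed (auto intro!: borel_measurable_times borel_measurable_indicator)
  also have "\<dots> = c * (t - s)" using assms by simp
  finally show ?thesis .
qed

lemma AE_lebesgue_on_neq: "AE t in lebesgue_on {a<..<b::real}. t \<noteq> c"
proof -
  have "AE t in lebesgue. t \<noteq> c" by (rule AE_completion[OF AE_lborel_singleton])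
  then show ?thesis by (subst AE_restrict_space_iff) (auto elim: eventually_mono)
qed

section \<open>Bochner spaces over V and the duality pairing\<close>

locale parabolic = energy_space \<Omega> a for \<Omega> :: "'a::euclidean_space set" and a :: "'a form" +
  fixes T :: real
  assumes T_pos: "T > 0"
begin

abbreviation M where "M \<equiv> lebesgue_on {0<..<T}"

sublocale L2V: semi_inner_space "L2V \<Omega> a T" "L2V_inner a T" "L2V_norm a T"
proof -
  have "L2V_inner a T = (\<lambda>u v. LINT t|M. a (u t) (v t))"
    "L2V_norm a T = (\<lambda>v. sqrt (LINT t|M. a (v t) (v t)))"
    by (auto simp: fun_eq_iff L2V_inner_def L2V_norm_def)
  then show "semi_inner_space (L2V \<Omega> a T) (L2V_inner a T) (L2V_norm a T)"
    using V.semi_inner_space_Bochner_L2 by simp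
qed

lemma semi_inner_space_H: "semi_inner_space (H10 \<Omega>) (L2_inner \<Omega>) (L2_norm \<Omega>)"
  by (rule L2.restrict[OF subspace_H10]) (use H10_L2 in blast)

sublocale H: semi_inner_space "H10 \<Omega>" "L2_inner \<Omega>" "L2_norm \<Omega>"
  by (rule semi_inner_space_H)

text \<open>Strong measurability depends on the seminorm, so it has to be carried over as well; the
  embedding of V into H is treated as a Lipschitz map.\<close>

lemma L2V_L2H:
  assumes "v \<in> L2V \<Omega> a T"
  shows "v \<in> Bochner_L2 T (H10 \<Omega>) (L2_norm \<Omega>)"
proof -
  obtain C where "C > 0" "\<And>u. u \<in> H10 \<Omega> \<Longrightarrow> L2_norm \<Omega> u \<le> C * V_norm a u" by (rule L2_norm_le_V_norm) blast
  then show ?thesis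
    using V.Bochner_L2_transform[OF semi_inner_space_H assms, where f = "\<lambda>x. x" and C = C] by (simp add: V.mem_diff)
qed

text \<open>The scalar product in which \<open>L2_projection\<close> is orthogonal, restricted to
  V-valued functions.\<close>

lemma semi_inner_space_L2H: "semi_inner_space (L2V \<Omega> a T) (L2H_inner \<Omega> T) (\<lambda>v. sqrt (L2H_inner \<Omega> T v v))"
proof -
  have "L2H_inner \<Omega> T = (\<lambda>u v. LINT t|M. L2_inner \<Omega> (u t) (v t))"
    by (auto simp: fun_eq_iff L2H_inner_def)
  then have "semi_inner_space (Bochner_L2 T (H10 \<Omega>) (L2_norm \<Omega>)) (L2H_inner \<Omega> T) (\<lambda>v. sqrt (L2H_inner \<Omega> T v v))"
    using H.semi_inner_space_Bochner_L2 by simp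
  then show ?thesis
    using semi_inner_space.restrict[OF _ L2V.subspace] L2V_L2H by blast
qed

lemma L2V_norm_eq_0I:
  assumes "v \<in> L2V \<Omega> a T" "AE t in M. V_norm a (v t) = 0"
  shows "L2V_norm a T v = 0"
proof -
  have "(LINT t|M. a (v t) (v t)) = (LINT t|M. 0)"
  proof (rule integral_cong_AE)
    show "AE t in M. a (v t) (v t) = 0"
      using assms(2) V.Bochner_L2D(2)[OF assms(1)]
      by eventually_elim (metis V.N_square power_zero_numeral)
  qed (auto intro: V.Bochner_L2_ip_measurable assms)
  then show ?thesis by (simp add: L2V_norm_def L2V_inner_def)
qed

lemma riesz_L2V:
  assumes "g \<in> L2V_dual \<Omega> a T"
  shows "(\<lambda>t. R (g t)) \<in> L2V \<Omega> a T"
  by (rule V_dual.Bochner_L2_transform[OF semi_inner_space_V assms, where C = 1])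
     (auto simp: riesz_lift V_norm_riesz_lift_diff V_norm_riesz_lift)

lemma L2V_dual_AE: "g \<in> L2V_dual \<Omega> a T \<Longrightarrow> AE t in M. g t \<in> V_dual \<Omega> a"
  by (rule V_dual.Bochner_L2D(2))

lemma pairing_AE:
  assumes "g \<in> L2V_dual \<Omega> a T" "v \<in> L2V \<Omega> a T"
  shows "AE t in M. a (R (g t)) (v t) = g t (v t)"
  using L2V_dual_AE[OF assms(1)] V.Bochner_L2D(2)[OF assms(2)]
  by eventually_elim (rule riesz_lift)

lemma pairing_integrable:
  assumes "g \<in> L2V_dual \<Omega> a T" "v \<in> L2V \<Omega> a T"
  shows "integrable M (\<lambda>t. g t (v t))"
  using V.Bochner_L2_ip_integrable[OF riesz_L2V[OF assms(1)] assms(2)]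
    borel_measurable_lebesgue_on_AE[OF sets_lebesgue_Ioo V.Bochner_L2_ip_measurable[OF riesz_L2V[OF assms(1)] assms(2)] pairing_AE[OF assms]]
    pairing_AE[OF assms]
  by (rule integrable_cong_AE_imp)

text \<open>Gives pairings the Cauchy-Schwarz inequality of \<open>L2V\<close>; \<open>b_hat\<close>
  is treated through it.\<close>

lemma dual_pairing_eq:
  assumes "g \<in> L2V_dual \<Omega> a T" "v \<in> L2V \<Omega> a T"
  shows "dual_pairing T g v = L2V_inner a T (\<lambda>t. R (g t)) v"
  unfolding dual_pairing_def L2V_inner_def
proof (rule integral_cong_AE)
  show "AE t in M. g t (v t) = a (R (g t)) (v t)"
    using pairing_AE[OF assms] by eventually_elim simp
  show "(\<lambda>t. g t (v t)) \<in> borel_measurable M"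
    by (rule borel_measurable_integrable[OF pairing_integrable[OF assms]])
  show "(\<lambda>t. a (R (g t)) (v t)) \<in> borel_measurable M"
    by (rule V.Bochner_L2_ip_measurable[OF riesz_L2V[OF assms(1)] assms(2)])
qed

lemma pairing_const_integrable:
  assumes "g \<in> L2V_dual \<Omega> a T" "\<eta> \<in> H10 \<Omega>"
  shows "integrable M (\<lambda>t. g t \<eta>)"
  by (rule pairing_integrable[OF assms(1) V.Bochner_L2_const[OF assms(2)]])

lemma L2_inner_const_integrable:
  assumes "v \<in> L2V \<Omega> a T" "\<eta> \<in> H10 \<Omega>"
  shows "integrable M (\<lambda>t. L2_inner \<Omega> (v t) \<eta>)"
  by (rule H.Bochner_L2_ip_integrable[OF L2V_L2H[OF assms(1)] H.Bochner_L2_const[OF assms(2)]])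

text \<open>For fixed \<eta> the fundamental lemma gives equality outside a null set that depends on
  \<eta>. Countably many test elements approximating the lifts of g t - h t suffice to recover the
  dual norm.\<close>

lemma weak_time_deriv_unique:
  assumes g: "g \<in> L2V_dual \<Omega> a T" "has_weak_time_deriv \<Omega> T v g"
    and h: "h \<in> L2V_dual \<Omega> a T" "has_weak_time_deriv \<Omega> T v h"
  shows "AE t in M. V_dual_norm \<Omega> a (g t - h t) = 0"
proof -
  have d: "(\<lambda>t. g t - h t) \<in> L2V_dual \<Omega> a T"
    using subspace_diff[OF V_dual.subspace_Bochner_L2 g(1) h(1)] by (simp add: fun_diff_def)
  have eq: "AE t in M. g t \<eta> - h t \<eta> = 0" if \<eta>: "\<eta> \<in> H10 \<Omega>" for \<eta>
  proof (rule fundamental_lemma)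
    note ig = pairing_const_integrable[OF g(1) \<eta>] and ih = pairing_const_integrable[OF h(1) \<eta>]
    show "integrable M (\<lambda>t. g t \<eta> - h t \<eta>)" using ig ih by (rule Bochner_Integration.integrable_diff)
    fix \<phi> :: "real \<Rightarrow> real" assume \<phi>: "\<phi> \<in> test_functions {0<..<T}"
    have "(LINT t|M. L2_inner \<Omega> (v t) \<eta> * deriv \<phi> t) = - (LINT t|M. g t \<eta> * \<phi> t)"
      "(LINT t|M. L2_inner \<Omega> (v t) \<eta> * deriv \<phi> t) = - (LINT t|M. h t \<eta> * \<phi> t)"
      using g(2) h(2) \<eta> \<phi> unfolding has_weak_time_deriv_def by blast+
    then have "(LINT t|M. g t \<eta> * \<phi> t) = (LINT t|M. h t \<eta> * \<phi> t)" by linarith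
    then show "(LINT t|M. (g t \<eta> - h t \<eta>) * \<phi> t) = 0"
      using integrable_test_function_mult[OF ig \<phi>] integrable_test_function_mult[OF ih \<phi>]
      by (simp add: left_diff_distrib)
  qed simp
  obtain D where D: "countable D" "D \<subseteq> H10 \<Omega>"
    "AE t in M. \<exists>s. (\<forall>k. s k \<in> D) \<and> (\<lambda>k::nat. V_norm a (s k - R (g t - h t))) \<longlonglongrightarrow> 0"
    by (rule V.strongly_measurable_separable[OF V.Bochner_L2D(1)[OF riesz_L2V[OF d]]]) blast
  have "AE t in M. \<forall>\<eta>\<in>D. g t \<eta> - h t \<eta> = 0"
    unfolding AE_ball_countable[OF D(1)] using eq D(2) by blast
  then show ?thesis
    using D(3) L2V_dual_AE[OF d]
  proof eventually_elim
    case (elim t)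
    obtain s where s: "\<And>k. s k \<in> D" "(\<lambda>k::nat. V_norm a (s k - R (g t - h t))) \<longlonglongrightarrow> 0" using elim(2) by blast
    have s_H10: "s k \<in> H10 \<Omega>" for k using s(1) D(2) by blast
    note r = riesz_lift(1)[OF elim(3)]
    have "a (R (g t - h t)) (s k) = 0" for k
      using riesz_lift(2)[OF elim(3) s_H10] elim(1) s(1)[of k] by simp
    moreover have "(\<lambda>k. a (R (g t - h t)) (s k)) \<longlonglongrightarrow> a (R (g t - h t)) (R (g t - h t))"
      by (rule V.tendsto_ip[OF r r _ s_H10 r s(2)]) (simp add: V.N_zero)
    ultimately have "a (R (g t - h t)) (R (g t - h t)) = 0" by (simp add: LIMSEQ_const_iff)
    then show ?case by (simp add: V_dual_norm_def V_dual_inner_def)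
  qed
qed

section \<open>The space W(0,T) as a semi-inner product space\<close>

abbreviation W where "W \<equiv> W_space \<Omega> a T"
abbreviation "td \<equiv> time_deriv \<Omega> a T"

lemma W_L2V: "v \<in> W \<Longrightarrow> v \<in> L2V \<Omega> a T"
  by (simp add: W_space_def)

lemma time_deriv:
  assumes "v \<in> W"
  shows "td v \<in> L2V_dual \<Omega> a T" "has_weak_time_deriv \<Omega> T v (td v)"
proof -
  have "\<exists>g. g \<in> L2V_dual \<Omega> a T \<and> has_weak_time_deriv \<Omega> T v g" using assms unfolding W_space_def by blast
  then have "td v \<in> L2V_dual \<Omega> a T \<and> has_weak_time_deriv \<Omega> T v (td v)"
    unfolding time_deriv_def by (rule someI_ex)
  then show "td v \<in> L2V_dual \<Omega> a T" "has_weak_time_deriv \<Omega> T v (td v)" by auto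
qed

lemma WI: "v \<in> L2V \<Omega> a T \<Longrightarrow> g \<in> L2V_dual \<Omega> a T \<Longrightarrow> has_weak_time_deriv \<Omega> T v g \<Longrightarrow> v \<in> W"
  unfolding W_space_def by blast

lemma has_weak_time_deriv_linear:
  assumes u: "u \<in> L2V \<Omega> a T" "g \<in> L2V_dual \<Omega> a T" "has_weak_time_deriv \<Omega> T u g"
    and v: "v \<in> L2V \<Omega> a T" "h \<in> L2V_dual \<Omega> a T" "has_weak_time_deriv \<Omega> T v h"
  shows "has_weak_time_deriv \<Omega> T (u + c *\<^sub>R v) (g + c *\<^sub>R h)"
  unfolding has_weak_time_deriv_def
proof (intro ballI)
  fix \<eta> \<phi> assume \<eta>: "\<eta> \<in> H10 \<Omega>" and \<phi>: "\<phi> \<in> test_functions {0<..<T}"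
  note ints = integrable_test_function_mult[OF L2_inner_const_integrable[OF u(1) \<eta>] test_function_deriv[OF \<phi>]]
    integrable_test_function_mult[OF L2_inner_const_integrable[OF v(1) \<eta>] test_function_deriv[OF \<phi>]]
    integrable_test_function_mult[OF pairing_const_integrable[OF u(2) \<eta>] \<phi>]
    integrable_test_function_mult[OF pairing_const_integrable[OF v(2) \<eta>] \<phi>]
  have uv: "u + c *\<^sub>R v \<in> L2V \<Omega> a T" by (intro L2V.mem u v)
  have "(LINT t|M. L2_inner \<Omega> ((u + c *\<^sub>R v) t) \<eta> * deriv \<phi> t) =
      (LINT t|M. L2_inner \<Omega> (u t) \<eta> * deriv \<phi> t + c * (L2_inner \<Omega> (v t) \<eta> * deriv \<phi> t))"
  proof (rule integral_cong_AE)
    show "AE t in M. L2_inner \<Omega> ((u + c *\<^sub>R v) t) \<eta> * deriv \<phi> t =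
        L2_inner \<Omega> (u t) \<eta> * deriv \<phi> t + c * (L2_inner \<Omega> (v t) \<eta> * deriv \<phi> t)"
      using V.Bochner_L2D(2)[OF u(1)] V.Bochner_L2D(2)[OF v(1)]
      by eventually_elim (simp add: H.ip_bilinear H.mem \<eta> distrib_right)
    show "(\<lambda>t. L2_inner \<Omega> ((u + c *\<^sub>R v) t) \<eta> * deriv \<phi> t) \<in> borel_measurable M"
      by (intro borel_measurable_integrable integrable_test_function_mult[OF L2_inner_const_integrable[OF uv \<eta>] test_function_deriv[OF \<phi>]])
    show "(\<lambda>t. L2_inner \<Omega> (u t) \<eta> * deriv \<phi> t + c * (L2_inner \<Omega> (v t) \<eta> * deriv \<phi> t)) \<in> borel_measurable M"
      using ints(1,2) by (intro borel_measurable_integrable Bochner_Integration.integrable_add integrable_mult_right)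
  qed
  also have "\<dots> = (LINT t|M. L2_inner \<Omega> (u t) \<eta> * deriv \<phi> t) + c * (LINT t|M. L2_inner \<Omega> (v t) \<eta> * deriv \<phi> t)"
    using ints(1,2) by simp
  also have "\<dots> = - (LINT t|M. g t \<eta> * \<phi> t) - c * (LINT t|M. h t \<eta> * \<phi> t)"
    using u(3) v(3) \<eta> \<phi> unfolding has_weak_time_deriv_def by simp
  also have "\<dots> = - (LINT t|M. g t \<eta> * \<phi> t + c * (h t \<eta> * \<phi> t))"
    using ints(3,4) by simp
  also have "\<dots> = - (LINT t|M. (g + c *\<^sub>R h) t \<eta> * \<phi> t)"
    by (simp add: distrib_right mult.assoc)
  finally show "(LINT t|M. L2_inner \<Omega> ((u + c *\<^sub>R v) t) \<eta> * deriv \<phi> t) = - (LINT t|M. (g + c *\<^sub>R h) t \<eta> * \<phi> t)" .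
qed

lemma L2V_dual_mem: "g \<in> L2V_dual \<Omega> a T \<Longrightarrow> h \<in> L2V_dual \<Omega> a T \<Longrightarrow> g + c *\<^sub>R h \<in> L2V_dual \<Omega> a T"
  by (intro subspace_add subspace_scale V_dual.subspace_Bochner_L2)

lemma W_linear: "u \<in> W \<Longrightarrow> v \<in> W \<Longrightarrow> u + c *\<^sub>R v \<in> W"
  by (rule WI[OF L2V.mem_add[OF W_L2V L2V.mem_scale[OF W_L2V]]
        L2V_dual_mem[OF time_deriv(1) time_deriv(1)]
        has_weak_time_deriv_linear[OF W_L2V time_deriv W_L2V time_deriv]])

text \<open>The lift moves v_t from the dual of V into V, so that the time part of
  \<open>W_inner\<close> and the form \<open>b_hat\<close> both become
  \<open>L2V_inner\<close>.\<close>

definition lifted_deriv :: "(real \<Rightarrow> 'a \<Rightarrow> real) \<Rightarrow> real \<Rightarrow> 'a \<Rightarrow> real" where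
  "lifted_deriv v t = R (td v t)"

lemma lifted_deriv_L2V: "v \<in> W \<Longrightarrow> lifted_deriv v \<in> L2V \<Omega> a T"
  using riesz_L2V[OF time_deriv(1)] by (simp add: lifted_deriv_def[abs_def])

lemma riesz_lift_linear:
  assumes F: "F \<in> V_dual \<Omega> a" and G: "G \<in> V_dual \<Omega> a" and K: "K \<in> V_dual \<Omega> a"
    and zero: "V_dual_norm \<Omega> a (F - (G + c *\<^sub>R K)) = 0"
  shows "V_norm a (R F - (R G + c *\<^sub>R R K)) = 0"
proof (rule V_norm_eq_0I)
  show "R F - (R G + c *\<^sub>R R K) \<in> H10 \<Omega>" by (intro V.mem riesz_lift F G K)
  fix v assume v: "v \<in> H10 \<Omega>"
  have "F - (G + c *\<^sub>R K) \<in> V_dual \<Omega> a" by (intro V_dual_mem F G K)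
  from V_dual_bound[OF this v] zero have "F v - (G v + c * K v) = 0" by simp
  then show "a (R F - (R G + c *\<^sub>R R K)) v = 0"
    using v F G K by (simp add: V.ip_bilinear V.mem riesz_lift)
qed

text \<open>The derivative chosen for a combination and the combination of the chosen derivatives
  are both weak derivatives, hence equal up to seminorm zero; the lift preserves this.\<close>

lemma lifted_deriv_linear:
  assumes u: "u \<in> W" and v: "v \<in> W"
  shows "L2V_norm a T (lifted_deriv (u + c *\<^sub>R v) - (lifted_deriv u + c *\<^sub>R lifted_deriv v)) = 0"
proof (rule L2V_norm_eq_0I)
  note uv = W_linear[OF u v, of c]
  show "lifted_deriv (u + c *\<^sub>R v) - (lifted_deriv u + c *\<^sub>R lifted_deriv v) \<in> L2V \<Omega> a T"
    by (intro L2V.mem lifted_deriv_L2V u v uv)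
  have "AE t in M. V_dual_norm \<Omega> a (td (u + c *\<^sub>R v) t - (td u + c *\<^sub>R td v) t) = 0"
    by (rule weak_time_deriv_unique[OF time_deriv[OF uv] L2V_dual_mem[OF time_deriv(1) time_deriv(1)]
          has_weak_time_deriv_linear[OF W_L2V time_deriv W_L2V time_deriv]]) (rule u v)+
  then show "AE t in M. V_norm a ((lifted_deriv (u + c *\<^sub>R v) - (lifted_deriv u + c *\<^sub>R lifted_deriv v)) t) = 0"
    using L2V_dual_AE[OF time_deriv(1)[OF u]] L2V_dual_AE[OF time_deriv(1)[OF v]] L2V_dual_AE[OF time_deriv(1)[OF uv]]
  proof eventually_elim
    case (elim t)
    then show ?case using riesz_lift_linear[OF elim(4,2,3)] by (simp add: lifted_deriv_def)
  qed
qed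

lemma W_inner_eq: "W_inner \<Omega> a T u v = L2V_inner a T (lifted_deriv u) (lifted_deriv v) + L2V_inner a T u v"
  unfolding W_inner_def L2V_inner_def V_dual_inner_def lifted_deriv_def ..

lemma lifted_deriv_inner:
  assumes u: "u \<in> W" and v: "v \<in> W" and q: "q \<in> L2V \<Omega> a T"
  shows "L2V_inner a T (lifted_deriv (u + c *\<^sub>R v)) q = L2V_inner a T (lifted_deriv u) q + c * L2V_inner a T (lifted_deriv v) q"
proof -
  have "L2V_inner a T (lifted_deriv (u + c *\<^sub>R v)) q = L2V_inner a T (lifted_deriv u + c *\<^sub>R lifted_deriv v) q"
    by (intro L2V.ip_cong L2V.mem lifted_deriv_L2V W_linear u v q lifted_deriv_linear) (simp add: L2V.N_zero)
  then show ?thesis using lifted_deriv_L2V[OF u] lifted_deriv_L2V[OF v] q by (simp add: L2V.ip_bilinear L2V.mem)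
qed

lemma semi_inner_space_W: "semi_inner_space W (W_inner \<Omega> a T) (W_norm \<Omega> a T)"
proof (rule semi_inner_space.intro)
  have "has_weak_time_deriv \<Omega> T 0 0"
    unfolding has_weak_time_deriv_def using H.ip_zero_left by simp
  then have zero: "0 \<in> W" by (rule WI[OF L2V.mem_zero subspace_0[OF V_dual.subspace_Bochner_L2]])
  show "subspace W"
  proof (rule subspaceI)
    show "0 \<in> W" by (rule zero)
    show "u + v \<in> W" if "u \<in> W" "v \<in> W" for u v using W_linear[OF that, of 1] by simp
    show "c *\<^sub>R u \<in> W" if "u \<in> W" for c u using W_linear[OF zero that, of c] by simp
  qed
  show "W_inner \<Omega> a T u v = W_inner \<Omega> a T v u" if "u \<in> W" "v \<in> W" for u v
    unfolding W_inner_eq using that by (simp add: L2V.ip_sym[OF lifted_deriv_L2V lifted_deriv_L2V] L2V.ip_sym[OF W_L2V W_L2V])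
  show "W_inner \<Omega> a T (u + v) w = W_inner \<Omega> a T u w + W_inner \<Omega> a T v w" if "u \<in> W" "v \<in> W" "w \<in> W" for u v w
    unfolding W_inner_eq
    using lifted_deriv_inner[OF that(1,2) lifted_deriv_L2V[OF that(3)], of 1] L2V.ip_add_left[OF W_L2V W_L2V W_L2V] that by simp
  have scale: "L2V_inner a T (lifted_deriv (c *\<^sub>R u)) q = c * L2V_inner a T (lifted_deriv u) q"
    if "u \<in> W" "q \<in> L2V \<Omega> a T" for c u q
  proof -
    \<comment> \<open>The derivative chosen for 0 need not be the zero function. Additivity applied
      to 0 + 0 shows that its pairing with \<open>q\<close> is zero.\<close>
    have "L2V_inner a T (lifted_deriv (0 + 1 *\<^sub>R 0)) q = L2V_inner a T (lifted_deriv 0) q + 1 * L2V_inner a T (lifted_deriv 0) q"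
      by (rule lifted_deriv_inner[OF zero zero that(2)])
    then have "L2V_inner a T (lifted_deriv 0) q = 0" by simp
    then show ?thesis using lifted_deriv_inner[OF zero that, of c] by simp
  qed
  show "W_inner \<Omega> a T (c *\<^sub>R u) w = c * W_inner \<Omega> a T u w" if "u \<in> W" "w \<in> W" for c u w
    unfolding W_inner_eq
    using scale[OF that(1) lifted_deriv_L2V[OF that(2)]] L2V.ip_scale_left[OF W_L2V W_L2V] that
    by (simp add: distrib_left)
  show "0 \<le> W_inner \<Omega> a T u u" if "u \<in> W" for u
    unfolding W_inner_eq using L2V.ip_nonneg[OF lifted_deriv_L2V[OF that]] L2V.ip_nonneg[OF W_L2V[OF that]] by simp
  show "W_norm \<Omega> a T u = sqrt (W_inner \<Omega> a T u u)" for u by (rule W_norm_def)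
qed

sublocale W: semi_inner_space W "W_inner \<Omega> a T" "W_norm \<Omega> a T"
  by (rule semi_inner_space_W)

lemma W_norm_square:
  assumes "v \<in> W"
  shows "(W_norm \<Omega> a T v)\<^sup>2 = (L2V_norm a T (lifted_deriv v))\<^sup>2 + (L2V_norm a T v)\<^sup>2"
  using W.N_square[OF assms] L2V.N_square[OF lifted_deriv_L2V[OF assms]] L2V.N_square[OF W_L2V[OF assms]]
  by (simp add: W_inner_eq)

lemma L2V_norm_le_W_norm: "v \<in> W \<Longrightarrow> L2V_norm a T v \<le> W_norm \<Omega> a T v"
  by (rule power2_le_imp_le[OF _ W.N_nonneg]) (simp_all add: W_norm_square)

lemma lifted_deriv_norm_le_W_norm: "v \<in> W \<Longrightarrow> L2V_norm a T (lifted_deriv v) \<le> W_norm \<Omega> a T v"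
  by (rule power2_le_imp_le[OF _ W.N_nonneg]) (simp_all add: W_norm_square)

lemma b_hat_eq: "v \<in> W \<Longrightarrow> q \<in> L2V \<Omega> a T \<Longrightarrow> b_hat \<Omega> a T v q = L2V_inner a T (lifted_deriv v) q"
  unfolding b_hat_def lifted_deriv_def[abs_def] by (rule dual_pairing_eq[OF time_deriv(1)])

section \<open>Continuous representatives and the trace bound\<close>

definition energy_density :: "(real \<Rightarrow> 'a \<Rightarrow> real) \<Rightarrow> real \<Rightarrow> real" where
  "energy_density v t = (V_norm a (lifted_deriv v t))\<^sup>2 + (V_norm a (v t))\<^sup>2"

lemma energy_density_integrable:
  assumes "v \<in> W"
  shows "integrable M (energy_density v)" "(LINT t|M. energy_density v t) = (W_norm \<Omega> a T v)\<^sup>2"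
proof -
  note i = V.Bochner_L2D(3)[OF lifted_deriv_L2V[OF assms]] V.Bochner_L2D(3)[OF W_L2V[OF assms]]
  show "integrable M (energy_density v)"
    unfolding energy_density_def[abs_def] using i by (rule Bochner_Integration.integrable_add)
  have sq: "(LINT t|M. (V_norm a (u t))\<^sup>2) = (L2V_norm a T u)\<^sup>2" if u: "u \<in> L2V \<Omega> a T" for u
  proof -
    have "(LINT t|M. (V_norm a (u t))\<^sup>2) = (LINT t|M. a (u t) (u t))"
    proof (rule integral_cong_AE)
      show "AE t in M. (V_norm a (u t))\<^sup>2 = a (u t) (u t)"
        using V.Bochner_L2D(2)[OF u] by eventually_elim (rule V.N_square)
    qed (intro borel_measurable_integrable V.Bochner_L2D(3)[OF u] V.Bochner_L2_ip_integrable[OF u u])+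
    then show ?thesis using L2V.N_square[OF u] by (simp add: L2V_inner_def)
  qed
  show "(LINT t|M. energy_density v t) = (W_norm \<Omega> a T v)\<^sup>2"
    unfolding energy_density_def W_norm_square[OF assms]
    using i sq[OF lifted_deriv_L2V[OF assms]] sq[OF W_L2V[OF assms]] by simp
qed

lemma V_norm_integrable:
  assumes u: "u \<in> L2V \<Omega> a T"
  shows "integrable M (\<lambda>t. V_norm a (u t))"
proof (rule Bochner_Integration.integrable_bound)
  show "integrable M (\<lambda>t. 1 + (V_norm a (u t))\<^sup>2)"
    by (intro Bochner_Integration.integrable_add integrable_const_Ioo V.Bochner_L2D(3)[OF u])
  have "(\<lambda>t. sqrt (a (u t) (u t))) \<in> borel_measurable M"
    using V.Bochner_L2_ip_measurable[OF u u] by measurable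
  then show "(\<lambda>t. V_norm a (u t)) \<in> borel_measurable M" by (simp add: V_norm_def)
  show "AE t in M. norm (V_norm a (u t)) \<le> norm (1 + (V_norm a (u t))\<^sup>2)"
  proof (rule AE_I2)
    fix t
    have "0 \<le> (\<bar>V_norm a (u t)\<bar> - 1)\<^sup>2" "0 \<le> (V_norm a (u t))\<^sup>2" by simp_all
    then show "norm (V_norm a (u t)) \<le> norm (1 + (V_norm a (u t))\<^sup>2)"
      by (simp add: power2_diff)
  qed
qed

text \<open>Only countably many test elements \<open>\<eta>\<close> can be handled at once almost everywhere; those
  approximating the values of \<open>v\<close> suffice, since \<open>v\<close> is almost separably valued.\<close>

lemma W_increment_bound:
  assumes v: "v \<in> W"
  obtains S where "S \<subseteq> {0<..<T}" "AE t in M. t \<in> S" "\<And>t. t \<in> S \<Longrightarrow> v t \<in> H10 \<Omega>"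
    "\<And>s t r. s \<in> S \<Longrightarrow> t \<in> S \<Longrightarrow> r \<in> S \<Longrightarrow> s < t \<Longrightarrow> \<bar>L2_inner \<Omega> (v t - v s) (v r)\<bar> \<le>
      V_norm a (v r) * (primitive T (\<lambda>\<tau>. V_norm a (lifted_deriv v \<tau>)) t - primitive T (\<lambda>\<tau>. V_norm a (lifted_deriv v \<tau>)) s)"
proof -
  define \<rho> where "\<rho> = primitive T (\<lambda>\<tau>. V_norm a (lifted_deriv v \<tau>))"
  note vL = W_L2V[OF v] and gL = time_deriv(1)[OF v]
  have \<rho>_int: "integrable M (\<lambda>\<tau>. V_norm a (lifted_deriv v \<tau>))"
    by (rule V_norm_integrable[OF lifted_deriv_L2V[OF v]])
  have "\<exists>c. AE t in M. L2_inner \<Omega> (v t) \<eta> = c + primitive T (\<lambda>\<tau>. td v \<tau> \<eta>) t" if \<eta>: "\<eta> \<in> H10 \<Omega>" for \<eta>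
    unfolding primitive_def
  proof (rule weak_derivative_imp_indefinite_integral[OF T_pos])
    show "integrable M (\<lambda>t. L2_inner \<Omega> (v t) \<eta>)" by (rule L2_inner_const_integrable[OF vL \<eta>])
    show "integrable M (\<lambda>t. td v t \<eta>)" by (rule pairing_const_integrable[OF gL \<eta>])
    show "(LINT t|M. L2_inner \<Omega> (v t) \<eta> * deriv \<phi> t) = - (LINT t|M. td v t \<eta> * \<phi> t)"
      if "\<phi> \<in> test_functions {0<..<T}" for \<phi>
      using time_deriv(2)[OF v] \<eta> that unfolding has_weak_time_deriv_def by blast
  qed
  \<comment> \<open>One integration constant for each test element; it cancels in the
    increments.\<close>
  then have "\<exists>c. \<forall>\<eta>\<in>H10 \<Omega>. AE t in M. L2_inner \<Omega> (v t) \<eta> = c \<eta> + primitive T (\<lambda>\<tau>. td v \<tau> \<eta>) t"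
    by (intro bchoice ballI)
  then obtain c where c: "\<And>\<eta>. \<eta> \<in> H10 \<Omega> \<Longrightarrow> AE t in M. L2_inner \<Omega> (v t) \<eta> = c \<eta> + primitive T (\<lambda>\<tau>. td v \<tau> \<eta>) t"
    by blast
  obtain D where D: "countable D" "D \<subseteq> H10 \<Omega>"
    "AE t in M. \<exists>s. (\<forall>k. s k \<in> D) \<and> (\<lambda>k::nat. V_norm a (s k - v t)) \<longlonglongrightarrow> 0"
    by (rule V.strongly_measurable_separable[OF V.Bochner_L2D(1)[OF vL]]) blast
  define S where "S = {t \<in> {0<..<T}. v t \<in> H10 \<Omega> \<and>
    (\<forall>\<eta>\<in>D. L2_inner \<Omega> (v t) \<eta> = c \<eta> + primitive T (\<lambda>\<tau>. td v \<tau> \<eta>) t) \<and>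
    (\<exists>s. (\<forall>k. s k \<in> D) \<and> (\<lambda>k::nat. V_norm a (s k - v t)) \<longlonglongrightarrow> 0)}"
  have S_H10: "v t \<in> H10 \<Omega>" if "t \<in> S" for t using that by (simp add: S_def)
  have "AE t in M. \<forall>\<eta>\<in>D. L2_inner \<Omega> (v t) \<eta> = c \<eta> + primitive T (\<lambda>\<tau>. td v \<tau> \<eta>) t"
    unfolding AE_ball_countable[OF D(1)] using c D(2) by blast
  moreover have "AE t in M. t \<in> {0<..<T}" by (rule AE_I2) simp
  ultimately have "AE t in M. t \<in> S"
    using D(3) V.Bochner_L2D(2)[OF vL]
  proof eventually_elim
    case (elim t)
    then show ?case unfolding S_def by blast
  qed
  moreover have "S \<subseteq> {0<..<T}" by (auto simp: S_def)
  moreover have "\<bar>L2_inner \<Omega> (v t - v s) (v r)\<bar> \<le> V_norm a (v r) * (\<rho> t - \<rho> s)"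
    if s: "s \<in> S" and t: "t \<in> S" and r: "r \<in> S" and "s < t" for s t r
  proof -
    note sX = S_H10[OF s] and tX = S_H10[OF t] and rX = S_H10[OF r]
    have on_D: "\<bar>L2_inner \<Omega> (v t - v s) \<eta>\<bar> \<le> V_norm a \<eta> * (\<rho> t - \<rho> s)" if \<eta>: "\<eta> \<in> D" for \<eta>
    proof -
      have \<eta>': "\<eta> \<in> H10 \<Omega>" using \<eta> D(2) by blast
      note g_int = pairing_const_integrable[OF gL \<eta>']
      have "L2_inner \<Omega> (v t - v s) \<eta> = L2_inner \<Omega> (v t) \<eta> - L2_inner \<Omega> (v s) \<eta>"
        by (rule H.ip_diff_left[OF tX sX \<eta>'])
      also have "\<dots> = primitive T (\<lambda>\<tau>. td v \<tau> \<eta>) t - primitive T (\<lambda>\<tau>. td v \<tau> \<eta>) s"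
        using s t \<eta> by (simp add: S_def)
      also have "\<dots> = (LINT \<tau>|M. indicator {s..<t} \<tau> * td v \<tau> \<eta>)"
        by (rule primitive_diff(1)[OF g_int less_imp_le[OF \<open>s < t\<close>]])
      finally have "\<bar>L2_inner \<Omega> (v t - v s) \<eta>\<bar> \<le> (LINT \<tau>|M. \<bar>indicator {s..<t} \<tau> * td v \<tau> \<eta>\<bar>)"
        using integral_abs_bound[of M "\<lambda>\<tau>. indicator {s..<t} \<tau> * td v \<tau> \<eta>"] by simp
      also have "\<dots> \<le> (LINT \<tau>|M. V_norm a \<eta> * (indicator {s..<t} \<tau> * V_norm a (lifted_deriv v \<tau>)))"
      proof (rule integral_mono_AE)
        show "integrable M (\<lambda>\<tau>. \<bar>indicator {s..<t} \<tau> * td v \<tau> \<eta>\<bar>)"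
          by (rule integrable_abs[OF primitive_diff(2)[OF g_int less_imp_le[OF \<open>s < t\<close>]]])
        show "integrable M (\<lambda>\<tau>. V_norm a \<eta> * (indicator {s..<t} \<tau> * V_norm a (lifted_deriv v \<tau>)))"
          by (intro integrable_mult_right primitive_diff(2)[OF \<rho>_int less_imp_le[OF \<open>s < t\<close>]])
        show "AE \<tau> in M. \<bar>indicator {s..<t} \<tau> * td v \<tau> \<eta>\<bar> \<le> V_norm a \<eta> * (indicator {s..<t} \<tau> * V_norm a (lifted_deriv v \<tau>))"
          using L2V_dual_AE[OF gL]
        proof eventually_elim
          case (elim \<tau>)
          then show ?case
            using V_dual_bound[OF elim \<eta>'] by (simp add: lifted_deriv_def V_norm_riesz_lift indicator_def mult.commute)
        qed
      qed
      also have "\<dots> = V_norm a \<eta> * (\<rho> t - \<rho> s)"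
        unfolding \<rho>_def primitive_diff(1)[OF \<rho>_int less_imp_le[OF \<open>s < t\<close>]] by simp
      finally show ?thesis .
    qed
    obtain x where x: "\<And>k. x k \<in> D" "(\<lambda>k::nat. V_norm a (x k - v r)) \<longlonglongrightarrow> 0"
      using r unfolding S_def by blast
    have xX: "x k \<in> H10 \<Omega>" for k using x(1) D(2) by blast
    obtain C where C: "C > 0" "\<And>u. u \<in> H10 \<Omega> \<Longrightarrow> L2_norm \<Omega> u \<le> C * V_norm a u" by (rule L2_norm_le_V_norm) blast
    have b: "norm (L2_norm \<Omega> (x k - v r)) \<le> C * V_norm a (x k - v r)" for k
      using C(2)[OF V.mem_diff[OF xX rX]] H.N_nonneg[OF V.mem_diff[OF xX rX]] by simp
    have xH: "(\<lambda>k. L2_norm \<Omega> (x k - v r)) \<longlonglongrightarrow> 0"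
      by (rule Lim_null_comparison[OF always_eventually[OF allI[OF b]] tendsto_mult_right_zero[OF x(2)]])
    note tsX = V.mem_diff[OF tX sX]
    have "(\<lambda>k. L2_inner \<Omega> (v t - v s) (x k)) \<longlonglongrightarrow> L2_inner \<Omega> (v t - v s) (v r)"
      by (rule H.tendsto_ip[OF tsX tsX _ xX rX xH]) (simp add: H.N_zero)
    then have "(\<lambda>k. \<bar>L2_inner \<Omega> (v t - v s) (x k)\<bar>) \<longlonglongrightarrow> \<bar>L2_inner \<Omega> (v t - v s) (v r)\<bar>"
      by (rule tendsto_rabs)
    moreover have "(\<lambda>k. V_norm a (x k) * (\<rho> t - \<rho> s)) \<longlonglongrightarrow> V_norm a (v r) * (\<rho> t - \<rho> s)"
      by (intro tendsto_mult tendsto_const V.tendsto_N[OF xX rX x(2)])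
    ultimately show ?thesis by (rule LIMSEQ_le) (use on_D x(1) in blast)
  qed
  ultimately show ?thesis using that S_H10 unfolding \<rho>_def by blast
qed

text \<open>Two conditions have content. \<open>young\<close> integrates 2 * c * x \<le> c^2 + x^2,
  where x is the norm of the lifted derivative. \<open>good_point\<close> holds because a function
  cannot exceed its mean almost everywhere on an interval of positive length.\<close>

lemma W_trace_curve:
  assumes v: "v \<in> W"
  obtains S where "AE t in M. t \<in> S" "\<And>t. t \<in> S \<Longrightarrow> v t \<in> H10 \<Omega>"
    "trace_curve (L2 \<Omega>) (L2_inner \<Omega>) (L2_norm \<Omega>) v (\<lambda>t. V_norm a (v t))
      (primitive T (\<lambda>\<tau>. V_norm a (lifted_deriv v \<tau>))) (primitive T (energy_density v)) S T"
proof -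
  obtain S where S: "S \<subseteq> {0<..<T}" "AE t in M. t \<in> S" "\<And>t. t \<in> S \<Longrightarrow> v t \<in> H10 \<Omega>"
    "\<And>s t r. s \<in> S \<Longrightarrow> t \<in> S \<Longrightarrow> r \<in> S \<Longrightarrow> s < t \<Longrightarrow> \<bar>L2_inner \<Omega> (v t - v s) (v r)\<bar> \<le>
      V_norm a (v r) * (primitive T (\<lambda>\<tau>. V_norm a (lifted_deriv v \<tau>)) t - primitive T (\<lambda>\<tau>. V_norm a (lifted_deriv v \<tau>)) s)"
    by (rule W_increment_bound[OF v]) blast
  let ?\<rho> = "\<lambda>\<tau>. V_norm a (lifted_deriv v \<tau>)"
  note \<rho>_int = V_norm_integrable[OF lifted_deriv_L2V[OF v]]
  note \<mu>_int = energy_density_integrable(1)[OF v]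
  have \<mu>_nonneg: "0 \<le> energy_density v t" for t by (simp add: energy_density_def)
  have "trace_curve (L2 \<Omega>) (L2_inner \<Omega>) (L2_norm \<Omega>) v (\<lambda>t. V_norm a (v t))
      (primitive T ?\<rho>) (primitive T (energy_density v)) S T"
  proof (intro trace_curve.intro semi_inner_space_L2 trace_curve_axioms.intro)
    show "v t \<in> L2 \<Omega>" if "t \<in> S" for t by (rule H10_L2[OF S(3)[OF that]])
    show "S \<subseteq> {0<..<T}" by (rule S(1))
    show "0 \<le> V_norm a (v t)" if "t \<in> S" for t by (rule V.N_nonneg[OF S(3)[OF that]])
    show "\<bar>L2_inner \<Omega> (v t - v s) (v r)\<bar> \<le> V_norm a (v r) * (primitive T ?\<rho> t - primitive T ?\<rho> s)"
      if "s \<in> S" "t \<in> S" "r \<in> S" "s < t" for s t r by (rule S(4)[OF that])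
    show "c * (primitive T ?\<rho> t - primitive T ?\<rho> s) \<le>
        (c\<^sup>2 * (t - s) + (primitive T (energy_density v) t - primitive T (energy_density v) s)) / 2"
      if "0 \<le> c" "0 \<le> s" "s \<le> t" "t \<le> T" for c s t
    proof -
      have ic: "integrable M (\<lambda>\<tau>. indicator {s..<t} \<tau> * c\<^sup>2)"
        by (rule primitive_diff(2)[OF integrable_const_Ioo that(3)])
      note i\<rho> = primitive_diff[OF \<rho>_int that(3)] and i\<mu> = primitive_diff[OF \<mu>_int that(3)]
      have "c * (primitive T ?\<rho> t - primitive T ?\<rho> s) = (LINT \<tau>|M. c * (indicator {s..<t} \<tau> * ?\<rho> \<tau>))"
        unfolding i\<rho>(1) by simp
      also have "\<dots> \<le> (LINT \<tau>|M. (indicator {s..<t} \<tau> * c\<^sup>2 + indicator {s..<t} \<tau> * energy_density v \<tau>) / 2)"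
      proof (rule integral_mono)
        show "integrable M (\<lambda>\<tau>. c * (indicator {s..<t} \<tau> * ?\<rho> \<tau>))"
          by (intro integrable_mult_right i\<rho>(2))
        show "integrable M (\<lambda>\<tau>. (indicator {s..<t} \<tau> * c\<^sup>2 + indicator {s..<t} \<tau> * energy_density v \<tau>) / 2)"
          by (intro integrable_divide_zero impI Bochner_Integration.integrable_add ic i\<mu>(2))
        fix \<tau>
        have "2 * c * ?\<rho> \<tau> \<le> c\<^sup>2 + (?\<rho> \<tau>)\<^sup>2" by (rule sum_squares_bound)
        also have "\<dots> \<le> c\<^sup>2 + energy_density v \<tau>" by (simp add: energy_density_def)
        finally show "c * (indicator {s..<t} \<tau> * ?\<rho> \<tau>) \<le> (indicator {s..<t} \<tau> * c\<^sup>2 + indicator {s..<t} \<tau> * energy_density v \<tau>) / 2"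
          by (simp add: indicator_def)
      qed
      also have "\<dots> = ((LINT \<tau>|M. indicator {s..<t} \<tau> * c\<^sup>2) + (LINT \<tau>|M. indicator {s..<t} \<tau> * energy_density v \<tau>)) / 2"
        using Bochner_Integration.integral_add[OF ic i\<mu>(2)] by simp
      also have "\<dots> = (c\<^sup>2 * (t - s) + (primitive T (energy_density v) t - primitive T (energy_density v) s)) / 2"
        unfolding i\<mu>(1) integral_indicator_Ico[OF that(2-4)] ..
      finally show ?thesis .
    qed
    show "\<exists>r\<in>S. s < r \<and> r < t \<and> (V_norm a (v r))\<^sup>2 * (t - s) \<le> primitive T (energy_density v) t - primitive T (energy_density v) s"
      if st: "0 \<le> s" "s < t" "t \<le> T" for s t
    proof (rule ccontr)
      assume neg: "\<not> ?thesis"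
      \<comment> \<open>The mean energy over the interval. If the claim fails, the energy density
        lies above it almost everywhere there.\<close>
      define \<kappa> where "\<kappa> = (primitive T (energy_density v) t - primitive T (energy_density v) s) / (t - s)"
      have le: "s \<le> t" using st by simp
      note i\<mu> = primitive_diff[OF \<mu>_int le]
      have ic: "integrable M (\<lambda>\<tau>. indicator {s..<t} \<tau> * c)" for c :: real
        by (rule primitive_diff(2)[OF integrable_const_Ioo le])
      \<comment> \<open>Primitives integrate over {s..<t}, whereas good points are sought in the
        open interval.\<close>
      have "AE \<tau> in M. \<tau> \<noteq> s" by (rule AE_lebesgue_on_neq)
      then have big: "AE \<tau> in M. \<tau> \<in> {s..<t} \<longrightarrow> \<kappa> < energy_density v \<tau>"
        using S(2)
      proof eventually_elim
        case (elim \<tau>)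
        show ?case
        proof
          assume "\<tau> \<in> {s..<t}"
          then have "primitive T (energy_density v) t - primitive T (energy_density v) s < (V_norm a (v \<tau>))\<^sup>2 * (t - s)"
            using neg elim by force
          then have "\<kappa> < (V_norm a (v \<tau>))\<^sup>2" using st by (simp add: \<kappa>_def divide_less_eq)
          also have "\<dots> \<le> energy_density v \<tau>" by (simp add: energy_density_def)
          finally show "\<kappa> < energy_density v \<tau>" .
        qed
      qed
      have id: "integrable M (\<lambda>\<tau>. indicator {s..<t} \<tau> * energy_density v \<tau> - indicator {s..<t} \<tau> * \<kappa>)"
        by (intro Bochner_Integration.integrable_diff i\<mu>(2) ic)
      have "(LINT \<tau>|M. indicator {s..<t} \<tau> * energy_density v \<tau> - indicator {s..<t} \<tau> * \<kappa>) =
          (primitive T (energy_density v) t - primitive T (energy_density v) s) - \<kappa> * (t - s)"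
        unfolding Bochner_Integration.integral_diff[OF i\<mu>(2) ic] i\<mu>(1)[symmetric] integral_indicator_Ico[OF st(1) le st(3)] ..
      also have "\<dots> = 0" using st by (simp add: \<kappa>_def)
      finally have "AE \<tau> in M. indicator {s..<t} \<tau> * energy_density v \<tau> - indicator {s..<t} \<tau> * \<kappa> = 0"
        by (subst (asm) integral_nonneg_eq_0_iff_AE[OF id])
           (use big in \<open>auto elim!: eventually_mono simp: indicator_def\<close>)
      then have "AE \<tau> in M. indicator {s..<t} \<tau> * (1::real) = 0"
        using big by eventually_elim (auto simp: indicator_def)
      then have "(LINT \<tau>|M. indicator {s..<t} \<tau> * (1::real)) = (LINT \<tau>|M. 0)"
        by (intro integral_cong_AE borel_measurable_integrable[OF ic]) auto
      then show False using integral_indicator_Ico[OF st(1) le st(3), of 1] st by simp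
    qed
    show "primitive T ?\<rho> s \<le> primitive T ?\<rho> t" if "0 \<le> s" "s \<le> t" "t \<le> T" for s t
    proof (rule primitive_mono[OF \<rho>_int _ that(2)])
      show "AE \<tau> in M. 0 \<le> ?\<rho> \<tau>"
        using V.Bochner_L2D(2)[OF lifted_deriv_L2V[OF v]] by eventually_elim (rule V.N_nonneg)
    qed
    show "primitive T (energy_density v) s \<le> primitive T (energy_density v) t" if "0 \<le> s" "s \<le> t" "t \<le> T" for s t
      by (rule primitive_mono[OF \<mu>_int AE_I2[OF \<mu>_nonneg] that(2)])
    show "continuous_on {0..T} (primitive T ?\<rho>)" by (rule primitive_continuous[OF \<rho>_int])
    show "continuous_on {0..T} (primitive T (energy_density v))" by (rule primitive_continuous[OF \<mu>_int])
  qed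
  then show ?thesis using that S(2,3) by blast
qed

text \<open>The condition under the \<open>SOME\<close> of \<open>cont_rep\<close>, named so that
  existence and uniqueness can be stated for arbitrary candidates.\<close>

definition is_cont_rep :: "(real \<Rightarrow> 'a \<Rightarrow> real) \<Rightarrow> (real \<Rightarrow> 'a \<Rightarrow> real) \<Rightarrow> bool" where
  "is_cont_rep v u \<longleftrightarrow>
     (\<forall>s\<in>{0..T}. u s \<in> L2 \<Omega> \<and> ((\<lambda>t. L2_norm \<Omega> (u t - u s)) \<longlongrightarrow> 0) (at s within {0..T})) \<and>
     (AE t in M. L2_norm \<Omega> (v t - u t) = 0)"

text \<open>The bound is shown for the representative built by \<open>extension\<close>; uniqueness
  passes it on to the chosen \<open>cont_rep\<close> in \<open>trace_bound\<close>.\<close>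

lemma cont_rep_exists:
  obtains C where "C > 0" "\<And>v. v \<in> W \<Longrightarrow> \<exists>u. is_cont_rep v u \<and> (\<forall>s\<in>{0..T}. L2_norm \<Omega> (u s) \<le> C * W_norm \<Omega> a T v)"
proof -
  obtain B where B: "B > 0" "\<And>u. u \<in> H10 \<Omega> \<Longrightarrow> L2_norm \<Omega> u \<le> B * V_norm a u" by (rule L2_norm_le_V_norm) blast
  \<comment> \<open>A good point of the whole interval has V-norm at most the W-norm divided by sqrt
    T, and \<open>B\<close> passes to the H-norm. The modulus of continuity contributes sqrt 56 on
    the way to any other time.\<close>
  define C where "C = B / sqrt T + sqrt 56"
  have "C > 0" unfolding C_def using B(1) T_pos by (intro add_pos_pos) auto
  moreover have "\<exists>u. is_cont_rep v u \<and> (\<forall>s\<in>{0..T}. L2_norm \<Omega> (u s) \<le> C * W_norm \<Omega> a T v)" if v: "v \<in> W" for v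
  proof -
    let ?\<mu> = "primitive T (energy_density v)"
    obtain S where S: "AE t in M. t \<in> S" "\<And>t. t \<in> S \<Longrightarrow> v t \<in> H10 \<Omega>"
      and tc: "trace_curve (L2 \<Omega>) (L2_inner \<Omega>) (L2_norm \<Omega>) v (\<lambda>t. V_norm a (v t))
        (primitive T (\<lambda>\<tau>. V_norm a (lifted_deriv v \<tau>))) ?\<mu> S T"
      by (rule W_trace_curve[OF v]) blast
    interpret curve: trace_curve "L2 \<Omega>" "L2_inner \<Omega>" "L2_norm \<Omega>" v "\<lambda>t. V_norm a (v t)"
        "primitive T (\<lambda>\<tau>. V_norm a (lifted_deriv v \<tau>))" ?\<mu> S T by (rule tc)
    obtain u where u: "\<And>s. s \<in> {0..T} \<Longrightarrow> u s \<in> L2 \<Omega>"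
      "\<And>s t. s \<in> {0..T} \<Longrightarrow> t \<in> S \<Longrightarrow> L2_norm \<Omega> (u s - v t) \<le> sqrt (56 * \<bar>?\<mu> s - ?\<mu> t\<bar>)"
      "\<And>s t. s \<in> {0..T} \<Longrightarrow> t \<in> {0..T} \<Longrightarrow> L2_norm \<Omega> (u s - u t) \<le> sqrt (56 * \<bar>?\<mu> s - ?\<mu> t\<bar>)"
      by (rule curve.extension[OF L2_complete T_pos]) blast
    have S_Icc: "t \<in> {0..T}" if "t \<in> S" for t using curve.S_bounds[OF that] by simp
    have "((\<lambda>t. L2_norm \<Omega> (u t - u s)) \<longlongrightarrow> 0) (at s within {0..T})" if s: "s \<in> {0..T}" for s
    proof (rule Lim_null_comparison)
      show "\<forall>\<^sub>F t in at s within {0..T}. norm (L2_norm \<Omega> (u t - u s)) \<le> sqrt (56 * \<bar>?\<mu> t - ?\<mu> s\<bar>)"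
        unfolding eventually_at_filter
      proof (intro always_eventually allI impI)
        fix t assume t: "t \<in> {0..T}"
        show "norm (L2_norm \<Omega> (u t - u s)) \<le> sqrt (56 * \<bar>?\<mu> t - ?\<mu> s\<bar>)"
          using u(3)[OF t s] L2.N_nonneg[OF L2.mem_diff[OF u(1)[OF t] u(1)[OF s]]] by simp
      qed
      have "(?\<mu> \<longlongrightarrow> ?\<mu> s) (at s within {0..T})" using curve.\<mu>_cont s by (simp add: continuous_on_def)
      then have "((\<lambda>t. sqrt (56 * \<bar>?\<mu> t - ?\<mu> s\<bar>)) \<longlongrightarrow> sqrt (56 * \<bar>?\<mu> s - ?\<mu> s\<bar>)) (at s within {0..T})"
        by (intro tendsto_real_sqrt tendsto_mult tendsto_rabs tendsto_diff tendsto_const)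
      then show "((\<lambda>t. sqrt (56 * \<bar>?\<mu> t - ?\<mu> s\<bar>)) \<longlongrightarrow> 0) (at s within {0..T})" by simp
    qed
    moreover have "AE t in M. L2_norm \<Omega> (v t - u t) = 0"
      using S(1)
    proof eventually_elim
      case (elim t)
      have X: "u t \<in> L2 \<Omega>" "v t \<in> L2 \<Omega>" using u(1)[OF S_Icc[OF elim]] H10_L2[OF S(2)[OF elim]] .
      show ?case
        using u(2)[OF S_Icc[OF elim] elim] L2.N_nonneg[OF L2.mem_diff[OF X]] L2.N_minus_commute[OF X] by simp
    qed
    ultimately have "is_cont_rep v u" using u(1) by (simp add: is_cont_rep_def)
    moreover have "L2_norm \<Omega> (u s) \<le> C * W_norm \<Omega> a T v" if s: "s \<in> {0..T}" for s
    proof -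
      note total = primitive_total[OF energy_density_integrable(1)[OF v], unfolded energy_density_integrable(2)[OF v]]
      obtain r where r: "r \<in> S" "(V_norm a (v r))\<^sup>2 * (T - 0) \<le> ?\<mu> T - ?\<mu> 0"
        using curve.good_point[of 0 T] T_pos by auto
      have W0: "0 \<le> W_norm \<Omega> a T v" by (rule W.N_nonneg[OF v])
      have rX: "v r \<in> H10 \<Omega>" by (rule S(2)[OF r(1)])
      have "(V_norm a (v r))\<^sup>2 \<le> (W_norm \<Omega> a T v / sqrt T)\<^sup>2"
        using r(2) T_pos unfolding total by (simp add: power_divide field_simps)
      then have "V_norm a (v r) \<le> W_norm \<Omega> a T v / sqrt T"
        by (rule power2_le_imp_le) (use W0 T_pos in simp)
      then have "L2_norm \<Omega> (v r) \<le> B * (W_norm \<Omega> a T v / sqrt T)"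
        using B(2)[OF rX] mult_left_mono[OF _ less_imp_le[OF B(1)]] order_trans by blast
      moreover have "L2_norm \<Omega> (u s - v r) \<le> sqrt 56 * W_norm \<Omega> a T v"
      proof -
        have "?\<mu> 0 \<le> ?\<mu> s" "?\<mu> s \<le> ?\<mu> T" "?\<mu> 0 \<le> ?\<mu> r" "?\<mu> r \<le> ?\<mu> T"
          using s curve.S_bounds[OF r(1)] by (auto intro!: curve.\<mu>_mono)
        then have "\<bar>?\<mu> s - ?\<mu> r\<bar> \<le> (W_norm \<Omega> a T v)\<^sup>2" using total by argo
        then have "sqrt (56 * \<bar>?\<mu> s - ?\<mu> r\<bar>) \<le> sqrt (56 * (W_norm \<Omega> a T v)\<^sup>2)" by simp
        also have "\<dots> = sqrt 56 * W_norm \<Omega> a T v" using W0 by (simp add: real_sqrt_mult)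
        finally show ?thesis using u(2)[OF s r(1)] by linarith
      qed
      moreover have "L2_norm \<Omega> (u s) \<le> L2_norm \<Omega> (u s - v r) + L2_norm \<Omega> (v r)"
        using L2.N_triangle[OF L2.mem_diff[OF u(1)[OF s] H10_L2[OF rX]] H10_L2[OF rX]] by simp
      ultimately show ?thesis unfolding C_def by (simp add: distrib_right)
    qed
    ultimately show ?thesis by blast
  qed
  ultimately show ?thesis using that by blast
qed

lemma is_cont_rep_cont_rep:
  assumes "v \<in> W"
  shows "is_cont_rep v (cont_rep \<Omega> T v)"
proof -
  obtain C where "\<And>v. v \<in> W \<Longrightarrow> \<exists>u. is_cont_rep v u \<and> (\<forall>s\<in>{0..T}. L2_norm \<Omega> (u s) \<le> C * W_norm \<Omega> a T v)"
    by (rule cont_rep_exists) blast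
  then have "\<exists>u. is_cont_rep v u" using assms by blast
  then show ?thesis unfolding cont_rep_def is_cont_rep_def by (rule someI_ex)
qed

lemma cont_rep_L2: "v \<in> W \<Longrightarrow> s \<in> {0..T} \<Longrightarrow> cont_rep \<Omega> T v s \<in> L2 \<Omega>"
  using is_cont_rep_cont_rep unfolding is_cont_rep_def by blast

text \<open>If the two differed at \<open>s\<close>, continuity would keep them apart on an interval
  of positive length next to \<open>s\<close>, one-sided at the end points. This contradicts their
  agreement with \<open>v\<close> almost everywhere.\<close>

lemma is_cont_rep_unique:
  assumes v: "v \<in> W" and u: "is_cont_rep v u" and w: "is_cont_rep v w" and s: "s \<in> {0..T}"
  shows "L2_norm \<Omega> (u s - w s) = 0"
proof -
  have uL: "u t \<in> L2 \<Omega>" and wL: "w t \<in> L2 \<Omega>" if "t \<in> {0..T}" for t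
    using u w that unfolding is_cont_rep_def by blast+
  define F where "F = at s within {0..T}"
  have lim: "((\<lambda>t. L2_norm \<Omega> (u t - u s) + L2_norm \<Omega> (w t - w s)) \<longlongrightarrow> 0 + 0) F"
    using u w s unfolding is_cont_rep_def F_def by (intro tendsto_add) blast+
  have zero: "AE t in M. L2_norm \<Omega> (u t - w t) = 0"
  proof -
    have "AE t in M. t \<in> {0<..<T}" by (rule AE_I2) simp
    moreover have "AE t in M. L2_norm \<Omega> (v t - u t) = 0" "AE t in M. L2_norm \<Omega> (v t - w t) = 0"
      using u w unfolding is_cont_rep_def by blast+
    ultimately show ?thesis
      using V.Bochner_L2D(2)[OF W_L2V[OF v]]
    proof eventually_elim
      case (elim t)
      then have t: "t \<in> {0..T}" by simp
      note X = uL[OF t] wL[OF t] H10_L2[OF elim(4)]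
      have "L2_norm \<Omega> (u t - w t) \<le> L2_norm \<Omega> (u t - v t) + L2_norm \<Omega> (v t - w t)"
        by (rule L2.N_triangle_diff[OF X(1,3,2)])
      then show ?case
        using elim L2.N_minus_commute[OF X(1,3)] L2.N_nonneg[OF L2.mem_diff[OF X(1,2)]] by simp
    qed
  qed
  show ?thesis
  proof (rule ccontr)
    assume "L2_norm \<Omega> (u s - w s) \<noteq> 0"
    then have pos: "L2_norm \<Omega> (u s - w s) > 0" using L2.N_nonneg[OF L2.mem_diff[OF uL[OF s] wL[OF s]]] by simp
    have "\<forall>\<^sub>F t in F. L2_norm \<Omega> (u t - u s) + L2_norm \<Omega> (w t - w s) < L2_norm \<Omega> (u s - w s)"
      using order_tendstoD(2)[OF lim] pos by simp
    then obtain \<delta> where \<delta>: "\<delta> > 0"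
      "\<And>t. t \<in> {0..T} \<Longrightarrow> t \<noteq> s \<Longrightarrow> dist t s < \<delta> \<Longrightarrow> L2_norm \<Omega> (u t - u s) + L2_norm \<Omega> (w t - w s) < L2_norm \<Omega> (u s - w s)"
      unfolding F_def eventually_at by blast
    define p q where "p = max 0 (s - \<delta>)" and "q = min T (s + \<delta>)"
    have pq: "0 \<le> p" "p < q" "q \<le> T" using s \<delta>(1) T_pos by (auto simp: p_def q_def)
    have "AE t in M. t \<noteq> s \<and> t \<noteq> p"
      by (intro AE_conjI AE_lebesgue_on_neq)
    then have "AE t in M. indicator {p..<q} t * (1::real) = 0"
      using zero
    proof eventually_elim
      case (elim t)
      show ?case
      proof (rule ccontr)
        assume "indicator {p..<q} t * (1::real) \<noteq> 0"
        then have "t \<in> {p..<q}" by (simp add: indicator_def split: if_splits)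
        then have t: "t \<in> {0..T}" "dist t s < \<delta>" using elim(1) by (auto simp: p_def q_def dist_real_def abs_less_iff)
        note X = uL[OF s] uL[OF t(1)] wL[OF t(1)] wL[OF s]
        have "L2_norm \<Omega> (u s - w s) \<le> L2_norm \<Omega> (u s - u t) + L2_norm \<Omega> (u t - w s)"
          by (rule L2.N_triangle_diff[OF X(1,2,4)])
        also have "L2_norm \<Omega> (u t - w s) \<le> L2_norm \<Omega> (u t - w t) + L2_norm \<Omega> (w t - w s)"
          by (rule L2.N_triangle_diff[OF X(2,3,4)])
        finally show False
          using \<delta>(2)[OF t(1) conjunct1[OF elim(1)] t(2)] elim(2) L2.N_minus_commute[OF X(1,2)] by linarith
      qed
    qed
    then have "(LINT t|M. indicator {p..<q} t * (1::real)) = (LINT t|M. 0)"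
      by (intro integral_cong_AE borel_measurable_integrable primitive_diff(2)[OF integrable_const_Ioo less_imp_le[OF pq(2)]]) auto
    then show False using integral_indicator_Ico[OF pq(1) less_imp_le[OF pq(2)] pq(3), of 1] pq by simp
  qed
qed

lemma trace_bound:
  obtains C where "C > 0" "\<And>v s. v \<in> W \<Longrightarrow> s \<in> {0..T} \<Longrightarrow> L2_norm \<Omega> (cont_rep \<Omega> T v s) \<le> C * W_norm \<Omega> a T v"
proof -
  obtain C where C: "C > 0" "\<And>v. v \<in> W \<Longrightarrow> \<exists>u. is_cont_rep v u \<and> (\<forall>s\<in>{0..T}. L2_norm \<Omega> (u s) \<le> C * W_norm \<Omega> a T v)"
    by (rule cont_rep_exists) blast
  have "L2_norm \<Omega> (cont_rep \<Omega> T v s) \<le> C * W_norm \<Omega> a T v" if v: "v \<in> W" and s: "s \<in> {0..T}" for v s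
  proof -
    obtain u where u: "is_cont_rep v u" "\<forall>s\<in>{0..T}. L2_norm \<Omega> (u s) \<le> C * W_norm \<Omega> a T v" using C(2)[OF v] by blast
    have uL: "u s \<in> L2 \<Omega>" using u(1) s unfolding is_cont_rep_def by blast
    have "L2_norm \<Omega> (cont_rep \<Omega> T v s - u s) = 0"
      by (rule is_cont_rep_unique[OF v is_cont_rep_cont_rep[OF v] u(1) s])
    then have "L2_norm \<Omega> (cont_rep \<Omega> T v s) = L2_norm \<Omega> (u s)"
      using L2.N_abs_diff_le[OF cont_rep_L2[OF v s] uL] by simp
    then show ?thesis using u(2) s by simp
  qed
  then show ?thesis using that C(1) by blast
qed

text \<open>Subtracting the chosen representatives gives a continuous representative of u - v, so
  uniqueness identifies it with the chosen one at each time.\<close>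

lemma cont_rep_diff:
  assumes u: "u \<in> W" and v: "v \<in> W" and s: "s \<in> {0..T}"
  shows "L2_norm \<Omega> (cont_rep \<Omega> T (u - v) s - (cont_rep \<Omega> T u s - cont_rep \<Omega> T v s)) = 0"
proof (rule is_cont_rep_unique[OF W.mem_diff[OF u v] is_cont_rep_cont_rep[OF W.mem_diff[OF u v]] _ s])
  let ?u = "cont_rep \<Omega> T u" and ?v = "cont_rep \<Omega> T v"
  show "is_cont_rep (u - v) (\<lambda>s. ?u s - ?v s)"
    unfolding is_cont_rep_def
  proof (intro conjI ballI)
    fix s assume s: "s \<in> {0..T}"
    show "?u s - ?v s \<in> L2 \<Omega>" by (intro L2.mem_diff cont_rep_L2 u v s)
    have lim: "((\<lambda>t. L2_norm \<Omega> (?u t - ?u s) + L2_norm \<Omega> (?v t - ?v s)) \<longlongrightarrow> 0) (at s within {0..T})"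
      using tendsto_add[of "\<lambda>t. L2_norm \<Omega> (?u t - ?u s)" 0 "at s within {0..T}" "\<lambda>t. L2_norm \<Omega> (?v t - ?v s)" 0]
        is_cont_rep_cont_rep[OF u] is_cont_rep_cont_rep[OF v] s unfolding is_cont_rep_def by simp
    show "((\<lambda>t. L2_norm \<Omega> (?u t - ?v t - (?u s - ?v s))) \<longlongrightarrow> 0) (at s within {0..T})"
    proof (rule Lim_null_comparison[OF _ lim])
      show "\<forall>\<^sub>F t in at s within {0..T}. norm (L2_norm \<Omega> (?u t - ?v t - (?u s - ?v s))) \<le> L2_norm \<Omega> (?u t - ?u s) + L2_norm \<Omega> (?v t - ?v s)"
        unfolding eventually_at_filter
      proof (intro always_eventually allI impI)
        fix t assume t: "t \<in> {0..T}"
        have X: "?u t - ?u s \<in> L2 \<Omega>" "?v t - ?v s \<in> L2 \<Omega>" by (intro L2.mem_diff cont_rep_L2 u v s t)+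
        have eq: "?u t - ?v t - (?u s - ?v s) = (?u t - ?u s) - (?v t - ?v s)" by simp
        show "norm (L2_norm \<Omega> (?u t - ?v t - (?u s - ?v s))) \<le> L2_norm \<Omega> (?u t - ?u s) + L2_norm \<Omega> (?v t - ?v s)"
          unfolding eq using L2.N_diff_le[OF X] L2.N_nonneg[OF L2.mem_diff[OF X]] by simp
      qed
    qed
  next
    have "AE t in M. t \<in> {0<..<T}" by (rule AE_I2) simp
    moreover have "AE t in M. L2_norm \<Omega> (u t - ?u t) = 0" "AE t in M. L2_norm \<Omega> (v t - ?v t) = 0"
      using is_cont_rep_cont_rep[OF u] is_cont_rep_cont_rep[OF v] unfolding is_cont_rep_def by blast+
    ultimately show "AE t in M. L2_norm \<Omega> ((u - v) t - (?u t - ?v t)) = 0"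
      using V.Bochner_L2D(2)[OF W_L2V[OF u]] V.Bochner_L2D(2)[OF W_L2V[OF v]]
    proof eventually_elim
      case (elim t)
      then have t: "t \<in> {0..T}" by simp
      have X: "u t - ?u t \<in> L2 \<Omega>" "v t - ?v t \<in> L2 \<Omega>"
        by (rule L2.mem_diff[OF H10_L2[OF elim(4)] cont_rep_L2[OF u t]] L2.mem_diff[OF H10_L2[OF elim(5)] cont_rep_L2[OF v t]])+
      have eq: "(u - v) t - (?u t - ?v t) = (u t - ?u t) - (v t - ?v t)" by simp
      show ?case
        unfolding eq using L2.N_diff_le[OF X] L2.N_nonneg[OF L2.mem_diff[OF X]] elim by simp
    qed
  qed
qed

end

section \<open>Quasi-optimality\<close>

lemma (in semi_inner_space) weakly_convergesI:
  assumes x: "\<And>k. x k \<in> X" and l: "l \<in> X" and lim: "(\<lambda>k. N (x k - l)) \<longlonglongrightarrow> 0"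
  shows "weakly_converges X N x l"
  unfolding weakly_converges_def
proof (intro conjI allI ballI x l)
  fix F assume F: "F \<in> dual_space X N"
  then obtain C where C: "\<And>v. v \<in> X \<Longrightarrow> \<bar>F v\<bar> \<le> C * N v" unfolding dual_space_def by blast
  have b: "norm (F (x k) - F l) \<le> C * N (x k - l)" for k
  proof -
    have "F ((x k - l) + l) = F (x k - l) + F l"
      using F mem_diff[OF x l] l unfolding dual_space_def linear_functional_on_def by blast
    then show ?thesis using C[OF mem_diff[OF x[of k] l]] by simp
  qed
  have "(\<lambda>k. F (x k) - F l) \<longlonglongrightarrow> 0"
    by (rule Lim_null_comparison[OF always_eventually[OF allI[OF b]] tendsto_mult_right_zero[OF lim]])
  then show "(\<lambda>k. F (x k)) \<longlonglongrightarrow> F l" by (simp add: LIM_zero_iff)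
qed

text \<open>The numbers are \<open>E = \<parallel>e\<parallel>\<close> in \<open>W(0,T)\<close>, \<open>G = \<parallel>e\<^sub>t\<parallel>\<close>, \<open>V = \<parallel>e\<parallel>\<close>
  and \<open>Q = \<parallel>\<eta>\<parallel>\<close> in the energy norms, for the discrete errors \<open>e\<close>, \<open>\<eta>\<close>;
  \<open>\<delta>\<close> is the error of best approximation.\<close>

lemma stability_arithmetic:
  fixes E G V Q \<delta> K C :: real
  assumes nonneg: "0 \<le> E" "0 \<le> G" "0 \<le> V" "0 \<le> Q" "0 \<le> \<delta>" "0 \<le> C" and K: "1 \<le> K"
    and E: "E\<^sup>2 = G\<^sup>2 + V\<^sup>2" and G: "G \<le> C * (Q + \<delta>)" and energy: "V\<^sup>2 + Q\<^sup>2 \<le> K * \<delta> * E + \<delta> * Q"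
    and P: "P = (2 * C\<^sup>2 + 2) * K"
  shows "E\<^sup>2 + Q\<^sup>2 \<le> 2 * (P\<^sup>2 + P) * \<delta>\<^sup>2"
proof -
  have "G\<^sup>2 \<le> (C * (Q + \<delta>))\<^sup>2" using G nonneg by (intro power_mono) auto
  also have "\<dots> = C\<^sup>2 * (Q + \<delta>)\<^sup>2" by (simp add: power_mult_distrib)
  also have "\<dots> \<le> C\<^sup>2 * (2 * Q\<^sup>2 + 2 * \<delta>\<^sup>2)"
    using sum_squares_bound[of Q \<delta>] by (intro mult_left_mono) (auto simp: power2_sum)
  finally have G2: "G\<^sup>2 \<le> 2 * C\<^sup>2 * (Q\<^sup>2 + \<delta>\<^sup>2)" by (simp add: algebra_simps)
  define D where "D = K * \<delta> * E + \<delta> * Q"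
  have D: "V\<^sup>2 + Q\<^sup>2 \<le> D" using energy by (simp add: D_def)
  have "0 \<le> V\<^sup>2" "0 \<le> Q\<^sup>2" by simp_all
  then have Q2: "Q\<^sup>2 \<le> D" using D by linarith
  have "2 * C\<^sup>2 * (Q\<^sup>2 + \<delta>\<^sup>2) \<le> 2 * C\<^sup>2 * (D + \<delta>\<^sup>2)" using Q2 by (intro mult_left_mono) auto
  then have "E\<^sup>2 + Q\<^sup>2 \<le> 2 * C\<^sup>2 * (D + \<delta>\<^sup>2) + D" using G2 D E by linarith
  also have "\<dots> \<le> (2 * C\<^sup>2 + 2) * (D + \<delta>\<^sup>2)"
    using order_trans[OF \<open>0 \<le> Q\<^sup>2\<close> Q2] by (simp add: distrib_right)
  \<comment> \<open>Since K \<ge> 1, one factor \<open>K\<close> covers all three products with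
    \<delta>.\<close>
  also have "\<dots> \<le> (2 * C\<^sup>2 + 2) * (K * (\<delta> * (E + Q + \<delta>)))"
  proof (intro mult_left_mono)
    have "\<delta> * Q \<le> K * (\<delta> * Q)" "\<delta> * \<delta> \<le> K * (\<delta> * \<delta>)"
      using K nonneg mult_right_mono[of 1 K "\<delta> * Q"] mult_right_mono[of 1 K "\<delta> * \<delta>"] by auto
    then show "D + \<delta>\<^sup>2 \<le> K * (\<delta> * (E + Q + \<delta>))" by (simp add: D_def power2_eq_square algebra_simps)
  qed simp
  also have "\<dots> = P * \<delta> * E + P * \<delta> * Q + P * \<delta>\<^sup>2" by (simp add: P power2_eq_square algebra_simps)
  finally have "E\<^sup>2 + Q\<^sup>2 \<le> P * \<delta> * E + P * \<delta> * Q + P * \<delta>\<^sup>2" .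
  \<comment> \<open>Young's inequality moves half of E^2 + Q^2 to the left side; doubling the rest
    gives the factor 2 before P^2 + P.\<close>
  moreover have "2 * (P * \<delta>) * E \<le> (P * \<delta>)\<^sup>2 + E\<^sup>2" "2 * (P * \<delta>) * Q \<le> (P * \<delta>)\<^sup>2 + Q\<^sup>2"
    by (rule sum_squares_bound)+
  moreover have "2 * (P\<^sup>2 + P) * \<delta>\<^sup>2 = 2 * (P * \<delta>)\<^sup>2 + 2 * (P * \<delta>\<^sup>2)"
    by (simp add: power_mult_distrib algebra_simps)
  ultimately show ?thesis by argo
qed

context parabolic
begin

abbreviation "final_value v \<equiv> cont_rep \<Omega> T v T"

lemma final_value_L2: "v \<in> W \<Longrightarrow> final_value v \<in> L2 \<Omega>"
  using cont_rep_L2[of v T] T_pos by simp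

lemma a_hat_diff:
  assumes "u \<in> W" "v \<in> W" "w \<in> W"
  shows "a_hat \<Omega> a T (u - v) w = a_hat \<Omega> a T u w - a_hat \<Omega> a T v w"
proof -
  have "L2_inner \<Omega> (final_value (u - v)) (final_value w) = L2_inner \<Omega> (final_value u - final_value v) (final_value w)"
    using T_pos
    by (intro L2.ip_cong final_value_L2 L2.mem_diff W.mem_diff assms cont_rep_diff) (auto simp: L2.N_zero)
  then show ?thesis
    using assms by (simp add: a_hat_def L2.ip_diff_left final_value_L2 L2V.ip_diff_left W_L2V)
qed

lemma b_hat_diff_left:
  assumes "u \<in> W" "v \<in> W" "q \<in> L2V \<Omega> a T"
  shows "b_hat \<Omega> a T (u - v) q = b_hat \<Omega> a T u q - b_hat \<Omega> a T v q"
  using lifted_deriv_inner[OF assms, of "-1"] assms by (simp add: b_hat_eq W.mem_diff)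

lemma b_hat_diff_right:
  assumes "u \<in> W" "p \<in> L2V \<Omega> a T" "q \<in> L2V \<Omega> a T"
  shows "b_hat \<Omega> a T u (p - q) = b_hat \<Omega> a T u p - b_hat \<Omega> a T u q"
  using assms by (simp add: b_hat_eq L2V.mem_diff L2V.ip_diff_right lifted_deriv_L2V)

lemma b_hat_bound:
  assumes "u \<in> W" "q \<in> L2V \<Omega> a T"
  shows "\<bar>b_hat \<Omega> a T u q\<bar> \<le> W_norm \<Omega> a T u * L2V_norm a T q"
proof -
  have "\<bar>b_hat \<Omega> a T u q\<bar> \<le> L2V_norm a T (lifted_deriv u) * L2V_norm a T q"
    unfolding b_hat_eq[OF assms] by (rule L2V.Cauchy_Schwarz[OF lifted_deriv_L2V[OF assms(1)] assms(2)])
  also have "\<dots> \<le> W_norm \<Omega> a T u * L2V_norm a T q"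
    by (intro mult_right_mono lifted_deriv_norm_le_W_norm L2V.N_nonneg assms)
  finally show ?thesis .
qed

text \<open>Since \<open>e\<^sub>t\<close> belongs to \<open>Q\<close>, testing \<open>\<parallel>e\<^sub>t\<parallel>\<^sup>2 = \<integral> \<langle>e\<^sub>t, R e\<^sub>t\<rangle>\<close> only
  sees the projection of \<open>R e\<^sub>t\<close> to \<open>Q\<close>.\<close>

lemma discrete_derivative_norm:
  assumes e: "e \<in> W" "time_deriv_in \<Omega> a T e Q" and Q: "fin_dim_subspace Q (L2V \<Omega> a T)"
    and C: "\<And>v. v \<in> L2V \<Omega> a T \<Longrightarrow> L2V_norm a T (L2_projection \<Omega> T Q v) \<le> C * L2V_norm a T v"
  obtains r where "r \<in> Q" "L2V_norm a T r \<le> C * L2V_norm a T (lifted_deriv e)"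
    "(L2V_norm a T (lifted_deriv e))\<^sup>2 = b_hat \<Omega> a T e r"
proof -
  interpret L2H: semi_inner_space "L2V \<Omega> a T" "L2H_inner \<Omega> T" "\<lambda>v. sqrt (L2H_inner \<Omega> T v v)"
    by (rule semi_inner_space_L2H)
  let ?g = "lifted_deriv e"
  note g = lifted_deriv_L2V[OF e(1)]
  obtain B where B: "finite B" "Q = span B" and Q_sub: "Q \<subseteq> L2V \<Omega> a T" using Q unfolding fin_dim_subspace_def by blast
  obtain q where q: "q \<in> Q" "AE t in M. \<forall>\<eta>\<in>H10 \<Omega>. td e t \<eta> = L2_inner \<Omega> (q t) \<eta>"
    using e(2) unfolding time_deriv_in_def by blast
  have qL: "q \<in> L2V \<Omega> a T" using q(1) Q_sub by blast
  \<comment> \<open>The representative \<open>q\<close> of e_t in \<open>Q\<close> turns the duality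
    pairing into the L2(0,T;H) product, which the projection preserves against elements of
    \<open>Q\<close>.\<close>
  have b_eq: "b_hat \<Omega> a T e v = L2H_inner \<Omega> T q v" if v: "v \<in> L2V \<Omega> a T" for v
    unfolding b_hat_def dual_pairing_def L2H_inner_def
  proof (rule integral_cong_AE)
    show "AE t in M. td e t (v t) = L2_inner \<Omega> (q t) (v t)"
      using q(2) V.Bochner_L2D(2)[OF v] by eventually_elim blast
    show "(\<lambda>t. td e t (v t)) \<in> borel_measurable M"
      by (rule borel_measurable_integrable[OF pairing_integrable[OF time_deriv(1)[OF e(1)] v]])
    show "(\<lambda>t. L2_inner \<Omega> (q t) (v t)) \<in> borel_measurable M"
      by (rule H.Bochner_L2_ip_measurable[OF L2V_L2H[OF qL] L2V_L2H[OF v]])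
  qed
  define r where "r = L2_projection \<Omega> T Q ?g"
  have "\<exists>r. r \<in> Q \<and> (\<forall>q\<in>Q. L2H_inner \<Omega> T r q = L2H_inner \<Omega> T ?g q)"
    using L2H.projection_span_exists[OF B(1) _ g] Q_sub unfolding B(2) by blast
  then have r: "r \<in> Q \<and> (\<forall>q\<in>Q. L2H_inner \<Omega> T r q = L2H_inner \<Omega> T ?g q)"
    unfolding r_def L2_projection_def by (rule someI_ex)
  then have rL: "r \<in> L2V \<Omega> a T" using Q_sub by blast
  have "(L2V_norm a T ?g)\<^sup>2 = b_hat \<Omega> a T e ?g"
    using L2V.N_square[OF g] b_hat_eq[OF e(1) g] by simp
  also have "\<dots> = L2H_inner \<Omega> T ?g q" using b_eq[OF g] L2H.ip_sym[OF qL g] by simp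
  also have "\<dots> = L2H_inner \<Omega> T r q" using r q(1) by simp
  also have "\<dots> = b_hat \<Omega> a T e r" using b_eq[OF rL] L2H.ip_sym[OF qL rL] by simp
  finally show ?thesis using that r C[OF g] unfolding r_def by blast
qed

text \<open>\<open>L\<close> is fixed before the discrete spaces and the solutions. It is built from
  \<open>C\<close> and the constant of the trace bound, so it is uniform in the mesh.\<close>

theorem quasi_optimality:
  assumes C: "C > 0"
  obtains L where "\<And>Wh Qh yh ph y p w q.
    fin_dim_subspace Wh W \<Longrightarrow> fin_dim_subspace Qh (L2V \<Omega> a T) \<Longrightarrow>
    (\<And>w. w \<in> Wh \<Longrightarrow> time_deriv_in \<Omega> a T w Qh) \<Longrightarrow>
    (\<And>v. v \<in> L2V \<Omega> a T \<Longrightarrow> L2V_norm a T (L2_projection \<Omega> T Qh v) \<le> C * L2V_norm a T v) \<Longrightarrow>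
    saddle_solution \<Omega> a T f y0 Wh Qh yh ph \<Longrightarrow> saddle_solution \<Omega> a T f y0 W (L2V \<Omega> a T) y p \<Longrightarrow>
    w \<in> Wh \<Longrightarrow> q \<in> Qh \<Longrightarrow>
    W_norm \<Omega> a T (yh - y) \<le> L * (W_norm \<Omega> a T (w - y) + L2V_norm a T (q - p)) \<and>
    L2V_norm a T (ph - p) \<le> L * (W_norm \<Omega> a T (w - y) + L2V_norm a T (q - p))"
proof -
  obtain B where B: "B > 0" "\<And>v s. v \<in> W \<Longrightarrow> s \<in> {0..T} \<Longrightarrow> L2_norm \<Omega> (cont_rep \<Omega> T v s) \<le> B * W_norm \<Omega> a T v"
    by (rule trace_bound) blast
  define K where "K = B\<^sup>2 + 1"
  define P where "P = (2 * C\<^sup>2 + 2) * K"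
  \<comment> \<open>The root comes from \<open>stability_arithmetic\<close>; the added 1 pays for
    the triangle inequality through the approximants.\<close>
  define L where "L = sqrt (2 * (P\<^sup>2 + P)) + 1"
  have K1: "1 \<le> K" by (simp add: K_def)
  have "W_norm \<Omega> a T (yh - y) \<le> L * (W_norm \<Omega> a T (w - y) + L2V_norm a T (q - p)) \<and>
    L2V_norm a T (ph - p) \<le> L * (W_norm \<Omega> a T (w - y) + L2V_norm a T (q - p))"
    if Wh: "fin_dim_subspace Wh W" and Qh: "fin_dim_subspace Qh (L2V \<Omega> a T)"
      and der: "\<And>w. w \<in> Wh \<Longrightarrow> time_deriv_in \<Omega> a T w Qh"
      and proj: "\<And>v. v \<in> L2V \<Omega> a T \<Longrightarrow> L2V_norm a T (L2_projection \<Omega> T Qh v) \<le> C * L2V_norm a T v"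
      and disc: "saddle_solution \<Omega> a T f y0 Wh Qh yh ph"
      and cont: "saddle_solution \<Omega> a T f y0 W (L2V \<Omega> a T) y p"
      and w: "w \<in> Wh" and q: "q \<in> Qh"
    for Wh Qh yh ph y p w q
  proof -
    have sub: "Wh \<subseteq> W" "Qh \<subseteq> L2V \<Omega> a T" "subspace Wh" "subspace Qh"
      using Wh Qh unfolding fin_dim_subspace_def by auto
    have yh: "yh \<in> Wh" "yh \<in> W" and ph: "ph \<in> Qh" "ph \<in> L2V \<Omega> a T"
      and y: "y \<in> W" and p: "p \<in> L2V \<Omega> a T" and w': "w \<in> W" and q': "q \<in> L2V \<Omega> a T"
      using disc cont w q sub(1,2) unfolding saddle_solution_def by blast+
    define e \<eta> \<alpha> \<beta> where "e = yh - w" and "\<eta> = ph - q" and "\<alpha> = y - w" and "\<beta> = p - q"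
    have e: "e \<in> Wh" "e \<in> W" and \<eta>: "\<eta> \<in> Qh" "\<eta> \<in> L2V \<Omega> a T"
      unfolding e_def \<eta>_def using sub yh ph w q by (blast intro: subspace_diff)+
    have \<alpha>: "\<alpha> \<in> W" and \<beta>: "\<beta> \<in> L2V \<Omega> a T"
      unfolding \<alpha>_def \<beta>_def by (intro W.mem_diff L2V.mem_diff y p w' q')+
    define E G V Q A D \<delta> where "E = W_norm \<Omega> a T e" and "G = L2V_norm a T (lifted_deriv e)"
      and "V = L2V_norm a T e" and "Q = L2V_norm a T \<eta>" and "A = W_norm \<Omega> a T \<alpha>" and "D = L2V_norm a T \<beta>"
      and "\<delta> = W_norm \<Omega> a T \<alpha> + L2V_norm a T \<beta>"
    have nonneg: "0 \<le> E" "0 \<le> G" "0 \<le> V" "0 \<le> Q" "0 \<le> A" "0 \<le> D"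
      unfolding E_def G_def V_def Q_def A_def D_def
      by (intro W.N_nonneg L2V.N_nonneg W_L2V lifted_deriv_L2V e \<eta> \<alpha> \<beta>)+
    have \<delta>: "\<delta> = A + D" "0 \<le> \<delta>" using nonneg by (simp_all add: \<delta>_def A_def D_def)
    \<comment> \<open>Galerkin orthogonality: both solutions satisfy the same equation for test
      functions in \<open>Wh\<close>, so the data cancel. The second equation is treated
      alike.\<close>
    have first: "a_hat \<Omega> a T e v + b_hat \<Omega> a T v \<eta> = a_hat \<Omega> a T \<alpha> v + b_hat \<Omega> a T v \<beta>" if "v \<in> Wh" for v
    proof -
      have v: "v \<in> W" using that sub by blast
      have "a_hat \<Omega> a T yh v + b_hat \<Omega> a T v ph = a_hat \<Omega> a T y v + b_hat \<Omega> a T v p"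
        using disc cont that v unfolding saddle_solution_def by simp
      then show ?thesis
        unfolding e_def \<eta>_def \<alpha>_def \<beta>_def a_hat_diff[OF yh(2) w' v] a_hat_diff[OF y w' v]
          b_hat_diff_right[OF v ph(2) q'] b_hat_diff_right[OF v p q'] by simp
    qed
    have second: "b_hat \<Omega> a T e v - L2V_inner a T \<eta> v = b_hat \<Omega> a T \<alpha> v - L2V_inner a T \<beta> v" if "v \<in> Qh" for v
    proof -
      have v: "v \<in> L2V \<Omega> a T" using that sub by blast
      have "b_hat \<Omega> a T yh v - L2V_inner a T ph v = b_hat \<Omega> a T y v - L2V_inner a T p v"
        using disc cont that v unfolding saddle_solution_def c_hat_def by simp
      then show ?thesis
        unfolding e_def \<eta>_def \<alpha>_def \<beta>_def b_hat_diff_left[OF yh(2) w' v] b_hat_diff_left[OF y w' v]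
          L2V.ip_diff_left[OF ph(2) q' v] L2V.ip_diff_left[OF p q' v] by simp
    qed
    \<comment> \<open>The trace bound acts here: each of the two final values costs a factor
      \<open>B\<close>, and the integral part adds the 1 in \<open>K\<close>.\<close>
    have a_hat_\<alpha>: "a_hat \<Omega> a T \<alpha> e \<le> K * (A * E)"
    proof -
      have "L2_inner \<Omega> (final_value \<alpha>) (final_value e) \<le> L2_norm \<Omega> (final_value \<alpha>) * L2_norm \<Omega> (final_value e)"
        using L2.Cauchy_Schwarz[OF final_value_L2[OF \<alpha>] final_value_L2[OF e(2)]] by linarith
      also have "\<dots> \<le> (B * A) * (B * E)"
        unfolding A_def E_def using T_pos B(1) W.N_nonneg[OF \<alpha>]
        by (intro mult_mono B(2) \<alpha> e L2.N_nonneg final_value_L2) auto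
      finally have 1: "L2_inner \<Omega> (final_value \<alpha>) (final_value e) \<le> B\<^sup>2 * (A * E)" by (simp add: power2_eq_square mult_ac)
      have "L2V_inner a T \<alpha> e \<le> L2V_norm a T \<alpha> * L2V_norm a T e"
        using L2V.Cauchy_Schwarz[OF W_L2V[OF \<alpha>] W_L2V[OF e(2)]] by linarith
      also have "\<dots> \<le> A * E"
        unfolding A_def E_def
        by (intro mult_mono L2V_norm_le_W_norm \<alpha> e W.N_nonneg L2V.N_nonneg W_L2V)
      finally show ?thesis using 1 by (simp add: a_hat_def K_def distrib_right)
    qed
    \<comment> \<open>Subtracting the second error equation, tested with \<eta>, from the first,
      tested with \<open>e\<close>, cancels the coupling of \<open>e\<close> and \<eta>. Both
      squares remain, together with the nonnegative square of the final value of
      \<open>e\<close>.\<close>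
    have "V\<^sup>2 + Q\<^sup>2 \<le> K * \<delta> * E + \<delta> * Q"
    proof -
      have "V\<^sup>2 \<le> a_hat \<Omega> a T e e"
        unfolding V_def a_hat_def using L2V.N_square[OF W_L2V[OF e(2)]] L2_inner_nonneg by simp
      moreover have "Q\<^sup>2 = L2V_inner a T \<eta> \<eta>" unfolding Q_def by (rule L2V.N_square[OF \<eta>(2)])
      moreover have "\<bar>b_hat \<Omega> a T e \<beta>\<bar> \<le> E * D" "\<bar>b_hat \<Omega> a T \<alpha> \<eta>\<bar> \<le> A * Q"
        unfolding E_def D_def A_def Q_def by (rule b_hat_bound[OF e(2) \<beta>] b_hat_bound[OF \<alpha> \<eta>(2)])+
      moreover have "\<bar>L2V_inner a T \<beta> \<eta>\<bar> \<le> D * Q"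
        unfolding D_def Q_def by (rule L2V.Cauchy_Schwarz[OF \<beta> \<eta>(2)])
      ultimately have "V\<^sup>2 + Q\<^sup>2 \<le> K * (A * E) + E * D + A * Q + D * Q"
        using first[OF e(1)] second[OF \<eta>(1)] a_hat_\<alpha> by argo
      also have "\<dots> \<le> K * (A * E) + K * (E * D) + A * Q + D * Q"
        using mult_right_mono[OF K1, of "E * D"] nonneg by simp
      also have "\<dots> = K * \<delta> * E + \<delta> * Q" by (simp add: \<delta>(1) algebra_simps)
      finally show ?thesis .
    qed
    \<comment> \<open>G^2 is expressed by the second error equation tested with \<open>r\<close>.
      The norm of \<open>r\<close> is at most C * G, so a factor G can be divided out unless it is
      zero.\<close>
    moreover have "G \<le> C * (Q + \<delta>)"
    proof -
      obtain r where r: "r \<in> Qh" "L2V_norm a T r \<le> C * G" "G\<^sup>2 = b_hat \<Omega> a T e r"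
        unfolding G_def by (rule discrete_derivative_norm[OF e(2) der[OF e(1)] Qh proj]) blast
      have rL: "r \<in> L2V \<Omega> a T" using r(1) sub by blast
      have "\<bar>L2V_inner a T \<eta> r\<bar> \<le> Q * L2V_norm a T r" "\<bar>L2V_inner a T \<beta> r\<bar> \<le> D * L2V_norm a T r"
        "\<bar>b_hat \<Omega> a T \<alpha> r\<bar> \<le> A * L2V_norm a T r"
        unfolding Q_def D_def A_def
        by (rule L2V.Cauchy_Schwarz[OF \<eta>(2) rL] L2V.Cauchy_Schwarz[OF \<beta> rL] b_hat_bound[OF \<alpha> rL])+
      then have "G\<^sup>2 \<le> Q * L2V_norm a T r + D * L2V_norm a T r + A * L2V_norm a T r"
        using r(3) second[OF r(1)] by argo
      also have "\<dots> = (Q + \<delta>) * L2V_norm a T r" by (simp add: \<delta>(1) algebra_simps)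
      also have "\<dots> \<le> (Q + \<delta>) * (C * G)" using r(2) nonneg \<delta> by (intro mult_left_mono) auto
      finally have "G * G \<le> (C * (Q + \<delta>)) * G" by (simp add: power2_eq_square mult_ac)
      then show ?thesis using nonneg \<delta> C by (cases "G = 0") auto
    qed
    moreover have "E\<^sup>2 = G\<^sup>2 + V\<^sup>2" unfolding E_def G_def V_def by (rule W_norm_square[OF e(2)])
    ultimately have main: "E\<^sup>2 + Q\<^sup>2 \<le> 2 * (P\<^sup>2 + P) * \<delta>\<^sup>2"
      using nonneg \<delta>(2) C K1 by (intro stability_arithmetic[where G = G and V = V and K = K and C = C]) (auto simp: P_def)
    have P0: "0 \<le> P" unfolding P_def K_def by simp
    have root: "sqrt (2 * (P\<^sup>2 + P) * \<delta>\<^sup>2) = (L - 1) * \<delta>"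
      using \<delta>(2) by (simp add: L_def real_sqrt_mult)
    have "0 \<le> E\<^sup>2" "0 \<le> Q\<^sup>2" by simp_all
    then have "E\<^sup>2 \<le> 2 * (P\<^sup>2 + P) * \<delta>\<^sup>2" "Q\<^sup>2 \<le> 2 * (P\<^sup>2 + P) * \<delta>\<^sup>2" using main by argo+
    then have EQ: "E \<le> (L - 1) * \<delta>" "Q \<le> (L - 1) * \<delta>" unfolding root[symmetric] by (auto intro: real_le_rsqrt)
    have sym: "W_norm \<Omega> a T (w - y) = A" "L2V_norm a T (q - p) = D"
      unfolding A_def D_def \<alpha>_def \<beta>_def by (rule W.N_minus_commute[OF w' y] L2V.N_minus_commute[OF q' p])+
    have "W_norm \<Omega> a T (yh - y) \<le> E + A"
      using W.N_triangle_diff[OF yh(2) w' y] sym unfolding E_def e_def by simp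
    moreover have "L2V_norm a T (ph - p) \<le> Q + D"
      using L2V.N_triangle_diff[OF ph(2) q' p] sym unfolding Q_def \<eta>_def by simp
    moreover have "L * (A + D) = (L - 1) * \<delta> + A + D" by (simp add: \<delta>(1) algebra_simps)
    ultimately show ?thesis unfolding sym using EQ nonneg by linarith
  qed
  then show ?thesis using that[of L] by blast
qed

end

theorem theorem3p11:
  fixes \<Omega> :: "(real ^ 'n) set"
    and a :: "(real ^ 'n) form"
    and T :: real
    and f :: "real \<Rightarrow> (real ^ 'n \<Rightarrow> real) \<Rightarrow> real"
    and y0 :: "real ^ 'n \<Rightarrow> real"
    and d :: "nat \<Rightarrow> real"
    and Wd Qd :: "real \<Rightarrow> (real \<Rightarrow> real ^ 'n \<Rightarrow> real) set"
    and yd pd :: "real \<Rightarrow> real \<Rightarrow> real ^ 'n \<Rightarrow> real"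
    and y p :: "real \<Rightarrow> real ^ 'n \<Rightarrow> real"
  assumes "CARD('n) \<in> {1, 2, 3}"
    and "open \<Omega>" and "bounded \<Omega>" and "connected \<Omega>" and "\<Omega> \<noteq> {}"
    and "T > 0"
    and "admissible_form \<Omega> a"
    and mesh: "\<And>k. d k > 0" "d \<longlonglongrightarrow> 0"
    and fin_dim: "\<And>k. fin_dim_subspace (Wd (d k)) (W_space \<Omega> a T)"
      "\<And>k. fin_dim_subspace (Qd (d k)) (L2V \<Omega> a T)"
    and approximation:
      "\<And>w q. w \<in> W_space \<Omega> a T \<Longrightarrow> q \<in> L2V \<Omega> a T \<Longrightarrow>
        \<exists>wd qd. (\<forall>k. wd k \<in> Wd (d k) \<and> qd k \<in> Qd (d k)) \<and>
          (\<lambda>k. W_norm \<Omega> a T (wd k - w)) \<longlonglongrightarrow> 0 \<and> (\<lambda>k. L2V_norm a T (qd k - q)) \<longlonglongrightarrow> 0"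
    and derivative: "\<And>k w. w \<in> Wd (d k) \<Longrightarrow> time_deriv_in \<Omega> a T w (Qd (d k))"
    and projection:
      "\<exists>C>0. \<forall>k. \<forall>v\<in>L2V \<Omega> a T. L2V_norm a T (L2_projection \<Omega> T (Qd (d k)) v) \<le> C * L2V_norm a T v"
    and "f \<in> L2V_dual \<Omega> a T" and "y0 \<in> L2 \<Omega>"
    and discrete:
      "\<And>k. saddle_solution \<Omega> a T f y0 (Wd (d k)) (Qd (d k)) (yd (d k)) (pd (d k))"
    and continuous: "saddle_solution \<Omega> a T f y0 (W_space \<Omega> a T) (L2V \<Omega> a T) y p"
  shows "weakly_converges (W_space \<Omega> a T) (W_norm \<Omega> a T) (\<lambda>k. yd (d k)) y \<and>
         weakly_converges (L2V \<Omega> a T) (L2V_norm a T) (\<lambda>k. pd (d k)) p"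
proof -
  interpret parabolic \<Omega> a T
    using assms by (intro parabolic.intro energy_space.intro bounded_domain.intro
        energy_space_axioms.intro parabolic_axioms.intro)
  obtain C where C: "C > 0"
    "\<And>k v. v \<in> L2V \<Omega> a T \<Longrightarrow> L2V_norm a T (L2_projection \<Omega> T (Qd (d k)) v) \<le> C * L2V_norm a T v"
    using projection by blast
  have y: "y \<in> W" and p: "p \<in> L2V \<Omega> a T" using continuous unfolding saddle_solution_def by blast+
  have ydk: "yd (d k) \<in> W" and pdk: "pd (d k) \<in> L2V \<Omega> a T" for k
    using discrete[of k] fin_dim[of k] unfolding saddle_solution_def fin_dim_subspace_def by blast+
  \<comment> \<open>Approximants of the exact solution itself serve as competitors in the
    quasi-optimal bound.\<close>
  obtain wd qd where wd: "\<And>k. wd k \<in> Wd (d k)" and qd: "\<And>k. qd k \<in> Qd (d k)"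
    and lim: "(\<lambda>k. W_norm \<Omega> a T (wd k - y)) \<longlonglongrightarrow> 0" "(\<lambda>k. L2V_norm a T (qd k - p)) \<longlonglongrightarrow> 0"
    using approximation[OF y p] by blast
  obtain L where L: "\<And>Wh Qh yh ph y p w q.
    fin_dim_subspace Wh W \<Longrightarrow> fin_dim_subspace Qh (L2V \<Omega> a T) \<Longrightarrow>
    (\<And>w. w \<in> Wh \<Longrightarrow> time_deriv_in \<Omega> a T w Qh) \<Longrightarrow>
    (\<And>v. v \<in> L2V \<Omega> a T \<Longrightarrow> L2V_norm a T (L2_projection \<Omega> T Qh v) \<le> C * L2V_norm a T v) \<Longrightarrow>
    saddle_solution \<Omega> a T f y0 Wh Qh yh ph \<Longrightarrow> saddle_solution \<Omega> a T f y0 W (L2V \<Omega> a T) y p \<Longrightarrow>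
    w \<in> Wh \<Longrightarrow> q \<in> Qh \<Longrightarrow>
    W_norm \<Omega> a T (yh - y) \<le> L * (W_norm \<Omega> a T (w - y) + L2V_norm a T (q - p)) \<and>
    L2V_norm a T (ph - p) \<le> L * (W_norm \<Omega> a T (w - y) + L2V_norm a T (q - p))"
    by (rule quasi_optimality[OF C(1)]) blast
  note est = L[OF fin_dim derivative C(2) discrete continuous wd qd]
  have est_lim: "(\<lambda>k. L * (W_norm \<Omega> a T (wd k - y) + L2V_norm a T (qd k - p))) \<longlonglongrightarrow> 0"
    using tendsto_add[OF lim] by (intro tendsto_mult_right_zero) simp
  have bW: "norm (W_norm \<Omega> a T (yd (d k) - y)) \<le> L * (W_norm \<Omega> a T (wd k - y) + L2V_norm a T (qd k - p))" for k
    using est[of k] W.N_nonneg[OF W.mem_diff[OF ydk y]] by simp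
  have bV: "norm (L2V_norm a T (pd (d k) - p)) \<le> L * (W_norm \<Omega> a T (wd k - y) + L2V_norm a T (qd k - p))" for k
    using est[of k] L2V.N_nonneg[OF L2V.mem_diff[OF pdk p]] by simp
  have "(\<lambda>k. W_norm \<Omega> a T (yd (d k) - y)) \<longlonglongrightarrow> 0"
    by (rule Lim_null_comparison[OF always_eventually[OF allI[OF bW]] est_lim])
  moreover have "(\<lambda>k. L2V_norm a T (pd (d k) - p)) \<longlonglongrightarrow> 0"
    by (rule Lim_null_comparison[OF always_eventually[OF allI[OF bV]] est_lim])
  ultimately show ?thesis
    by (intro conjI W.weakly_convergesI[OF ydk y] L2V.weakly_convergesI[OF pdk p])
qed

end
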